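(* Let $m\ge2$ and let $a$ be a free Borel action of the free group $\mathbb{F}_m$ on a standard probability space $(X,\mu)$ which is $\mu$-hyperfinite. Then every abstract system of congruences $E$ that is non-complementing and non-expanding has a realization for $a$ whose pieces are all $\mu$-measurable.
   Context: An abstract system of congruences on $n=\{0,\dots,n-1\}$ is an equivalence relation $E$ on the set $\mathcal{P}_{\mathrm{pr}}(n)$ of subsets of $n$ other than $\emptyset,n$, with $U\mathrel{E}V\Rightarrow\overline{U}\mathrel{E}\overline{V}$ ($\overline{U}=n\setminus U$). A realization of $E$ for an action of $\Gamma$ on $X$ is a partition $\{A_0,\dots,A_{n-1}\}$ of $X$ such that whenever $U\mathrel{E}V$ some $\gamma\in\Gamma$ has $\gamma\cdot\bigcup_{i\in U}A_i=\bigcup_{i\in V}A_i$. $E$ is non-complementing if no $U$ has $U\mathrel{E}\overline{U}$; non-expanding if there are no $k\ge0$ and $V_0,\dots,V_k,W_0,\dots,W_k$ with $V_i\mathrel{E}W_i$, $W_i\subset V_{i+1}$ ($i<k$), and $W_k\subsetneq V_0$. The action is $\mu$-hyperfinite if its orbit equivalence relation, restricted to some $\mu$-conull Borel set, is a countable increasing union of Borel equivalence relations with finite classes. *)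

theory Defs
  imports "HOL-Probability.Probability" "HOL-Algebra.Group_Action"
begin

section \<open>The free group of rank \<open>m\<close>\<close>

text \<open>
  The letter \<open>(i, True)\<close> stands for the \<open>i\<close>-th free generator and \<open>(i, False)\<close> for its inverse.
  Group elements are the reduced words; a product is the reduced form of the concatenation.
\<close>

type_synonym letter = "nat \<times> bool"

definition inv_letter :: "letter \<Rightarrow> letter" where
  "inv_letter x = (fst x, \<not> snd x)"

definition reduced_words :: "nat \<Rightarrow> letter list set" where
  "reduced_words m = {w. fst ` set w \<subseteq> {..<m} \<and> successively (\<lambda>x y. y \<noteq> inv_letter x) w}"

fun push_letter :: "letter \<Rightarrow> letter list \<Rightarrow> letter list" where
  "push_letter x [] = [x]"
| "push_letter x (y # w) = (if y = inv_letter x then w else x # y # w)"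

definition free_group :: "nat \<Rightarrow> letter list monoid" where
  "free_group m = \<lparr>carrier = reduced_words m, mult = foldr push_letter, one = []\<rparr>"

lemma inv_letter_inv_letter [simp]: "inv_letter (inv_letter x) = x"
  by (simp add: inv_letter_def)

lemma fst_inv_letter [simp]: "fst (inv_letter x) = fst x"
  by (simp add: inv_letter_def)

lemma Nil_reduced_words [simp]: "[] \<in> reduced_words m"
  by (simp add: reduced_words_def)

lemma reduced_words_ConsD: "x # w \<in> reduced_words m \<Longrightarrow> fst x < m \<and> w \<in> reduced_words m"
  by (cases w) (auto simp: reduced_words_def)

lemma push_letter_reduced:
  assumes "fst x < m" "w \<in> reduced_words m"
  shows "push_letter x w \<in> reduced_words m"
proof (cases w)
  case Nil
  then show ?thesis using assms by (simp add: reduced_words_def)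
next
  case (Cons y v)
  then show ?thesis
    using assms reduced_words_ConsD[of y v m] by (auto simp: reduced_words_def)
qed

lemma push_letter_cancel:
  assumes "w \<in> reduced_words m"
  shows "push_letter x (push_letter (inv_letter x) w) = w"
proof (cases w)
  case Nil
  then show ?thesis by simp
next
  case (Cons y v)
  then show ?thesis using assms by (cases v) (auto simp: reduced_words_def)
qed

lemma foldr_push_letter_reduced:
  assumes "fst ` set u \<subseteq> {..<m}" "w \<in> reduced_words m"
  shows "foldr push_letter u w \<in> reduced_words m"
  using assms by (induction u) (auto intro: push_letter_reduced)

lemma foldr_push_letter_push:
  assumes "w \<in> reduced_words m"
    and "fst ` set v \<subseteq> {..<m}"
  shows "foldr push_letter (push_letter x v) w = push_letter x (foldr push_letter v w)"
proof (cases v)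
  case Nil
  then show ?thesis by simp
next
  case (Cons y u)
  have "foldr push_letter u w \<in> reduced_words m"
    using assms Cons by (intro foldr_push_letter_reduced) auto
  then show ?thesis
    using Cons push_letter_cancel by (cases "y = inv_letter x") auto
qed

lemma foldr_push_letter_Nil: "w \<in> reduced_words m \<Longrightarrow> foldr push_letter w [] = w"
proof (induction w)
  case (Cons x w)
  then have "foldr push_letter w [] = w"
    using reduced_words_ConsD by blast
  then show ?case
    using Cons.prems by (cases w) (auto simp: reduced_words_def)
qed simp

lemma foldr_push_letter_assoc:
  assumes "fst ` set u \<subseteq> {..<m}" "v \<in> reduced_words m" "w \<in> reduced_words m"
  shows "foldr push_letter (foldr push_letter u v) w = foldr push_letter u (foldr push_letter v w)"
  using assms
proof (induction u)
  case (Cons x u)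
  have "foldr push_letter u v \<in> reduced_words m"
    using Cons.prems by (intro foldr_push_letter_reduced) auto
  then have "fst ` set (foldr push_letter u v) \<subseteq> {..<m}"
    by (simp add: reduced_words_def)
  then show ?case
    using Cons foldr_push_letter_push[of w m] by simp
qed simp

lemma foldr_push_letter_inverse:
  "w \<in> reduced_words m \<Longrightarrow>
    \<exists>v \<in> reduced_words m. foldr push_letter v w = []"
proof (induction w)
  case Nil
  then show ?case by (intro bexI[of _ "[]"]) auto
next
  case (Cons x w)
  note red = reduced_words_ConsD[OF Cons.prems]
  then obtain v where v: "v \<in> reduced_words m" "foldr push_letter v w = []"
    using Cons.IH by blast
  let ?x = "[inv_letter x]" and ?v = "foldr push_letter v [inv_letter x]"
  have x: "?x \<in> reduced_words m"
    using red by (simp add: reduced_words_def)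
  have "?v \<in> reduced_words m"
    using v(1) x by (intro foldr_push_letter_reduced) (auto simp: reduced_words_def)
  moreover have "foldr push_letter ?v (x # w) = foldr push_letter v (foldr push_letter ?x (x # w))"
    using v(1) x Cons.prems
    by (intro foldr_push_letter_assoc[of _ m]) (auto simp: reduced_words_def)
  ultimately show ?case using v(2) by auto
qed

lemma group_free_group: "group (free_group m)"
proof (rule groupI)
  fix u v w
  assume "u \<in> carrier (free_group m)" "v \<in> carrier (free_group m)" "w \<in> carrier (free_group m)"
  then show "u \<otimes>\<^bsub>free_group m\<^esub> v \<otimes>\<^bsub>free_group m\<^esub> w =
      u \<otimes>\<^bsub>free_group m\<^esub> (v \<otimes>\<^bsub>free_group m\<^esub> w)"
    by (auto simp: free_group_def reduced_words_def intro: foldr_push_letter_assoc[of _ m])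
next
  fix u v
  assume "u \<in> carrier (free_group m)" "v \<in> carrier (free_group m)"
  then show "u \<otimes>\<^bsub>free_group m\<^esub> v \<in> carrier (free_group m)"
    by (simp add: free_group_def) (rule foldr_push_letter_reduced, auto simp: reduced_words_def)
next
  fix w
  assume "w \<in> carrier (free_group m)"
  then show "\<exists>v\<in>carrier (free_group m). v \<otimes>\<^bsub>free_group m\<^esub> w = \<one>\<^bsub>free_group m\<^esub>"
    using foldr_push_letter_inverse by (simp add: free_group_def)
qed (simp_all add: free_group_def)


section \<open>Free Borel actions on standard probability spaces\<close>

definition standard_borel_space :: "'a measure \<Rightarrow> bool" where
  "standard_borel_space M \<longleftrightarrow>
    (\<exists>T. topspace T = space M \<and> completely_metrizable_space T \<and> second_countable T \<and>
         sets M = sigma_sets (space M) {U. openin T U})"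

definition standard_prob_space :: "'a measure \<Rightarrow> bool" where
  "standard_prob_space M \<longleftrightarrow> standard_borel_space M \<and> prob_space M"

text \<open>
  The groups below are countable and discrete, so measurability of each \<open>\<phi> g\<close> amounts to
  joint measurability of the action.
\<close>

definition borel_action :: "('g, 'r) monoid_scheme \<Rightarrow> 'a measure \<Rightarrow> ('g \<Rightarrow> 'a \<Rightarrow> 'a) \<Rightarrow> bool" where
  "borel_action G M \<phi> \<longleftrightarrow>
    group_action G (space M) \<phi> \<and> (\<forall>g \<in> carrier G. \<phi> g \<in> measurable M M)"

definition free_action :: "('g, 'r) monoid_scheme \<Rightarrow> 'a set \<Rightarrow> ('g \<Rightarrow> 'a \<Rightarrow> 'a) \<Rightarrow> bool" where
  "free_action G X \<phi> \<longleftrightarrow> (\<forall>x \<in> X. stabilizer G \<phi> x = {\<one>\<^bsub>G\<^esub>})"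

definition orbit_rel :: "('g, 'r) monoid_scheme \<Rightarrow> 'a set \<Rightarrow> ('g \<Rightarrow> 'a \<Rightarrow> 'a) \<Rightarrow> ('a \<times> 'a) set" where
  "orbit_rel G X \<phi> = {(x, y). x \<in> X \<and> y \<in> orbit G \<phi> x}"

definition mu_hyperfinite :: "('g, 'r) monoid_scheme \<Rightarrow> 'a measure \<Rightarrow> ('g \<Rightarrow> 'a \<Rightarrow> 'a) \<Rightarrow> bool" where
  "mu_hyperfinite G M \<phi> \<longleftrightarrow>
    (\<exists>Y \<in> sets M. space M - Y \<in> null_sets M \<and>
      (\<exists>F :: nat \<Rightarrow> ('a \<times> 'a) set. incseq F \<and>
         (\<forall>k. equiv Y (F k) \<and> F k \<in> sets (M \<Otimes>\<^sub>M M) \<and> (\<forall>x \<in> Y. finite (F k `` {x}))) \<and>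
         orbit_rel G (space M) \<phi> \<inter> Y \<times> Y = (\<Union>k. F k)))"


section \<open>Abstract systems of congruences\<close>

definition proper_subsets :: "nat \<Rightarrow> nat set set" where
  "proper_subsets n = Pow {..<n} - {{}, {..<n}}"

definition abstract_system :: "nat \<Rightarrow> (nat set \<times> nat set) set \<Rightarrow> bool" where
  "abstract_system n E \<longleftrightarrow>
    equiv (proper_subsets n) E \<and> (\<forall>U V. (U, V) \<in> E \<longrightarrow> ({..<n} - U, {..<n} - V) \<in> E)"

definition non_complementing :: "nat \<Rightarrow> (nat set \<times> nat set) set \<Rightarrow> bool" where
  "non_complementing n E \<longleftrightarrow> \<not> (\<exists>U. (U, {..<n} - U) \<in> E)"

definition non_expanding :: "(nat set \<times> nat set) set \<Rightarrow> bool" where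
  "non_expanding E \<longleftrightarrow>
    \<not> (\<exists>(k :: nat) (V :: nat \<Rightarrow> nat set) W.
         (\<forall>i \<le> k. (V i, W i) \<in> E) \<and> (\<forall>i < k. W i \<subseteq> V (Suc i)) \<and> W k \<subset> V 0)"

text \<open>
  \<^const>\<open>partition_on\<close> requires the pieces to be nonempty; together with injectivity of the
  indexing this says that \<open>A 0, \<dots>, A (n - 1)\<close> are nonempty, pairwise disjoint and cover \<open>X\<close>.
\<close>

definition realization ::
    "('g, 'r) monoid_scheme \<Rightarrow> 'a set \<Rightarrow> ('g \<Rightarrow> 'a \<Rightarrow> 'a) \<Rightarrow> nat \<Rightarrow> (nat set \<times> nat set) set \<Rightarrow>
     (nat \<Rightarrow> 'a set) \<Rightarrow> bool" where
  "realization G X \<phi> n E A \<longleftrightarrow>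
    inj_on A {..<n} \<and> partition_on X (A ` {..<n}) \<and>
    (\<forall>U V. (U, V) \<in> E \<longrightarrow> (\<exists>g \<in> carrier G. \<phi> g ` (\<Union>i\<in>U. A i) = (\<Union>i\<in>V. A i)))"

end

(*
The pieces are read off a labelling of the points by 0, ..., n - 1 that satisfies one local constraint
for each generator of a free subgroup of finite rank k of F_m.  With the generators chosen along a
star in each pair of complementary classes of E, non-complementation and non-expansion make the
constraints mixing: the labels at the two ends of a long reduced word can be prescribed independently.

Hyperfiniteness yields, on an invariant conull set, an invariant family of probability measures on the
vertices and ends of the trees that are the orbits of the subgroup.  Where no vertex splits its measure
into parts of mass at most 1/2, following the heavier side points every tree to a single end;
otherwise such vertices form a path, and every vertex is pointed to that path.  In both cases points of
a separated set, taken from a finite Borel colouring, serve as seeds whose label is fixed in advance.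
Every other point takes its label from the next point on its way to a seed.  The only edges not handled
this way start at a seed, and mixing along a path leading away from that seed lets them satisfy their
constraints as well.

The exceptional null set and one countable invariant set, which makes all pieces nonempty, are labelled
by choice, orbit by orbit: there the constraints can be propagated from a root of the tree.
*)
theory Submission
  imports Defs "HOL-Library.Nat_Bijection"
begin

section \<open>Relations along words\<close>

text \<open>Two obstacles shape the argument. Each congruence asks for one group element, so
  \<open>k\<close> generating congruences call for \<open>k\<close> independent generators even if
  \<open>m\<close> is 2; hence the passage to a subgroup. And orbits in general admit no measurable
  choice of a root, so labels cannot be propagated outwards: an orientation towards an end only
  gives a recursion that never starts. Seeds cut this recursion, at the price of edges whose two
  ends are labelled independently of each other, and this is what mixing has to absorb.

  The length \<open>3 * 2 ^ n + 3\<close> comes from a rank on sets of labels that is at most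
  \<open>2 ^ n\<close>, constant on classes and strictly increasing along proper inclusions;
  non-expansion provides it. Non-complementation allows one class of each complementary pair to be
  singled out.

  Hyperfiniteness yields uniform measures on finite classes, but these need not converge. Suitable
  convex combinations converge almost everywhere, and their limits are the potentials. The null set
  where this fails is labelled without regard to measurability, which is why the pieces are
  measurable for the completion.\<close>

primrec path_rel :: "(letter \<Rightarrow> ('b \<times> 'b) set) \<Rightarrow> letter list \<Rightarrow> ('b \<times> 'b) set" where
  "path_rel R [] = Id"
| "path_rel R (s # w) = path_rel R w O R s"

lemma reduced_words_Cons_iff:
  "s # w \<in> reduced_words k \<longleftrightarrow>
    fst s < k \<and> w \<in> reduced_words k \<and> (w \<noteq> [] \<longrightarrow> hd w \<noteq> inv_letter s)"
  by (cases w) (auto simp: reduced_words_def)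

text \<open>With \<open>i = fst s\<close>: if the labels of \<open>x\<close> and
  \<open>T s x\<close> are related for all \<open>x\<close>, the generator carries the union of the
  pieces labelled in \<open>A i\<close> onto the union of those labelled in \<open>B i\<close>.
  Swapping the two sets for an inverse letter turns the relation into its converse.\<close>

definition cong_rel :: "nat \<Rightarrow> (nat \<Rightarrow> nat set) \<Rightarrow> (nat \<Rightarrow> nat set) \<Rightarrow> letter \<Rightarrow> (nat \<times> nat) set" where
  "cong_rel n A B s = {(l, l'). l < n \<and> l' < n \<and>
     (if snd s then l \<in> A (fst s) \<longleftrightarrow> l' \<in> B (fst s) else l \<in> B (fst s) \<longleftrightarrow> l' \<in> A (fst s))}"

lemma cong_rel_inv_letter: "cong_rel n A B (inv_letter s) = (cong_rel n A B s)\<inverse>"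
  by (auto simp: cong_rel_def inv_letter_def)

lemma cong_rel_bounded: "cong_rel n A B s \<subseteq> {..<n} \<times> {..<n}"
  by (auto simp: cong_rel_def)

lemma cong_rel_total:
  assumes "A (fst s) \<in> proper_subsets n" "B (fst s) \<in> proper_subsets n" "l < n"
  shows "\<exists>l'. (l, l') \<in> cong_rel n A B s"
proof -
  have "\<exists>a<n. a \<in> U" "\<exists>a<n. a \<notin> U" if "U \<in> proper_subsets n" for U
    using that by (auto simp: proper_subsets_def)
  then show ?thesis
    using assms by (simp add: cong_rel_def) metis
qed

text \<open>A set that meets both the source and its complement reaches every label. Otherwise its
  image is again one of the sets occurring in the congruences, so that ranks can be
  compared.\<close>

lemma cong_rel_Image:
  assumes s: "A (fst s) \<in> proper_subsets n" "B (fst s) \<in> proper_subsets n"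
    and S: "S \<subseteq> {..<n}" "S \<noteq> {}"
  obtains (full) "cong_rel n A B s `` S = {..<n}"
  | (src) "S \<subseteq> (if snd s then A else B) (fst s)"
      "cong_rel n A B s `` S = (if snd s then B else A) (fst s)"
  | (compl) "S \<subseteq> {..<n} - (if snd s then A else B) (fst s)"
      "cong_rel n A B s `` S = {..<n} - (if snd s then B else A) (fst s)"
proof -
  have sub: "A (fst s) \<subseteq> {..<n}" "B (fst s) \<subseteq> {..<n}"
    using s by (auto simp: proper_subsets_def)
  define V where "V = (if snd s then A else B) (fst s)"
  define W where "W = (if snd s then B else A) (fst s)"
  have R: "cong_rel n A B s `` S = {l'. l' < n \<and> (\<exists>l\<in>S. l \<in> V \<longleftrightarrow> l' \<in> W)}"
    using S by (auto simp: cong_rel_def V_def W_def)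
  have sub': "V \<subseteq> {..<n}" "W \<subseteq> {..<n}" using sub by (auto simp: V_def W_def)
  consider "S \<subseteq> V" | "S \<subseteq> {..<n} - V" | a b where "a \<in> S" "b \<in> S" "a \<in> V" "b \<notin> V"
    using S by blast
  then show thesis
  proof cases
    case 1
    then have "cong_rel n A B s `` S = W" using S sub' unfolding R by blast
    then show ?thesis using 1 src unfolding V_def W_def by blast
  next
    case 2
    then have "cong_rel n A B s `` S = {..<n} - W" using S sub' unfolding R by blast
    then show ?thesis using 2 compl unfolding V_def W_def by blast
  next
    case 3
    then have "cong_rel n A B s `` S = {..<n}" using S sub' unfolding R by blast
    then show ?thesis using full by blast
  qed
qed

lemma proper_subsets_compl: "U \<in> proper_subsets n \<Longrightarrow> {..<n} - U \<in> proper_subsets n"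
  by (auto simp: proper_subsets_def)

lemma compl_compl_proper: "U \<in> proper_subsets n \<Longrightarrow> {..<n} - ({..<n} - U) = U"
  by (auto simp: proper_subsets_def)

lemma finite_proper_subsets: "finite (proper_subsets n)"
  by (simp add: proper_subsets_def)

section \<open>Mixing for non-expanding systems\<close>

text \<open>The rank of \<open>V\<close> counts the sets from which \<open>V\<close> can be reached
  by moves that replace a set by a congruent one and then enlarge it. Non-expansion forbids a return
  from \<open>V\<close> to a proper subset \<open>U\<close>, so \<open>V\<close> itself is counted
  for \<open>V\<close> but not for \<open>U\<close>. The bound is the number of all subsets.\<close>

lemma non_expanding_rank:
  assumes E: "abstract_system n E" and ne: "non_expanding E"
  shows "\<exists>\<rho> :: nat set \<Rightarrow> nat. (\<forall>U V. (U, V) \<in> E \<longrightarrow> \<rho> U = \<rho> V) \<and>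
    (\<forall>U\<in>proper_subsets n. \<forall>V\<in>proper_subsets n. U \<subset> V \<longrightarrow> \<rho> U < \<rho> V) \<and> (\<forall>U. \<rho> U \<le> 2 ^ n)"
proof -
  let ?P = "proper_subsets n"
  have eq: "equiv ?P E" using E by (simp add: abstract_system_def)
  have refl: "(U, U) \<in> E" if "U \<in> ?P" for U
    using eq that by (simp add: equiv_def refl_on_def)
  have sym: "(V, U) \<in> E" if "(U, V) \<in> E" for U V
    using eq that by (meson equivE symE)
  have dom: "U \<in> ?P \<and> V \<in> ?P" if "(U, V) \<in> E" for U V
    using eq that by (meson equiv_class_eq_iff)
  define Q where "Q = {(V, V'). V \<in> ?P \<and> V' \<in> ?P \<and> (\<exists>W. (V, W) \<in> E \<and> W \<subseteq> V')}"
  define \<rho> where "\<rho> V = card {W \<in> ?P. (W, V) \<in> Q\<^sup>*}" for V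
  have EQ: "E \<subseteq> Q" using dom by (auto simp: Q_def)
  have le: "\<rho> U \<le> \<rho> V" if "(U, V) \<in> Q\<^sup>*" for U V
    unfolding \<rho>_def using that finite_proper_subsets[of n]
    by (intro card_mono) (auto intro: rtrancl_trans)
  have noexp: False if U: "U \<in> ?P" and V: "V \<in> ?P" and VU: "(V, U) \<in> Q\<^sup>*" and "U \<subset> V" for U V
  proof -
    obtain k where "(V, U) \<in> Q ^^ k" using VU rtrancl_imp_relpow by blast
    then obtain f where f: "f 0 = V" "f k = U" "\<And>i. i < k \<Longrightarrow> (f i, f (Suc i)) \<in> Q"
      by (auto simp: relpow_fun_conv)
    have "\<exists>W. (f i, W) \<in> E \<and> W \<subseteq> f (Suc i)" if "i < k" for i
      using f(3)[OF that] by (auto simp: Q_def)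
    then obtain W where W: "\<And>i. i < k \<Longrightarrow> (f i, W i) \<in> E \<and> W i \<subseteq> f (Suc i)" by metis
    \<comment> \<open>The chain of moves is closed by the trivial congruence of \<open>U\<close>
      with itself, whose right side is the proper subset of \<open>V\<close> that non-expansion
      excludes.\<close>
    let ?W = "W(k := U)"
    have "(\<forall>i\<le>k. (f i, ?W i) \<in> E) \<and> (\<forall>i<k. ?W i \<subseteq> f (Suc i)) \<and> ?W k \<subset> f 0"
      using W f refl[OF U] \<open>U \<subset> V\<close> by (auto simp: le_less)
    then show False using ne unfolding non_expanding_def by blast
  qed
  show ?thesis
  proof (rule exI[of _ \<rho>], intro conjI allI ballI impI)
    fix U V assume "(U, V) \<in> E"
    then show "\<rho> U = \<rho> V" using EQ sym le by (meson order_antisym r_into_rtrancl subsetD)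
  next
    fix U V assume U: "U \<in> ?P" and V: "V \<in> ?P" and UV: "U \<subset> V"
    have UVQ: "(U, V) \<in> Q" using U V UV refl by (auto simp: Q_def)
    have "V \<notin> {W \<in> ?P. (W, U) \<in> Q\<^sup>*}" using noexp U V UV by blast
    then have "{W \<in> ?P. (W, U) \<in> Q\<^sup>*} \<subset> {W \<in> ?P. (W, V) \<in> Q\<^sup>*}"
      using UVQ V by (auto intro: rtrancl_into_rtrancl)
    then show "\<rho> U < \<rho> V"
      unfolding \<rho>_def using finite_proper_subsets[of n] by (intro psubset_card_mono) auto
  next
    fix U
    have "\<rho> U \<le> card (Pow {..<n})"
      unfolding \<rho>_def by (intro card_mono) (auto simp: proper_subsets_def)
    then show "\<rho> U \<le> 2 ^ n" by (simp add: card_Pow)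
  qed
qed

text \<open>
  The letters form a star around the set \<open>Cen\<close> of centres.  A reduced word cannot follow the star
  for three consecutive steps, so the rank of the set of reachable labels increases at least
  every third step until every label is reachable.
\<close>

lemma star_mixing:
  assumes E: "abstract_system n E" and ne: "non_expanding E"
    and AB: "\<And>i. i < k \<Longrightarrow> (A i, B i) \<in> E"
    and ACen: "\<And>i. i < k \<Longrightarrow> A i \<in> Cen" "\<And>i. i < k \<Longrightarrow> {..<n} - A i \<in> Cen"
    and BCen: "\<And>i. i < k \<Longrightarrow> B i \<notin> Cen" "\<And>i. i < k \<Longrightarrow> {..<n} - B i \<notin> Cen"
    and Binj: "\<And>i j. i < k \<Longrightarrow> j < k \<Longrightarrow> B i = B j \<or> B i = {..<n} - B j \<Longrightarrow> i = j"
    and w: "w \<in> reduced_words k" "3 * 2 ^ n + 3 \<le> length w"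
    and ab: "a < n" "b < n"
  shows "(a, b) \<in> path_rel (cong_rel n A B) w"
proof -
  let ?P = "proper_subsets n" and ?R = "cong_rel n A B" and ?c = "\<lambda>U. {..<n} - U"
  obtain \<rho> :: "nat set \<Rightarrow> nat" where rank: "(\<forall>U V. (U, V) \<in> E \<longrightarrow> \<rho> U = \<rho> V) \<and>
      (\<forall>U\<in>?P. \<forall>V\<in>?P. U \<subset> V \<longrightarrow> \<rho> U < \<rho> V) \<and> (\<forall>U. \<rho> U \<le> 2 ^ n)"
    using non_expanding_rank[OF E ne] ..
  note \<rho> = rank[THEN conjunct1, rule_format] rank[THEN conjunct2, THEN conjunct1, rule_format]
    rank[THEN conjunct2, THEN conjunct2, rule_format]
  have eq: "equiv ?P E" using E by (simp add: abstract_system_def)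
  have sym: "(V, U) \<in> E" if "(U, V) \<in> E" for U V
    using eq that by (meson equivE symE)
  have dom: "U \<in> ?P \<and> V \<in> ?P" if "(U, V) \<in> E" for U V
    using eq that by (meson equiv_class_eq_iff)
  have Ecompl: "({..<n} - U, {..<n} - V) \<in> E" if "(U, V) \<in> E" for U V
    using E that by (auto simp: abstract_system_def)
  define S where "S w = path_rel ?R w `` {a}" for w
  have S_Nil: "S [] = {a}" by (simp add: S_def)
  have S_Cons: "S (s # w) = ?R s `` S w" for s w by (auto simp: S_def)
  \<comment> \<open>A step that strictly enlarges the set before applying the congruence raises the
    rank by at least one, which pays for three letters. A step without gain must start exactly at a
    centre or at a leaf; remembering on which of the two the last letter ended, with one unit of
    slack kept at centres, bounds the number of such steps in a row.\<close>
  have key: "S w = {..<n} \<or> (S w \<in> ?P \<and> length w \<le> 3 * \<rho> (S w) + 2 \<and>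
      (w \<noteq> [] \<longrightarrow> (if snd (hd w) then S w \<in> {B (fst (hd w)), {..<n} - B (fst (hd w))}
           else S w \<in> Cen \<and> length w \<le> 3 * \<rho> (S w) + 1)))" if "w \<in> reduced_words k" for w
    using that
  proof (induction w)
    case Nil
    then show ?case using \<open>a < n\<close> by (auto simp: S_Nil proper_subsets_def)
  next
    case (Cons s w)
    have sk: "fst s < k" and wk: "w \<in> reduced_words k" and hdw: "w \<noteq> [] \<Longrightarrow> hd w \<noteq> inv_letter s"
      using Cons.prems by (auto simp: reduced_words_Cons_iff)
    have PA: "A (fst s) \<in> ?P" and PB: "B (fst s) \<in> ?P" using AB[OF sk] dom by auto
    have IH: "S w = {..<n} \<or> (S w \<in> ?P \<and> length w \<le> 3 * \<rho> (S w) + 2 \<and>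
      (w \<noteq> [] \<longrightarrow> (if snd (hd w) then S w \<in> {B (fst (hd w)), {..<n} - B (fst (hd w))}
           else S w \<in> Cen \<and> length w \<le> 3 * \<rho> (S w) + 1)))"
      using Cons.IH wk by blast
    show ?case
    proof (cases "S w = {..<n}")
      case True
      have "?R s `` {..<n} = {..<n}"
      proof (intro equalityI subsetI)
        fix l assume "l \<in> {..<n}"
        then obtain l' where "(l, l') \<in> ?R (inv_letter s)"
          using cong_rel_total[of A "inv_letter s" n B l] PA PB by auto
        then show "l \<in> ?R s `` {..<n}"
          using cong_rel_bounded[of n A B s] by (auto simp: cong_rel_inv_letter)
      qed (use cong_rel_bounded[of n A B s] in auto)
      then show ?thesis using True by (simp add: S_Cons)
    next
      case False
      then have Sw: "S w \<in> ?P" "length w \<le> 3 * \<rho> (S w) + 2" using IH by auto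
      then have Sw': "S w \<subseteq> {..<n}" "S w \<noteq> {}" by (auto simp: proper_subsets_def)
      have main: ?thesis
        if VW: "(V, W) \<in> E" and SV: "S w \<subseteq> V" and SW: "S (s # w) = W"
          and V: "V \<in> {(if snd s then A else B) (fst s), {..<n} - (if snd s then A else B) (fst s)}"
          and W: "W \<in> {(if snd s then B else A) (fst s), {..<n} - (if snd s then B else A) (fst s)}"
        for V W
      proof (cases "S w = V")
        case False
        then have "S w \<subset> V" using SV by blast
        then have "\<rho> (S w) < \<rho> W" using \<rho>(2)[OF Sw(1)] \<rho>(1)[OF VW] dom[OF VW] by metis
        then have "length (s # w) \<le> 3 * \<rho> W" using Sw(2) by simp
        moreover have "W \<in> ?P" using dom[OF VW] by blast
        moreover have "W \<in> {B (fst s), ?c (B (fst s))}" if "snd s" using W that by simp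
        moreover have "W \<in> Cen" if "\<not> snd s" using W that ACen[OF sk] by auto
        ultimately show ?thesis unfolding SW list.sel by (cases "snd s") simp_all
      next
        case True
        then have rw: "\<rho> (S w) = \<rho> W" using \<rho>(1)[OF VW] by simp
        have hk: "fst (hd w) < k" if "w \<noteq> []"
          using wk that by (cases w) (auto simp: reduced_words_Cons_iff)
        show ?thesis
        proof (cases "snd s")
          case True
          have "V = A (fst s) \<or> V = ?c (A (fst s))" using V True by simp
          then have Cen: "S w \<in> Cen" using ACen[OF sk] \<open>S w = V\<close> by metis
          have "length w \<le> 3 * \<rho> (S w) + 1"
          proof (cases "w = []")
            case False
            have "\<not> snd (hd w)"
            proof
              assume "snd (hd w)"
              then have "S w = B (fst (hd w)) \<or> S w = ?c (B (fst (hd w)))"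
                using IH False \<open>S w \<noteq> {..<n}\<close> by simp
              then show False using BCen[OF hk[OF False]] Cen by metis
            qed
            then show ?thesis using IH \<open>S w \<noteq> {..<n}\<close> False by metis
          qed simp
          then have "length (s # w) \<le> 3 * \<rho> W + 2" using rw by simp
          moreover have "W \<in> ?P" using dom[OF VW] by blast
          moreover have "W \<in> {B (fst s), ?c (B (fst s))}" using W True by simp
          ultimately show ?thesis unfolding SW list.sel using True by simp
        next
          case False
          have VB: "V = B (fst s) \<or> V = {..<n} - B (fst s)" using V False by auto
          \<comment> \<open>A step without gain from a leaf back to its centre is possible only at
            the start of the word: the set can be this leaf only if the preceding letter led to it
            from the same centre, and then the two letters would cancel.\<close>
          have "w = []"
          proof (rule ccontr)
            assume w: "w \<noteq> []"
            show False
            proof (cases "snd (hd w)")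
              case True
              then have "V = B (fst (hd w)) \<or> V = {..<n} - B (fst (hd w))"
                using IH \<open>S w \<noteq> {..<n}\<close> w \<open>S w = V\<close> by auto
              then have "fst s = fst (hd w)"
                using VB Binj[OF sk hk[OF w]] PB compl_compl_proper[OF PB]
                  compl_compl_proper[of "B (fst (hd w))"] dom[OF AB[OF hk[OF w]]] by metis
              then show False using hdw[OF w] True False
                by (auto simp: inv_letter_def prod_eq_iff)
            next
              case False
              then have "V \<in> Cen" using IH \<open>S w \<noteq> {..<n}\<close> w \<open>S w = V\<close> by auto
              then show False using VB BCen[OF sk] by auto
            qed
          qed
          then have "length (s # w) \<le> 3 * \<rho> W + 1" by simp
          moreover have "W \<in> ?P" using dom[OF VW] by blast
          moreover have "W \<in> Cen" using W False ACen[OF sk] by auto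
          ultimately show ?thesis unfolding SW list.sel using False by simp
        qed
      qed
      have EV: "((if snd s then A else B) (fst s), (if snd s then B else A) (fst s)) \<in> E"
        using AB[OF sk] sym by auto
      show ?thesis
        using PA PB Sw'
      proof (cases rule: cong_rel_Image)
        case full
        then show ?thesis by (simp add: S_Cons)
      next
        case src
        show ?thesis by (rule main[OF EV src(1)]) (use src(2) in \<open>auto simp: S_Cons\<close>)
      next
        case compl
        show ?thesis by (rule main[OF Ecompl[OF EV] compl(1)]) (use compl(2) in \<open>auto simp: S_Cons\<close>)
      qed
    qed
  qed
  \<comment> \<open>For a proper set of labels the length would be at most
    \<open>3 * 2 ^ n + 2\<close>, one less than assumed.\<close>
  have "S w = {..<n}"
    using key[OF w(1)] w(2) \<rho>(3)[of "S w"] by auto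
  then show ?thesis using ab by (auto simp: S_def)
qed

text \<open>In the class kept from each complementary pair, a representative is joined to every
  other member. The second conclusion says that these pairs generate \<open>E\<close> together with
  complements; it will be applied to the relation of being carried to each other by a group element,
  so that only \<open>k\<close> constraints remain to be met.\<close>

lemma exists_star_generators:
  assumes E: "abstract_system n E" and nc: "non_complementing n E" and ne: "non_expanding E"
  obtains k :: nat and A B :: "nat \<Rightarrow> nat set" where
    "\<And>i. i < k \<Longrightarrow> A i \<in> proper_subsets n \<and> B i \<in> proper_subsets n"
    "\<And>Q. equiv (proper_subsets n) Q \<Longrightarrow> (\<And>U V. (U, V) \<in> Q \<Longrightarrow> ({..<n} - U, {..<n} - V) \<in> Q) \<Longrightarrow>
       (\<And>i. i < k \<Longrightarrow> (A i, B i) \<in> Q) \<Longrightarrow> E \<subseteq> Q"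
    "\<And>w a b. w \<in> reduced_words k \<Longrightarrow> 3 * 2 ^ n + 3 \<le> length w \<Longrightarrow> a < n \<Longrightarrow> b < n \<Longrightarrow>
       (a, b) \<in> path_rel (cong_rel n A B) w"
proof -
  let ?P = "proper_subsets n" and ?c = "\<lambda>U. {..<n} - U"
  have eq: "equiv ?P E" using E by (simp add: abstract_system_def)
  have refl: "(U, U) \<in> E" if "U \<in> ?P" for U
    using eq that by (simp add: equiv_def refl_on_def)
  have sym: "(V, U) \<in> E" if "(U, V) \<in> E" for U V
    using eq that by (meson equivE symE)
  have trans: "(U, W) \<in> E" if "(U, V) \<in> E" "(V, W) \<in> E" for U V W
    using eq that by (meson equivE transE)
  have dom: "U \<in> ?P \<and> V \<in> ?P" if "(U, V) \<in> E" for U V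
    using eq that by (meson equiv_class_eq_iff)
  have Ecompl: "(?c U, ?c V) \<in> E" if "(U, V) \<in> E" for U V
    using E that by (auto simp: abstract_system_def)
  define rep where "rep U = (SOME V. V \<in> E `` {U})" for U
  have rep: "(U, rep U) \<in> E" if "U \<in> ?P" for U
    using someI[of "\<lambda>V. V \<in> E `` {U}" U] refl[OF that] by (simp add: rep_def)
  have rep_eq: "rep U = rep V" if "(U, V) \<in> E" for U V
    using equiv_class_eq[OF eq that] by (simp add: rep_def)
  \<comment> \<open>Exactly one of two complementary classes is positive. Their representatives
    differ by non-complementation, so comparing their numerical codes is a valid way to
    decide.\<close>
  define pos where "pos U \<longleftrightarrow> set_encode (rep U) < set_encode (rep (?c U))" for U
  have pos_E: "pos U = pos V" if "(U, V) \<in> E" for U V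
    using rep_eq[OF that] rep_eq[OF Ecompl[OF that]] by (simp add: pos_def)
  have rep_ne: "rep U \<noteq> rep (?c U)" if "U \<in> ?P" for U
  proof
    assume "rep U = rep (?c U)"
    then have "(U, ?c U) \<in> E"
      using rep[OF that] rep[OF proper_subsets_compl[OF that]] sym trans by metis
    then show False using nc by (auto simp: non_complementing_def)
  qed
  have fin: "finite U" if "U \<in> ?P" for U
    using that by (auto simp: proper_subsets_def intro: finite_subset)
  have pos_compl: "pos (?c U) \<longleftrightarrow> \<not> pos U" if "U \<in> ?P" for U
  proof -
    have "set_encode (rep U) \<noteq> set_encode (rep (?c U))"
      using rep_ne[OF that] fin dom[OF rep[OF that]] dom[OF rep[OF proper_subsets_compl[OF that]]]
        set_encode_eq by metis
    then show ?thesis by (auto simp: pos_def compl_compl_proper[OF that])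
  qed
  define I where "I = {U \<in> ?P. pos U \<and> U \<noteq> rep U}"
  have "finite I" using finite_proper_subsets by (auto simp: I_def)
  then obtain B where B: "bij_betw B {..<card I} I"
    using ex_bij_betw_nat_finite[of I] by (auto simp: atLeast0LessThan)
  define A where "A i = rep (B i)" for i
  define Cen where "Cen = {rep U |U. U \<in> ?P \<and> pos U} \<union> {?c (rep U) |U. U \<in> ?P \<and> pos U}"
  let ?k = "card I"
  have BI: "B i \<in> I" if "i < ?k" for i using B that by (auto simp: bij_betw_def)
  have AB: "(A i, B i) \<in> E" if "i < ?k" for i
    using BI[OF that] rep sym by (auto simp: I_def A_def)
  have ACen: "A i \<in> Cen" "?c (A i) \<in> Cen" if "i < ?k" for i
    using BI[OF that] by (auto simp: I_def A_def Cen_def)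
  have notCen: "B i \<notin> Cen" "?c (B i) \<notin> Cen" if i: "i < ?k" for i
  proof -
    have Bi: "B i \<in> ?P" "pos (B i)" "B i \<noteq> rep (B i)" using BI[OF i] by (auto simp: I_def)
    have 1: "B i \<noteq> rep U" if "U \<in> ?P" for U
      using Bi(3) rep_eq[OF rep[OF that]] by auto
    have 2: "B i \<noteq> ?c (rep U)" if U: "U \<in> ?P" "pos U" for U
      using pos_compl[of "rep U"] pos_E[OF rep[OF U(1)]] U dom[OF rep[OF U(1)]] Bi(2) by metis
    show "B i \<notin> Cen" using 1 2 by (auto simp: Cen_def)
    have 3: "rep U = ?c (?c (rep U))" if "U \<in> ?P" for U
      using compl_compl_proper dom[OF rep[OF that]] by metis
    show "?c (B i) \<notin> Cen"
    proof
      assume "?c (B i) \<in> Cen"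
      then obtain U where U: "U \<in> ?P" "pos U" "?c (B i) = rep U \<or> ?c (B i) = ?c (rep U)"
        by (auto simp: Cen_def)
      then have "B i = ?c (rep U) \<or> B i = rep U"
        using 3[OF U(1)] compl_compl_proper[OF Bi(1)] by metis
      then show False using 1 2 U by blast
    qed
  qed
  have Binj: "i = j" if ij: "i < ?k" "j < ?k" "B i = B j \<or> B i = ?c (B j)" for i j
  proof -
    have "B i \<noteq> ?c (B j)" using BI[OF ij(1)] BI[OF ij(2)] pos_compl by (auto simp: I_def)
    then show ?thesis using ij B by (auto simp: bij_betw_def inj_on_def)
  qed
  show thesis
  proof (rule that[of ?k A B])
    fix i assume "i < ?k"
    then show "A i \<in> ?P \<and> B i \<in> ?P" using AB dom by blast
  next
    fix Q assume Q: "equiv ?P Q" "\<And>U V. (U, V) \<in> Q \<Longrightarrow> (?c U, ?c V) \<in> Q"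
      "\<And>i. i < ?k \<Longrightarrow> (A i, B i) \<in> Q"
    have repQ: "(rep U, U) \<in> Q" if U: "U \<in> ?P" "pos U" for U
    proof (cases "U = rep U")
      case True
      then show ?thesis using Q(1) U by (simp add: equiv_def refl_on_def)
    next
      case False
      then have "U \<in> I" using U by (auto simp: I_def)
      then obtain i where "i < ?k" "B i = U"
        using B unfolding bij_betw_def by (metis imageE lessThan_iff)
      then show ?thesis using Q(3) by (auto simp: A_def)
    qed
    have pos_case: "(U, V) \<in> Q" if UV: "(U, V) \<in> E" and p: "pos U" for U V
    proof -
      have "(rep U, U) \<in> Q" "(rep U, V) \<in> Q"
        using repQ[of U] repQ[of V] dom[OF UV] p pos_E[OF UV] rep_eq[OF UV] by auto
      then show ?thesis using Q(1) by (meson equivE symE transE)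
    qed
    show "E \<subseteq> Q"
    proof (rule subrelI)
      fix U V assume UV: "(U, V) \<in> E"
      show "(U, V) \<in> Q"
      proof (cases "pos U")
        case False
        then have "(?c U, ?c V) \<in> Q"
          using pos_case[OF Ecompl[OF UV]] pos_compl dom[OF UV] by auto
        then have "(?c (?c U), ?c (?c V)) \<in> Q" by (rule Q(2))
        then show ?thesis using compl_compl_proper dom[OF UV] by metis
      qed (use pos_case[OF UV] in blast)
    qed
  next
    fix w a b assume w: "w \<in> reduced_words ?k" "3 * 2 ^ n + 3 \<le> length w" "a < n" "b < n"
    show "(a, b) \<in> path_rel (cong_rel n A B) w"
      by (rule star_mixing[OF E ne _ _ _ _ _ _ w, where Cen = Cen]) (use AB ACen notCen Binj in blast)+
  qed
qed

section \<open>Almost everywhere convergent convex combinations\<close>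

text \<open>Even after multiplication by \<open>2 ^ i\<close> the squared increments have summable
  integrals, so their sum is finite almost everywhere. There an increment of size \<open>d\<close>
  is at most \<open>(1/2) ^ i + 2 ^ i * d\<^sup>2\<close>, by the inequality between arithmetic and
  geometric mean, and the increments are absolutely summable.\<close>

lemma (in prob_space) AE_convergent_of_L2_steps:
  fixes c :: "nat \<Rightarrow> 'a \<Rightarrow> real"
  assumes meas [measurable]: "\<And>i. c i \<in> borel_measurable M"
    and int: "\<And>i. integrable M (\<lambda>x. (c i x - c (Suc i) x)\<^sup>2)"
    and le: "\<And>i. (\<integral>x. (c i x - c (Suc i) x)\<^sup>2 \<partial>M) \<le> 8 * (1/8) ^ i"
  shows "AE x in M. convergent (\<lambda>i. c i x)"
proof -
  let ?u = "\<lambda>i x. 2 ^ i * (c i x - c (Suc i) x)\<^sup>2"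
  have nn: "(\<integral>\<^sup>+ x. ennreal (?u i x) \<partial>M) \<le> ennreal (8 * (1/4) ^ i)" for i
  proof -
    have "(\<integral>\<^sup>+ x. ennreal (?u i x) \<partial>M) = ennreal (\<integral>x. ?u i x \<partial>M)"
      using int by (intro nn_integral_eq_integral) auto
    also have "(\<integral>x. ?u i x \<partial>M) = 2 ^ i * (\<integral>x. (c i x - c (Suc i) x)\<^sup>2 \<partial>M)" by simp
    also have "\<dots> \<le> 2 ^ i * (8 * (1/8) ^ i)" using le by (intro mult_left_mono) auto
    also have "\<dots> = 8 * (1/4) ^ i" by (simp flip: power_mult_distrib)
    finally show ?thesis by (simp add: ennreal_leI)
  qed
  have "(\<integral>\<^sup>+ x. (\<Sum>i. ennreal (?u i x)) \<partial>M) = (\<Sum>i. \<integral>\<^sup>+ x. ennreal (?u i x) \<partial>M)"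
    by (intro nn_integral_suminf) measurable
  also have "\<dots> \<le> (\<Sum>i. ennreal (8 * (1/4) ^ i))"
    by (intro suminf_le nn) auto
  also have "\<dots> = ennreal (\<Sum>i. 8 * (1/4) ^ i)"
    by (intro suminf_ennreal2) (auto intro!: summable_mult summable_geometric)
  finally have "(\<integral>\<^sup>+ x. (\<Sum>i. ennreal (?u i x)) \<partial>M) \<noteq> \<infinity>"
    by (metis ennreal_less_top infinity_ennreal_def leD)
  then have "AE x in M. (\<Sum>i. ennreal (?u i x)) \<noteq> \<infinity>"
    by (intro nn_integral_PInf_AE) auto
  then show ?thesis
  proof (rule AE_mp, intro AE_I2 impI)
    fix x assume "(\<Sum>i. ennreal (?u i x)) \<noteq> \<infinity>"
    then have "summable (\<lambda>i. ?u i x)" by (intro summable_suminf_not_top) auto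
    then have "summable (\<lambda>i. (1/2) ^ i + ?u i x)"
      by (intro summable_add summable_geometric) auto
    moreover have "norm (c (Suc i) x - c i x) \<le> (1/2) ^ i + ?u i x" for i
    proof -
      define d where "d = \<bar>c i x - c (Suc i) x\<bar>"
      have "0 \<le> (1 - 2 ^ i * d)\<^sup>2" by simp
      also have "\<dots> = 2 ^ i * ((1/2) ^ i + 2 ^ i * d\<^sup>2 - 2 * d)"
        by (simp add: power2_eq_square algebra_simps power_one_over)
      finally have "0 \<le> 2 ^ i * ((1/2) ^ i + 2 ^ i * d\<^sup>2 - 2 * d)" .
      moreover have "(0::real) < 2 ^ i" by simp
      ultimately have "2 * d \<le> (1/2) ^ i + 2 ^ i * d\<^sup>2"
        by (metis diff_ge_0_iff_ge not_le zero_le_mult_iff)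
      moreover have "0 \<le> d" by (simp add: d_def)
      ultimately have "d \<le> (1/2) ^ i + 2 ^ i * d\<^sup>2" by linarith
      then show ?thesis by (simp add: d_def abs_minus_commute)
    qed
    ultimately have "summable (\<lambda>i. c (Suc i) x - c i x)"
      by (rule summable_comparison_test')
    then have "(\<lambda>n. \<Sum>i<n. c (Suc i) x - c i x) \<longlonglongrightarrow> (\<Sum>i. c (Suc i) x - c i x)"
      by (rule summable_LIMSEQ)
    then have "(\<lambda>n. c n x - c 0 x) \<longlonglongrightarrow> (\<Sum>i. c (Suc i) x - c i x)"
      by (simp add: sum_lessThan_telescope[of "\<lambda>i. c i x"])
    from tendsto_add[OF tendsto_const[of "c 0 x"] this]
    have "(\<lambda>n. c n x) \<longlonglongrightarrow> c 0 x + (\<Sum>i. c (Suc i) x - c i x)" by simp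
    then show "convergent (\<lambda>i. c i x)" by (auto simp: convergent_def)
  qed
qed

section \<open>Convex combinations over tails of a sequence\<close>

definition tail_weights :: "nat \<Rightarrow> (nat \<Rightarrow> real) set" where
  "tail_weights i = {a. (\<forall>j. 0 \<le> a j) \<and> finite {j. a j \<noteq> 0} \<and> (\<forall>j. a j \<noteq> 0 \<longrightarrow> i \<le> j) \<and>
     sum a {j. a j \<noteq> 0} = 1}"

definition weighted_sum :: "(nat \<Rightarrow> real) \<Rightarrow> (nat \<Rightarrow> real) \<Rightarrow> real" where
  "weighted_sum a f = (\<Sum>j | a j \<noteq> 0. a j * f j)"

lemma weighted_sum_bounds:
  assumes "a \<in> tail_weights i" "\<And>j. 0 \<le> f j \<and> f j \<le> 1"
  shows "0 \<le> weighted_sum a f \<and> weighted_sum a f \<le> 1"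
proof -
  have "weighted_sum a f \<le> sum a {j. a j \<noteq> 0}"
    unfolding weighted_sum_def using assms
    by (intro sum_mono) (auto simp: tail_weights_def mult_left_le)
  moreover have "0 \<le> weighted_sum a f"
    unfolding weighted_sum_def using assms by (intro sum_nonneg) (auto simp: tail_weights_def)
  ultimately show ?thesis using assms by (auto simp: tail_weights_def)
qed

lemma tail_weights_mid:
  assumes a: "a \<in> tail_weights i" and b: "b \<in> tail_weights i"
  defines "c \<equiv> \<lambda>j. (a j + b j) / 2"
  shows "c \<in> tail_weights i" "weighted_sum c f = (weighted_sum a f + weighted_sum b f) / 2"
proof -
  let ?S = "{j. a j \<noteq> 0} \<union> {j. b j \<noteq> 0}"
  have fin: "finite ?S" using a b by (auto simp: tail_weights_def)
  have sub: "{j. c j \<noteq> 0} \<subseteq> ?S" by (auto simp: c_def)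
  have finc: "finite {j. c j \<noteq> 0}" using finite_subset[OF sub fin] .
  have ext: "sum g {j. d j \<noteq> 0} = sum g ?S"
    if "{j. d j \<noteq> 0} \<subseteq> ?S" "\<And>j. d j = 0 \<Longrightarrow> g j = 0" for d g :: "nat \<Rightarrow> real"
    using that by (intro sum.mono_neutral_left fin) auto
  have "sum c {j. c j \<noteq> 0} = (sum a ?S + sum b ?S) / 2"
    using sub by (subst ext) (auto simp: c_def sum.distrib simp flip: sum_divide_distrib)
  also have "\<dots> = 1"
    using a b ext[of a a] ext[of b b] by (auto simp: tail_weights_def)
  finally show "c \<in> tail_weights i"
    using a b finc unfolding tail_weights_def mem_Collect_eq c_def
    by (metis add_nonneg_nonneg add_0 divide_eq_0_iff divide_nonneg_pos zero_less_numeral)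
  have "weighted_sum c f = (\<Sum>j\<in>?S. c j * f j)"
    unfolding weighted_sum_def using sub by (intro ext) auto
  also have "\<dots> = ((\<Sum>j\<in>?S. a j * f j) + (\<Sum>j\<in>?S. b j * f j)) / 2"
    by (simp add: c_def sum.distrib[symmetric] sum_divide_distrib algebra_simps add_divide_distrib)
  also have "\<dots> = (weighted_sum a f + weighted_sum b f) / 2"
    unfolding weighted_sum_def using ext[of a "\<lambda>j. a j * f j"] ext[of b "\<lambda>j. b j * f j"] by auto
  finally show "weighted_sum c f = (weighted_sum a f + weighted_sum b f) / 2" .
qed

text \<open>
  The weights nearly minimise the second moment over all convex combinations of a tail, so the
  parallelogram law makes the combinations Cauchy in mean square.
\<close>

lemma (in prob_space) convex_combinations_AE_convergent:
  fixes g :: "nat \<Rightarrow> 'a \<Rightarrow> real"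
  assumes meas [measurable]: "\<And>j. g j \<in> borel_measurable M"
    and bounds: "\<And>j x. x \<in> space M \<Longrightarrow> 0 \<le> g j x \<and> g j x \<le> 1"
  obtains a :: "nat \<Rightarrow> nat \<Rightarrow> real" where "\<And>i. a i \<in> tail_weights i"
    "AE x in M. convergent (\<lambda>i. weighted_sum (a i) (\<lambda>j. g j x))"
proof -
  let ?W = tail_weights and ?c = "\<lambda>a x. weighted_sum a (\<lambda>j. g j x)"
  have cm [measurable]: "?c a \<in> borel_measurable M" for a
    unfolding weighted_sum_def by measurable
  have cb: "0 \<le> ?c a x \<and> ?c a x \<le> 1" if "a \<in> ?W i" "x \<in> space M" for a x i
    using that bounds by (intro weighted_sum_bounds) auto
  have int: "integrable M (\<lambda>x. (p * ?c a x + q * ?c b x)\<^sup>2)" if a: "a \<in> ?W i" and b: "b \<in> ?W i'"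
    for a b i i' p q
  proof (rule integrable_const_bound[where B="(\<bar>p\<bar> + \<bar>q\<bar>)\<^sup>2"])
    show "AE x in M. norm ((p * ?c a x + q * ?c b x)\<^sup>2) \<le> (\<bar>p\<bar> + \<bar>q\<bar>)\<^sup>2"
    proof (intro AE_I2)
      fix x assume x: "x \<in> space M"
      have "\<bar>p * ?c a x + q * ?c b x\<bar> \<le> \<bar>p\<bar> * \<bar>?c a x\<bar> + \<bar>q\<bar> * \<bar>?c b x\<bar>"
        by (metis abs_mult abs_triangle_ineq)
      also have "\<dots> \<le> \<bar>p\<bar> * 1 + \<bar>q\<bar> * 1"
        using cb[OF a x] cb[OF b x] by (intro add_mono mult_left_mono) auto
      finally have "\<bar>p * ?c a x + q * ?c b x\<bar> \<le> \<bar>\<bar>p\<bar> + \<bar>q\<bar>\<bar>" by simp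
      then have "(p * ?c a x + q * ?c b x)\<^sup>2 \<le> (\<bar>p\<bar> + \<bar>q\<bar>)\<^sup>2"
        by (rule abs_le_square_iff[THEN iffD1])
      then show "norm ((p * ?c a x + q * ?c b x)\<^sup>2) \<le> (\<bar>p\<bar> + \<bar>q\<bar>)\<^sup>2" by simp
    qed
  qed measurable
  define I where "I a = (\<integral>x. (?c a x)\<^sup>2 \<partial>M)" for a
  define d where "d i = Inf (I ` ?W i)" for i
  have I0: "0 \<le> I a" for a unfolding I_def by simp
  have I1: "I a \<le> 1" if "a \<in> ?W i" for a i
  proof -
    have "I a \<le> (\<integral>x. 1 \<partial>M)"
      unfolding I_def using int[OF that that, of 1 0] cb[OF that]
      by (intro integral_mono) (auto simp: power2_eq_square mult_le_one)
    then show ?thesis by (simp add: prob_space)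
  qed
  have bdd: "bdd_below (I ` ?W i)" for i using I0 by (intro bdd_belowI[of _ 0]) auto
  have ne: "(\<lambda>j. of_bool (j = i)) \<in> ?W i" for i
  proof -
    have "{j. of_bool (j = i) \<noteq> (0::real)} = {i}" by auto
    then show ?thesis by (auto simp: tail_weights_def)
  qed
  have W_anti: "?W j \<subseteq> ?W i" if "i \<le> j" for i j using that by (fastforce simp: tail_weights_def)
  have d_le: "d i \<le> I a" if "a \<in> ?W i" for i a
    unfolding d_def using that bdd by (auto intro: cInf_lower)
  have d_mono: "d i \<le> d j" if "i \<le> j" for i j
    unfolding d_def using W_anti[OF that] ne bdd by (intro cInf_superset_mono) auto
  have d1: "d i \<le> 1" for i using d_le[OF ne] I1[OF ne] order_trans by blast
  define D where "D = (SUP i. d i)"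
  have bddD: "bdd_above (range d)" using d1 by (intro bdd_aboveI[of _ 1]) auto
  have dD: "d i \<le> D" for i unfolding D_def using bddD by (intro cSUP_upper) auto
  define e :: "nat \<Rightarrow> real" where "e i = (1/8) ^ i" for i
  have e0: "0 < e i" and eS: "e (Suc i) \<le> e i" for i by (auto simp: e_def)
  have "\<exists>n. D - e i < d n" for i
  proof -
    have "D - e i < (SUP i. d i)" using e0[of i] by (simp add: D_def)
    then show ?thesis using less_cSUP_iff[OF _ bddD] by auto
  qed
  then obtain n where n: "\<And>i. D - e i < d (n i)" by metis
  \<comment> \<open>The partial sums make the starting indices increase, so that later weights also
    belong to the earlier tails; the summand \<open>i\<close> pushes the tails to infinity.\<close>
  define r where "r i = i + (\<Sum>j\<le>i. n j)" for i
  have dr: "D - e i < d (r i)" for i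
  proof -
    have "n i \<le> r i" unfolding r_def by (simp add: sum.remove[of _ i] add_increasing)
    then show ?thesis using n[of i] d_mono[of "n i" "r i"] by linarith
  qed
  have r_mono: "r i \<le> r (Suc i)" and r_ge: "i \<le> r i" for i by (auto simp: r_def)
  have "\<exists>a \<in> ?W (r i). I a < D + e i" for i
  proof -
    have "Inf (I ` ?W (r i)) < D + e i" using dD[of "r i"] e0[of i] unfolding d_def by linarith
    then show ?thesis using cInf_lessD[of "I ` ?W (r i)"] ne by blast
  qed
  then obtain a where a: "\<And>i. a i \<in> ?W (r i)" "\<And>i. I (a i) < D + e i" by metis
  have par: "(\<integral>x. (?c (a i) x - ?c (a (Suc i)) x)\<^sup>2 \<partial>M) \<le> 8 * e i" for i
  proof -
    let ?a = "a i" and ?b = "a (Suc i)"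
    have b: "?b \<in> ?W (r i)" using a(1)[of "Suc i"] W_anti[OF r_mono] by blast
    \<comment> \<open>The midpoint of two near-minimisers is itself a competitor, so its second
      moment exceeds \<open>D - e i\<close>. The parallelogram law then leaves at most
      \<open>2 * e i + 2 * e (Suc i) + 4 * e i\<close> for the difference.\<close>
    let ?m = "\<lambda>j. (?a j + ?b j) / 2"
    have m: "?m \<in> ?W (r i)" "\<And>x. ?c ?m x = (?c ?a x + ?c ?b x) / 2"
      using tail_weights_mid[OF a(1) b] by auto
    have "(\<integral>x. (?c ?a x - ?c ?b x)\<^sup>2 \<partial>M) =
        (\<integral>x. 2 * (?c ?a x)\<^sup>2 + 2 * (?c ?b x)\<^sup>2 - 4 * (?c ?m x)\<^sup>2 \<partial>M)"
      by (intro Bochner_Integration.integral_cong) (auto simp: m(2) power2_eq_square field_simps)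
    also have "\<dots> = 2 * I ?a + 2 * I ?b - 4 * I ?m"
      unfolding I_def using int[OF a(1)[of i] a(1)[of i], of 1 0] int[OF b b, of 1 0] int[OF m(1) m(1), of 1 0]
      by simp
    also have "\<dots> \<le> 8 * e i"
      using a(2)[of i] a(2)[of "Suc i"] eS[of i] d_le[OF m(1)] dr[of i] by linarith
    finally show ?thesis .
  qed
  show thesis
  proof (rule that[of a])
    show "a i \<in> ?W i" for i using a(1) W_anti[OF r_ge] by blast
    show "AE x in M. convergent (\<lambda>i. ?c (a i) x)"
      using par int[OF a(1) a(1), of 1 _ "-1" "Suc _"] by (intro AE_convergent_of_L2_steps) (auto simp: e_def)
  qed
qed

section \<open>Injections of standard Borel spaces into the reals\<close>

text \<open>In base three the first differing digit contributes \<open>(1/3) ^ N\<close>, while all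
  later digits together change the sum by at most half of that. In base two the two amounts could be
  equal.\<close>

lemma ternary_inj:
  fixes b c :: "nat \<Rightarrow> bool"
  assumes "(\<Sum>n. (1/3) ^ n * of_bool (b n)) = (\<Sum>n. (1/3) ^ n * of_bool (c n) :: real)"
  shows "b = c"
proof (rule ccontr)
  assume "b \<noteq> c"
  then have ex: "\<exists>n. b n \<noteq> c n" by auto
  define N where "N = (LEAST n. b n \<noteq> c n)"
  have N: "b N \<noteq> c N" "\<And>n. n < N \<Longrightarrow> b n = c n"
    using LeastI_ex[OF ex] not_less_Least unfolding N_def by blast+
  have sm: "summable (\<lambda>n. (1/3) ^ n * of_bool (b n) :: real)" for b :: "nat \<Rightarrow> bool"
    by (rule summable_comparison_test'[OF summable_geometric[of "1/3::real"]]) auto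
  let ?f = "\<lambda>n. (1/3) ^ n * of_bool (b n) - (1/3) ^ n * of_bool (c n) :: real"
  have sf: "summable ?f" using sm by (intro summable_diff)
  have "0 = (\<Sum>n. ?f n)" using suminf_diff[OF sm sm, of b c] assms by simp
  also have "\<dots> = (\<Sum>n. ?f (n + Suc N)) + (\<Sum>n<Suc N. ?f n)"
    by (rule suminf_split_initial_segment[OF sf])
  also have "(\<Sum>n<Suc N. ?f n) = ?f N" using N(2) by simp
  finally have eq: "\<bar>?f N\<bar> = \<bar>\<Sum>n. ?f (n + Suc N)\<bar>" by linarith
  have g: "summable (\<lambda>n. (1/3) ^ Suc N * (1/3) ^ n :: real)"
    by (intro summable_mult summable_geometric) auto
  have "\<bar>\<Sum>n. ?f (n + Suc N)\<bar> \<le> (\<Sum>n. (1/3) ^ Suc N * (1/3) ^ n)"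
  proof -
    have le: "norm (?f (n + Suc N)) \<le> (1/3) ^ Suc N * (1/3) ^ n" for n
      by (auto simp: power_add of_bool_def)
    have "summable (\<lambda>n. norm (?f (n + Suc N)))"
      by (rule summable_comparison_test'[OF g]) (use le in auto)
    then have "norm (\<Sum>n. ?f (n + Suc N)) \<le> (\<Sum>n. norm (?f (n + Suc N)))" by (rule summable_norm)
    also have "\<dots> \<le> (\<Sum>n. (1/3) ^ Suc N * (1/3) ^ n)"
      using le \<open>summable (\<lambda>n. norm (?f (n + Suc N)))\<close> g by (intro suminf_le)
    finally show ?thesis by simp
  qed
  also have "\<dots> = (1/3) ^ Suc N * (3/2)"
    by (subst suminf_mult) (auto simp: suminf_geometric summable_geometric)
  also have "\<dots> < \<bar>?f N\<bar>" using N(1) by (auto simp: of_bool_def)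
  finally show False using eq by simp
qed

text \<open>A countable base of a Hausdorff topology separates points, so the sequence of
  memberships, read as ternary digits, determines the point. The resulting real number serves to
  isolate a point from finitely many others by a rational interval, and to break ties between seeds
  measurably.\<close>

lemma standard_borel_space_injection:
  assumes "standard_borel_space M"
  shows "\<exists>h :: 'a \<Rightarrow> real. h \<in> borel_measurable M \<and> inj_on h (space M)"
proof -
  obtain T where T: "topspace T = space M" "completely_metrizable_space T" "second_countable T"
    "sets M = sigma_sets (space M) {U. openin T U}"
    using assms by (auto simp: standard_borel_space_def)
  obtain B where B: "countable B" "\<And>V. V \<in> B \<Longrightarrow> openin T V"
    "\<And>U x. openin T U \<Longrightarrow> x \<in> U \<Longrightarrow> \<exists>V\<in>B. x \<in> V \<and> V \<subseteq> U"
    using T(3) unfolding second_countable_def by metis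
  define U where "U = from_nat_into (insert {} B)"
  have rU: "range U = insert {} B" unfolding U_def using B(1) by (intro range_from_nat_into) auto
  have "openin T (U n)" for n using rU B(2) by (metis openin_empty insert_iff rangeI)
  then have [measurable]: "U n \<in> sets M" for n unfolding T(4) by (intro sigma_sets.Basic) auto
  define h where "h x = (\<Sum>n. (1/3) ^ n * of_bool (x \<in> U n) :: real)" for x
  have "h \<in> borel_measurable M" unfolding h_def by measurable
  moreover have "inj_on h (space M)"
  proof (rule inj_onI, rule ccontr)
    fix x y assume xy: "x \<in> space M" "y \<in> space M" "h x = h y" "x \<noteq> y"
    have "Hausdorff_space T"
      using T(2) completely_metrizable_imp_metrizable_space metrizable_imp_Hausdorff_space by blast
    then obtain V where "openin T V" "x \<in> V" "y \<notin> V"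
      using xy T(1) unfolding Hausdorff_space_def disjnt_iff by metis
    then obtain W where W: "W \<in> B" "x \<in> W" "y \<notin> W" using B(3) by blast
    have "W \<in> range U" using rU W(1) by simp
    then obtain n where "x \<in> U n" "y \<notin> U n" using W(2,3) by blast
    moreover have "(\<lambda>n. x \<in> U n) = (\<lambda>n. y \<in> U n)"
      using xy(3) unfolding h_def by (rule ternary_inj)
    ultimately show False by metis
  qed
  ultimately show ?thesis by blast
qed

section \<open>Labelling from seeds\<close>

text \<open>Letters of index at least \<open>k\<close> act trivially, so that unions and quantifiers
  may range over the countable type of all words without changing the orbits. \<open>act_inj\<close>
  is freeness: each orbit is a tree whose paths are the reduced words.\<close>

locale letter_action =
  fixes M :: "'a measure" and k :: nat and T :: "letter \<Rightarrow> 'a \<Rightarrow> 'a" and h :: "'a \<Rightarrow> real"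
  assumes T_measurable [measurable]: "T s \<in> M \<rightarrow>\<^sub>M M"
    and T_trivial: "k \<le> fst s \<Longrightarrow> x \<in> space M \<Longrightarrow> T s x = x"
    and T_inv [simp]: "x \<in> space M \<Longrightarrow> T (inv_letter s) (T s x) = x"
    and act_inj: "x \<in> space M \<Longrightarrow> v \<in> reduced_words k \<Longrightarrow> w \<in> reduced_words k \<Longrightarrow>
      foldr T v x = foldr T w x \<Longrightarrow> v = w"
    and h_measurable [measurable]: "h \<in> borel_measurable M"
    and h_inj: "inj_on h (space M)"
begin

abbreviation act :: "letter list \<Rightarrow> 'a \<Rightarrow> 'a" where
  "act w \<equiv> foldr T w"

lemma T_space [simp]: "x \<in> space M \<Longrightarrow> T s x \<in> space M"
  using measurable_space[OF T_measurable] .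

lemma act_space [simp]: "x \<in> space M \<Longrightarrow> act w x \<in> space M"
  by (induction w) auto

lemma act_measurable [measurable]: "act w \<in> M \<rightarrow>\<^sub>M M"
proof (induction w)
  case (Cons s w)
  then show ?case using measurable_compose[OF Cons T_measurable[of s]] by (simp add: comp_def)
qed simp

lemma T_inv' [simp]: "x \<in> space M \<Longrightarrow> T s (T (inv_letter s) x) = x"
  using T_inv[of x "inv_letter s"] by simp

definition step :: "('a \<Rightarrow> letter) \<Rightarrow> 'a \<Rightarrow> 'a" where
  "step dir x = T (dir x) x"

text \<open>Spells the path that leaves \<open>y\<close> by \<open>s\<close> and then takes
  \<open>i\<close> steps along \<open>dir\<close>. Words act from the right, so the latest letter
  stands in front, and the length is one more than \<open>i\<close>.\<close>

primrec chain_word :: "('a \<Rightarrow> letter) \<Rightarrow> 'a \<Rightarrow> letter \<Rightarrow> nat \<Rightarrow> letter list" where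
  "chain_word dir y s 0 = [s]"
| "chain_word dir y s (Suc i) = dir ((step dir ^^ i) (T s y)) # chain_word dir y s i"

lemma act_chain_word: "act (chain_word dir y s i) y = (step dir ^^ i) (T s y)"
  by (induction i) (auto simp: step_def[of dir "(step dir ^^ _) _"])

lemma length_chain_word [simp]: "length (chain_word dir y s i) = Suc i"
  by (induction i) auto

text \<open>
  A seed system orients the Schreier graph on \<open>X\<close> towards the seeds \<open>Z\<close>, except for extra edges
  \<open>(y, T s y)\<close> with \<open>y \<in> Lk s\<close>; from the far end of an extra edge the orientation
  leads away from the seeds for \<open>N\<close> steps, along paths that are disjoint for distinct extra edges.
\<close>

definition seed_system ::
    "nat \<Rightarrow> 'a set \<Rightarrow> 'a set \<Rightarrow> ('a \<Rightarrow> letter) \<Rightarrow> (letter \<Rightarrow> 'a set) \<Rightarrow> bool" where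
  "seed_system N X Z dir Lk \<longleftrightarrow>
     X \<in> sets M \<and> Z \<in> sets M \<and> dir \<in> M \<rightarrow>\<^sub>M count_space UNIV \<and> (\<forall>s. Lk s \<in> sets M) \<and>
     (\<forall>s. Lk s \<subseteq> X \<inter> Z \<and> (Lk s \<noteq> {} \<longrightarrow> fst s < k)) \<and>
     (\<forall>x\<in>X. \<forall>s. T s x \<in> X) \<and>
     (\<forall>x\<in>X - Z. fst (dir x) < k) \<and>
     (\<forall>x\<in>X. \<exists>t. (step dir ^^ t) x \<in> Z) \<and>
     (\<forall>x\<in>X. \<forall>s. fst s < k \<longrightarrow> x \<notin> Z \<and> dir x = s \<or> T s x \<notin> Z \<and> dir (T s x) = inv_letter s \<or>
        x \<in> Lk s \<or> T s x \<in> Lk (inv_letter s)) \<and>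
     (\<forall>s. \<forall>y\<in>Lk s. \<forall>i<N. (step dir ^^ i) (T s y) \<notin> Z \<and> chain_word dir y s i \<in> reduced_words k) \<and>
     (\<forall>s s' i i'. \<forall>y\<in>Lk s. \<forall>y'\<in>Lk s'. i < N \<and> i' < N \<and>
        (step dir ^^ i) (T s y) = (step dir ^^ i') (T s' y') \<longrightarrow> y = y' \<and> s = s')"

text \<open>Seeds are labelled 0, and every other point takes a label compatible with that of its
  successor. On the chain behind an extra edge the label is moreover kept among those reachable from
  0 along the chain word. This restriction is passed back from each chain point to the previous one;
  at the last it is void by mixing, and at the first it is the constraint of the extra edge.\<close>

lemma seed_labelling:
  fixes R :: "letter \<Rightarrow> (nat \<times> nat) set"
  assumes seeds: "seed_system N X Z dir Lk" and N: "1 \<le> N" and n: "1 \<le> n"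
    and R_bounded: "\<And>s. R s \<subseteq> {..<n} \<times> {..<n}"
    and R_inv: "\<And>s. R (inv_letter s) = (R s)\<inverse>"
    and R_total: "\<And>s l. fst s < k \<Longrightarrow> l < n \<Longrightarrow> \<exists>l'. (l, l') \<in> R s"
    and R_mixing: "\<And>w a b. w \<in> reduced_words k \<Longrightarrow> N \<le> length w \<Longrightarrow> a < n \<Longrightarrow> b < n \<Longrightarrow>
      (a, b) \<in> path_rel R w"
  obtains c :: "'a \<Rightarrow> nat" where "c \<in> M \<rightarrow>\<^sub>M count_space UNIV" "\<And>x. x \<in> X \<Longrightarrow> c x < n"
    "\<And>x s. x \<in> X \<Longrightarrow> fst s < k \<Longrightarrow> (c x, c (T s x)) \<in> R s"
proof -
  have [measurable]: "X \<in> sets M" "Z \<in> sets M" "dir \<in> M \<rightarrow>\<^sub>M count_space UNIV" "\<And>s. Lk s \<in> sets M"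
    using seeds by (auto simp: seed_system_def)
  have LkZ: "\<And>s y. y \<in> Lk s \<Longrightarrow> y \<in> X \<and> y \<in> Z \<and> fst s < k"
    and XT: "\<And>x s. x \<in> X \<Longrightarrow> T s x \<in> X"
    and dir_k: "\<And>x. x \<in> X \<Longrightarrow> x \<notin> Z \<Longrightarrow> fst (dir x) < k"
    and reach: "\<And>x. x \<in> X \<Longrightarrow> \<exists>t. (step dir ^^ t) x \<in> Z"
    and cover: "\<And>x s. x \<in> X \<Longrightarrow> fst s < k \<Longrightarrow> x \<notin> Z \<and> dir x = s \<or>
        T s x \<notin> Z \<and> dir (T s x) = inv_letter s \<or> x \<in> Lk s \<or> T s x \<in> Lk (inv_letter s)"
    and chainZ: "\<And>s y i. y \<in> Lk s \<Longrightarrow> i < N \<Longrightarrow> (step dir ^^ i) (T s y) \<notin> Z"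
    and chain_red: "\<And>s y i. y \<in> Lk s \<Longrightarrow> i < N \<Longrightarrow> chain_word dir y s i \<in> reduced_words k"
    and disj: "\<And>s s' i i' y y'. y \<in> Lk s \<Longrightarrow> y' \<in> Lk s' \<Longrightarrow> i < N \<Longrightarrow> i' < N \<Longrightarrow>
        (step dir ^^ i) (T s y) = (step dir ^^ i') (T s' y') \<Longrightarrow> y = y' \<and> s = s'"
    using seeds unfolding seed_system_def by blast+
  have X_space: "x \<in> space M" if "x \<in> X" for x
    using that sets.sets_into_space[of X M] by auto
  let ?F = "step dir"
  have F_measurable [measurable]: "?F \<in> M \<rightarrow>\<^sub>M M"
    unfolding step_def by (rule measurable_compose_countable) measurable
  have XF: "?F x \<in> X" if "x \<in> X" for x using XT that by (simp add: step_def)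
  define u where "u y s i = (?F ^^ i) (T s y)" for y s i
  have u_0: "u y s 0 = T s y" and u_Suc: "u y s (Suc i) = ?F (u y s i)" for y s i
    by (auto simp: u_def)
  define W where "W y s i = path_rel R (chain_word dir y s i)" for y s i
  have W_Suc: "W y s (Suc i) = W y s i O R (dir (u y s i))" for y s i
    by (simp add: W_def u_def)
  have W_0: "W y s 0 = R s" for y s by (simp add: W_def)
  have R_surj: "\<exists>l'. (l', l) \<in> R s" if "fst s < k" "l < n" for s l
    using R_total[of "inv_letter s" l] R_inv[of s] that by auto
  \<comment> \<open>Reachability along chains is described from the receiving end: each layer
    inspects the neighbours that point to \<open>x\<close>, of which there are finitely many,
    instead of quantifying over the possibly uncountable set of links. This keeps it
    measurable.\<close>
  define Al where "Al = rec_nat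
     (\<lambda>x l. l < n \<and> (\<forall>s. fst s < k \<and> T s x \<in> Lk (inv_letter s) \<longrightarrow> (0, l) \<in> R (inv_letter s)))
     (\<lambda>i P x l. l < n \<and> (\<forall>s. fst s < k \<and> T s x \<notin> Z \<and> dir (T s x) = inv_letter s \<longrightarrow>
        (\<exists>l'. P (T s x) l' \<and> (l', l) \<in> R (inv_letter s))))"
  have Al_0: "Al 0 x l \<longleftrightarrow> l < n \<and>
      (\<forall>s. fst s < k \<and> T s x \<in> Lk (inv_letter s) \<longrightarrow> (0, l) \<in> R (inv_letter s))" for x l
    by (simp add: Al_def)
  have Al_Suc: "Al (Suc i) x l \<longleftrightarrow> l < n \<and>
      (\<forall>s. fst s < k \<and> T s x \<notin> Z \<and> dir (T s x) = inv_letter s \<longrightarrow>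
        (\<exists>l'. Al i (T s x) l' \<and> (l', l) \<in> R (inv_letter s)))" for i x l
    by (simp add: Al_def)
  have Al_measurable [measurable]: "Measurable.pred M (\<lambda>x. Al i x l)" for i l
  proof (induction i arbitrary: l)
    case 0
    then show ?case unfolding Al_0 by measurable
  next
    case (Suc i)
    have [measurable]: "Measurable.pred M (\<lambda>x. Al i (T s x) l)" for s l
      using measurable_compose[OF T_measurable Suc] .
    show ?case unfolding Al_Suc by measurable
  qed
  have Al_chain: "Al i x l \<longleftrightarrow> l < n \<and> (\<forall>y s. y \<in> Lk s \<and> x = u y s i \<longrightarrow> (0, l) \<in> W y s i)"
    if "x \<in> X" "i < N" for i x l
    using that
  proof (induction i arbitrary: x l)
    case 0
    have "(fst s < k \<and> T s x \<in> Lk (inv_letter s) \<longrightarrow> (0, l) \<in> R (inv_letter s)) \<longleftrightarrow>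
        (\<forall>y. y \<in> Lk (inv_letter s) \<and> x = u y (inv_letter s) 0 \<longrightarrow> (0, l) \<in> W y (inv_letter s) 0)" for s
    proof -
      have "y = T s x" if "y \<in> Lk (inv_letter s)" "x = T (inv_letter s) y" for y
        using that LkZ X_space by simp
      moreover have "x = T (inv_letter s) (T s x)" using 0 X_space by simp
      ultimately show ?thesis using LkZ unfolding W_0 u_0 by fastforce
    qed
    then show ?case unfolding Al_0 by (metis inv_letter_inv_letter)
  next
    case (Suc i)
    have i: "i < N" using Suc by simp
    note IH = Suc.IH[OF _ i]
    have x: "x \<in> X" "x \<in> space M" using Suc.prems X_space by auto
    show ?case
    proof (intro iffI conjI allI impI)
      assume Al: "Al (Suc i) x l"
      then show "l < n" by (simp add: Al_Suc)
      fix y s assume ys: "y \<in> Lk s \<and> x = u y s (Suc i)"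
      have "T s y \<in> X" using LkZ ys XT by blast
      then have "(?F ^^ j) (T s y) \<in> X" for j using XF by (induction j) auto
      then have "u y s i \<in> X" by (simp add: u_def)
      then have t: "u y s i \<in> X" "u y s i \<in> space M" using X_space by auto
      have tZ: "u y s i \<notin> Z" using chainZ ys i by (simp add: u_def)
      let ?s = "inv_letter (dir (u y s i))"
      have xs: "x = T (dir (u y s i)) (u y s i)" using ys by (simp add: u_Suc step_def)
      then have Tx: "T ?s x = u y s i" using t by simp
      have "fst ?s < k" using dir_k[OF t(1) tZ] by simp
      then obtain l' where l': "Al i (u y s i) l'" "(l', l) \<in> R (dir (u y s i))"
        using Al tZ unfolding Al_Suc by (metis Tx inv_letter_inv_letter)
      then have "(0, l') \<in> W y s i" using IH[OF t(1)] ys by blast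
      then show "(0, l) \<in> W y s (Suc i)" using l' by (auto simp: W_Suc)
    next
      assume r: "l < n \<and> (\<forall>y s. y \<in> Lk s \<and> x = u y s (Suc i) \<longrightarrow> (0, l) \<in> W y s (Suc i))"
      have "\<exists>l'. Al i (T s x) l' \<and> (l', l) \<in> R (inv_letter s)"
        if s: "fst s < k" "T s x \<notin> Z" "dir (T s x) = inv_letter s" for s
      proof -
        have tX: "T s x \<in> X" using XT x by blast
        have Ft: "?F (T s x) = x" using s x by (simp add: step_def)
        show ?thesis
        proof (cases "\<exists>y s'. y \<in> Lk s' \<and> T s x = u y s' i")
          case True
          then obtain y s' where y: "y \<in> Lk s'" "T s x = u y s' i" by blast
          then have "x = u y s' (Suc i)" using Ft by (simp add: u_Suc)
          then have "(0, l) \<in> W y s' (Suc i)" using r y by blast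
          then obtain l' where l': "(0, l') \<in> W y s' i" "(l', l) \<in> R (inv_letter s)"
            using s(3) y(2) unfolding W_Suc by auto
          \<comment> \<open>By disjointness the predecessor is on the chain of a single link, so one
            witness satisfies all of its restrictions.\<close>
          have uniq: "y'' = y \<and> s'' = s'" if "y'' \<in> Lk s''" "T s x = u y'' s'' i" for y'' s''
            using disj[OF that(1) y(1) i i] that(2) y(2) by (simp add: u_def)
          have "l' < n" using l'(2) R_bounded by fastforce
          then have "Al i (T s x) l'" using IH[OF tX] l'(1) uniq by blast
          then show ?thesis using l'(2) by blast
        next
          case False
          obtain l' where l': "(l', l) \<in> R (inv_letter s)" using R_surj[of "inv_letter s" l] r s by auto
          then have "l' < n" using R_bounded by fastforce
          then have "Al i (T s x) l'" using IH[OF tX] False by blast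
          then show ?thesis using l' by blast
        qed
      qed
      then show "Al (Suc i) x l" using r unfolding Al_Suc by blast
    qed
  qed
  define A where "A x l \<longleftrightarrow> (\<forall>i<N. Al i x l)" for x l
  have A_measurable [measurable]: "Measurable.pred M (\<lambda>x. A x l)" for l
    unfolding A_def by measurable
  have A_iff: "A x l \<longleftrightarrow> l < n \<and> (\<forall>y s. \<forall>i<N. y \<in> Lk s \<and> x = u y s i \<longrightarrow> (0, l) \<in> W y s i)"
    if "x \<in> X" for x l
    using Al_chain[OF that] N unfolding A_def by (metis less_le_trans zero_less_one)
  \<comment> \<open>\<open>C t\<close> unrolls the recursion towards the seeds for \<open>t\<close>
    steps, so each stage is measurable by induction. The final label is read off at the stage given
    by the distance to the seed reached along \<open>dir\<close>.\<close>
  define C where "C = rec_nat (\<lambda>x. 0::nat)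
     (\<lambda>t C x. if x \<in> Z then 0 else LEAST l. A x l \<and> (l, C (?F x)) \<in> R (dir x))"
  have C_Suc: "C (Suc t) = (\<lambda>x. if x \<in> Z then 0 else LEAST l. A x l \<and> (l, C t (?F x)) \<in> R (dir x))" for t
    unfolding C_def by simp
  have C_measurable [measurable]: "C t \<in> M \<rightarrow>\<^sub>M count_space UNIV" for t
  proof (induction t)
    case (Suc t)
    have [measurable]: "(\<lambda>x. C t (?F x)) \<in> M \<rightarrow>\<^sub>M count_space UNIV"
      using measurable_compose[OF F_measurable Suc] .
    have "(\<lambda>x. if x \<in> Z then 0 else LEAST l. A x l \<and> (l, C t (?F x)) \<in> R (dir x))
        \<in> M \<rightarrow>\<^sub>M count_space UNIV"
      by measurable
    then show ?case by (simp only: C_Suc)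
  qed (simp add: C_def)
  define dep where "dep x = (LEAST t. (?F ^^ t) x \<in> Z)" for x
  have dep_measurable [measurable]: "dep \<in> M \<rightarrow>\<^sub>M count_space UNIV"
    unfolding dep_def by measurable
  define c where "c x = C (dep x) x" for x
  have c_measurable: "c \<in> M \<rightarrow>\<^sub>M count_space UNIV"
    unfolding c_def by (rule measurable_compose_countable) measurable
  have c_Z: "c x = 0" if "x \<in> Z" for x
  proof -
    have "dep x = 0" unfolding dep_def using that by (intro Least_eq_0) auto
    then show ?thesis by (simp add: c_def C_def)
  qed
  have dep_Suc: "dep x = Suc (dep (?F x))" if x: "x \<in> X" "x \<notin> Z" for x
  proof -
    obtain t where t: "(?F ^^ t) x \<in> Z" using reach[OF x(1)] by blast
    have "dep x = Suc (LEAST t. (?F ^^ Suc t) x \<in> Z)"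
      unfolding dep_def using x(2) by (intro Least_Suc[of "\<lambda>t. (?F ^^ t) x \<in> Z", OF t]) auto
    then show ?thesis by (simp add: dep_def funpow_swap1)
  qed
  have c_rec: "c x = (LEAST l. A x l \<and> (l, c (?F x)) \<in> R (dir x))" if "x \<in> X" "x \<notin> Z" for x
    using that dep_Suc[OF that] by (simp add: c_def C_def)
  have A_Z: "A x l \<longleftrightarrow> l < n" if "x \<in> X" "x \<in> Z" for x l
    using A_iff[OF that(1)] chainZ that(2) unfolding u_def by blast
  have main: "A x (c x) \<and> (x \<notin> Z \<longrightarrow> (c x, c (?F x)) \<in> R (dir x))" if "x \<in> X" for x
    using that
  proof (induction "dep x" arbitrary: x)
    case 0
    then have "x \<in> Z" using dep_Suc[of x] by (cases "x \<in> Z") auto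
    then show ?case using A_Z[OF 0(2)] c_Z n by auto
  next
    case (Suc d)
    show ?case
    proof (cases "x \<in> Z")
      case True
      then show ?thesis using A_Z[OF Suc(3)] c_Z n by auto
    next
      case False
      have x: "x \<in> X" by fact
      have "dep (?F x) = d" using dep_Suc[OF x False] Suc(2) by simp
      then have IH: "A (?F x) (c (?F x))" using Suc(1)[of "?F x"] XF[OF x] by blast
      then have cn: "c (?F x) < n" using A_iff[OF XF[OF x]] by blast
      have "\<exists>l. A x l \<and> (l, c (?F x)) \<in> R (dir x)"
      proof (cases "\<exists>y s. \<exists>i. Suc i < N \<and> y \<in> Lk s \<and> x = u y s i")
        case True
        then obtain y s i where y: "Suc i < N" "y \<in> Lk s" "x = u y s i" by blast
        then have "?F x = u y s (Suc i)" by (simp add: u_Suc)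
        then have "(0, c (?F x)) \<in> W y s (Suc i)"
          using IH A_iff[OF XF[OF x], of "c (?F x)"] y(1,2) by blast
        then obtain l where l: "(0, l) \<in> W y s i" "(l, c (?F x)) \<in> R (dir x)"
          using y by (auto simp: W_Suc)
        \<comment> \<open>Disjointness of the chains identifies the link, and freeness then
          identifies the position, because words of different lengths cannot lead from
          \<open>y\<close> to the same point.\<close>
        have "y' = y \<and> s' = s \<and> i' = i" if "i' < N" "y' \<in> Lk s'" "x = u y' s' i'" for y' s' i'
        proof -
          have e: "y' = y \<and> s' = s"
            using disj[OF that(2) y(2) that(1) Suc_lessD[OF y(1)]] that(3) y(3) by (simp add: u_def)
          have "act (chain_word dir y s i) y = act (chain_word dir y s i') y"
            using that(3) y(3) e by (simp add: act_chain_word u_def)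
          then have "chain_word dir y s i = chain_word dir y s i'"
            using act_inj X_space LkZ chain_red that(1) y e by (meson Suc_lessD)
          then show ?thesis using e by (metis length_chain_word nat.inject)
        qed
        then have "A x l" using A_iff[OF x] l R_bounded by blast
        then show ?thesis using l by blast
      next
        case False': False
        obtain l where l: "(l, c (?F x)) \<in> R (dir x)"
          using R_surj[OF dir_k[OF x False] cn] by blast
        have ln: "l < n" using l R_bounded by fastforce
        have "(0, l) \<in> W y s i" if "i < N" "y \<in> Lk s" "x = u y s i" for y s i
        proof -
          \<comment> \<open>In this case \<open>x\<close> can only be the last point of a chain. Its
            chain word has length \<open>N\<close>, just long enough for mixing to lead from 0 to
            any label.\<close>
          have "Suc i = N" using False' that by (metis Suc_lessI)
          then show ?thesis
            unfolding W_def using n ln chain_red[OF that(2,1)] by (intro R_mixing) auto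
        qed
        then have "A x l" using A_iff[OF x] ln by blast
        then show ?thesis using l by blast
      qed
      from LeastI_ex[OF this] show ?thesis
        using c_rec[OF x False] by simp
    qed
  qed
  show thesis
  proof (rule that[OF c_measurable])
    fix x assume x: "x \<in> X"
    then show "c x < n" using main A_iff by blast
    fix s :: letter assume s: "fst s < k"
    have start: "(0, c (T s' y)) \<in> R s'" if "y \<in> Lk s'" for y s'
    proof -
      have "T s' y \<in> X" using LkZ XT that by blast
      then have "A (T s' y) (c (T s' y))" using main by blast
      then have "(0, c (T s' y)) \<in> W y s' 0"
        using A_iff[OF \<open>T s' y \<in> X\<close>] that N u_0 by (metis less_le_trans zero_less_one)
      then show ?thesis by (simp add: W_0)
    qed
    consider "x \<notin> Z" "dir x = s" | "T s x \<notin> Z" "dir (T s x) = inv_letter s" | "x \<in> Lk s" |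
      "T s x \<in> Lk (inv_letter s)" using cover[OF x s] by blast
    then show "(c x, c (T s x)) \<in> R s"
    proof cases
      case 1
      then show ?thesis using main[OF x] by (auto simp: step_def)
    next
      case 2
      then have "?F (T s x) = x" using X_space[OF x] by (simp add: step_def)
      then have "(c (T s x), c x) \<in> R (inv_letter s)" using main[OF XT[OF x], of s] 2 by simp
      then show ?thesis by (simp add: R_inv)
    next
      case 3
      then show ?thesis using start[OF 3] c_Z LkZ by simp
    next
      case 4
      then show ?thesis using start[OF 4] c_Z LkZ X_space[OF x] R_inv by simp
    qed
  qed
qed

end

section \<open>Finite colourings\<close>

abbreviation letters :: "nat \<Rightarrow> letter set" where
  "letters k \<equiv> {s. fst s < k}"

lemma letters_eq: "letters k = {..<k} \<times> UNIV"
  by auto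

lemma finite_letters [simp]: "finite (letters k)"
  unfolding letters_eq by simp

lemma inv_letter_eq_iff: "s = inv_letter t \<longleftrightarrow> t = inv_letter s"
  by auto

definition inv_word :: "letter list \<Rightarrow> letter list" where
  "inv_word w = rev (map inv_letter w)"

lemma length_inv_word [simp]: "length (inv_word w) = length w"
  by (simp add: inv_word_def)

lemma inv_word_letters: "set w \<subseteq> letters k \<Longrightarrow> set (inv_word w) \<subseteq> letters k"
  by (auto simp: inv_word_def)

lemma reduced_words_letters: "w \<in> reduced_words k \<Longrightarrow> set w \<subseteq> letters k"
  by (auto simp: reduced_words_def)

context letter_action
begin

lemma act_append [simp]: "act (v @ w) x = act v (act w x)"
  by simp

lemma act_inv_word [simp]: "x \<in> space M \<Longrightarrow> act (inv_word w) (act w x) = x"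
  by (induction w) (auto simp: inv_word_def)

lemma act_push_letter: "x \<in> space M \<Longrightarrow> act (push_letter s w) x = T s (act w x)"
  by (cases w) auto

lemma act_reduced:
  assumes "x \<in> space M"
  shows "\<exists>v\<in>reduced_words k. act v x = act w x"
proof (induction w)
  case Nil
  then show ?case by (intro bexI[of _ "[]"]) auto
next
  case (Cons s w)
  then obtain v where v: "v \<in> reduced_words k" "act v x = act w x" by blast
  show ?case
  proof (cases "fst s < k")
    case True
    then show ?thesis
      using v push_letter_reduced[OF True v(1)] act_push_letter[OF assms, of s v]
      by (intro bexI[of _ "push_letter s v"]) auto
  next
    case False
    then show ?thesis using v T_trivial[of s "act w x"] assms by auto
  qed
qed

lemma act_reduced_eq_self:
  assumes "x \<in> space M" "w \<in> reduced_words k" "act w x = x"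
  shows "w = []"
  using act_inj[of x w "[]"] assms by simp

definition separated :: "nat \<Rightarrow> 'a set \<Rightarrow> bool" where
  "separated L I \<longleftrightarrow>
     (\<forall>x\<in>I. \<forall>w. set w \<subseteq> letters k \<and> length w \<le> L \<and> act w x \<in> I \<longrightarrow> act w x = x)"

text \<open>A greedy construction in countably many rounds, one for each rational interval. The
  round for an interval treats only points whose value under \<open>h\<close> is alone in it among
  their finitely many neighbours, so no two nearby points compete in the same round. Every point of
  \<open>S\<close> gets its turn, since some interval isolates it.\<close>

lemma exists_maximal_separated:
  assumes [measurable]: "S \<in> sets M"
  shows "\<exists>I\<in>sets M. I \<subseteq> S \<and> separated L I \<and>
    (\<forall>x\<in>S. \<exists>w. set w \<subseteq> letters k \<and> length w \<le> L \<and> act w x \<in> I)"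
proof -
  let ?W = "{w. set w \<subseteq> letters k \<and> length w \<le> L}"
  have finW: "finite ?W" by (rule finite_lists_length_le) simp
  define lo hi :: "nat \<Rightarrow> real" where "lo i = of_rat (fst (from_nat i :: rat \<times> rat))" and
    "hi i = of_rat (snd (from_nat i :: rat \<times> rat))" for i
  define V where "V i = {x \<in> space M. lo i < h x \<and> h x < hi i \<and>
     (\<forall>w\<in>?W. h (act w x) = h x \<or> \<not> (lo i < h (act w x) \<and> h (act w x) < hi i))}" for i
  have V_measurable [measurable]: "V i \<in> sets M" for i unfolding V_def by measurable
  define I where "I = rec_nat {} (\<lambda>i J. J \<union> {x \<in> space M. x \<in> S \<and> x \<in> V i \<and> (\<forall>w\<in>?W. act w x \<notin> J)})"
  have I_0: "I 0 = {}" and I_Suc: "I (Suc i) = I i \<union> {x \<in> space M. x \<in> S \<and> x \<in> V i \<and>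
      (\<forall>w\<in>?W. act w x \<notin> I i)}" for i
    by (auto simp: I_def)
  have I_measurable [measurable]: "I i \<in> sets M" for i
  proof (induction i)
    case (Suc i)
    note [measurable] = Suc
    show ?case unfolding I_Suc by measurable
  qed (simp add: I_0)
  have I_S: "I i \<subseteq> S" for i by (induction i) (auto simp: I_0 I_Suc)
  have I_space: "I i \<subseteq> space M" for i using sets.sets_into_space[OF I_measurable] .
  have I_mono: "I i \<subseteq> I j" if "i \<le> j" for i j
    using that by (rule lift_Suc_mono_le[of I, rotated]) (auto simp: I_Suc)
  have inv_W: "inv_word w \<in> ?W" if "w \<in> ?W" for w using that inv_word_letters by auto
  have I_sep: "act w x = x" if "x \<in> I i" "w \<in> ?W" "act w x \<in> I i" for x w i
    using that
  proof (induction i)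
    case (Suc i)
    have xs: "x \<in> space M" using Suc.prems I_space by blast
    have x_new: "x \<in> V i" "\<forall>w\<in>?W. act w x \<notin> I i" if "x \<notin> I i"
      using Suc.prems that by (auto simp: I_Suc)
    have w_new: "act w x \<in> V i" "\<forall>v\<in>?W. act v (act w x) \<notin> I i" if "act w x \<notin> I i"
      using Suc.prems that by (auto simp: I_Suc)
    consider "x \<in> I i" "act w x \<in> I i" | "x \<notin> I i" "act w x \<in> I i" | "x \<in> I i" "act w x \<notin> I i"
      | "x \<notin> I i" "act w x \<notin> I i" by blast
    then show ?case
    proof cases
      case 1
      then show ?thesis using Suc by blast
    next
      case 2
      then show ?thesis using x_new Suc.prems by blast
    next
      case 3
      then have "act (inv_word w) (act w x) \<notin> I i" using w_new inv_W Suc.prems by blast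
      then show ?thesis using 3 xs by simp
    next
      case 4
      then have "h (act w x) = h x"
        using x_new w_new Suc.prems(2) unfolding V_def by blast
      then show ?thesis using h_inj xs act_space by (meson inj_onD)
    qed
  qed (simp add: I_0)
  have "separated L (\<Union>i. I i)"
    unfolding separated_def
  proof (intro ballI allI impI)
    fix x w assume "x \<in> (\<Union>i. I i)" and w: "set w \<subseteq> letters k \<and> length w \<le> L \<and> act w x \<in> (\<Union>i. I i)"
    then obtain i j where "x \<in> I i" "act w x \<in> I j" by blast
    then have "x \<in> I (max i j)" "act w x \<in> I (max i j)"
      using I_mono[of i "max i j"] I_mono[of j "max i j"] by auto
    then show "act w x = x" using I_sep w by blast
  qed
  moreover have "\<exists>w\<in>?W. act w x \<in> (\<Union>i. I i)" if x: "x \<in> S" for x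
  proof -
    have xs: "x \<in> space M" using x sets.sets_into_space[OF assms] by blast
    obtain d where d: "d > 0" "\<forall>y\<in>(\<lambda>w. h (act w x)) ` ?W. y \<noteq> h x \<longrightarrow> d \<le> dist (h x) y"
      using finite_set_avoid[of "(\<lambda>w. h (act w x)) ` ?W" "h x"] finW by auto
    obtain p q :: rat where pq: "h x - d < of_rat p" "of_rat p < h x" "h x < of_rat q" "of_rat q < h x + d"
      using of_rat_dense[of "h x - d" "h x"] of_rat_dense[of "h x" "h x + d"] d(1) by auto
    define i where "i = to_nat (p, q)"
    have i: "lo i = of_rat p" "hi i = of_rat q" by (auto simp: i_def lo_def hi_def)
    have "h (act w x) = h x \<or> \<not> (lo i < h (act w x) \<and> h (act w x) < hi i)" if "w \<in> ?W" for w
      using bspec[OF d(2) imageI[OF that]] pq unfolding i dist_real_def by argo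
    then have "x \<in> V i" using xs pq by (auto simp: V_def i)
    show ?thesis
    proof (cases "\<forall>w\<in>?W. act w x \<notin> I i")
      case True
      then have "act [] x \<in> I (Suc i)" using xs x \<open>x \<in> V i\<close> by (auto simp: I_Suc)
      then show ?thesis by (intro bexI[of _ "[]"]) auto
    qed blast
  qed
  ultimately show ?thesis using I_S by (intro bexI[of _ "\<Union>i. I i"]) auto
qed

text \<open>Maximal separated sets are removed one after the other. A point surviving a round is
  joined by a short word to the set just removed; these sets are disjoint, so different rounds use
  different words, and there are only finitely many of those.\<close>

lemma exists_finite_colouring:
  "\<exists>(Y :: nat \<Rightarrow> 'a set) q :: nat. (\<forall>i. Y i \<in> sets M \<and> separated L (Y i)) \<and>
     (\<forall>x\<in>space M. \<exists>i<q. x \<in> Y i)"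
proof -
  let ?W = "{w. set w \<subseteq> letters k \<and> length w \<le> L}"
  have finW: "finite ?W" by (rule finite_lists_length_le) simp
  obtain ind where ind: "\<And>S. S \<in> sets M \<Longrightarrow> ind S \<in> sets M \<and> ind S \<subseteq> S \<and> separated L (ind S) \<and>
    (\<forall>x\<in>S. \<exists>w. set w \<subseteq> letters k \<and> length w \<le> L \<and> act w x \<in> ind S)"
    using exists_maximal_separated[of _ L] by metis
  define S where "S = rec_nat (space M) (\<lambda>i S. S - ind S)"
  have S_0: "S 0 = space M" and S_Suc: "S (Suc i) = S i - ind (S i)" for i by (auto simp: S_def)
  have S_measurable: "S i \<in> sets M" for i
    by (induction i) (auto simp: S_0 S_Suc ind)
  have S_anti: "S j \<subseteq> S i" if "i \<le> j" for i j
    using that by (rule lift_Suc_antimono_le[of S, rotated]) (auto simp: S_Suc)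
  have disj: "i = j" if "x \<in> ind (S i)" "x \<in> ind (S j)" for x i j
  proof -
    have "\<not> a < b" if "x \<in> ind (S a)" "x \<in> ind (S b)" for a b
    proof
      assume "a < b"
      then have "S b \<subseteq> S a - ind (S a)" using S_anti[of "Suc a" b] by (simp add: S_Suc)
      then show False using that ind[OF S_measurable[of b]] by blast
    qed
    then show ?thesis using that by (metis nat_neq_iff)
  qed
  show ?thesis
  proof (rule exI[of _ "\<lambda>i. ind (S i)"], rule exI[of _ "Suc (card ?W)"], intro conjI allI ballI)
    show "ind (S i) \<in> sets M" "separated L (ind (S i))" for i using ind S_measurable by blast+
  next
    fix x assume x: "x \<in> space M"
    show "\<exists>i<Suc (card ?W). x \<in> ind (S i)"
    proof (rule ccontr)
      assume n: "\<not> ?thesis"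
      have "x \<in> S i" if "i < Suc (card ?W)" for i
        using that n by (induction i) (auto simp: S_0 S_Suc x)
      then have "\<forall>i\<in>{..<Suc (card ?W)}. \<exists>w. w \<in> ?W \<and> act w x \<in> ind (S i)"
        using ind[OF S_measurable] by blast
      from bchoice[OF this] obtain f
        where f: "\<And>i. i < Suc (card ?W) \<Longrightarrow> f i \<in> ?W \<and> act (f i) x \<in> ind (S i)" by auto
      have "inj_on f {..<Suc (card ?W)}"
      proof (rule inj_onI)
        fix i j assume "i \<in> {..<Suc (card ?W)}" "j \<in> {..<Suc (card ?W)}" "f i = f j"
        then have "act (f i) x \<in> ind (S i)" "act (f i) x \<in> ind (S j)" using f[of i] f[of j] by auto
        then show "i = j" by (rule disj)
      qed
      moreover have "f ` {..<Suc (card ?W)} \<subseteq> ?W" using f by auto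
      ultimately have "Suc (card ?W) \<le> card ?W"
        using card_inj_on_le[OF _ _ finW] by fastforce
      then show False by simp
    qed
  qed
qed

end

section \<open>Potentials\<close>

text \<open>
  A value \<open>p x s\<close> is the mass, in a probability measure on the ends of the tree of \<open>x\<close> and its
  vertices, of the half-tree that \<open>x\<close> sees in the direction of the letter \<open>s\<close>.
\<close>

locale potential = letter_action +
  fixes X :: "'a set" and p :: "'a \<Rightarrow> letter \<Rightarrow> real"
  assumes X_sets [measurable]: "X \<in> sets M"
    and X_invariant: "x \<in> X \<Longrightarrow> T s x \<in> X"
    and p_measurable [measurable]: "(\<lambda>x. p x s) \<in> borel_measurable M"
    and p_nonneg: "x \<in> X \<Longrightarrow> fst s < k \<Longrightarrow> 0 \<le> p x s"
    and p_edge: "x \<in> X \<Longrightarrow> fst s < k \<Longrightarrow> p x s + p (T s x) (inv_letter s) = 1"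
    and p_sum: "x \<in> X \<Longrightarrow> (\<Sum>s\<in>letters k. p x s) \<le> 1"
begin

lemma X_space: "x \<in> X \<Longrightarrow> x \<in> space M"
  using sets.sets_into_space[OF X_sets] by blast

lemma X_act: "x \<in> X \<Longrightarrow> act w x \<in> X"
  by (induction w) (auto simp: X_invariant)

lemma p_sum_le:
  assumes "x \<in> X" "S \<subseteq> letters k"
  shows "(\<Sum>s\<in>S. p x s) \<le> 1"
proof -
  have "(\<Sum>s\<in>S. p x s) \<le> (\<Sum>s\<in>letters k. p x s)"
    using assms p_nonneg by (intro sum_mono2) auto
  then show ?thesis using p_sum[OF assms(1)] by linarith
qed

lemma p_add_le:
  assumes "x \<in> X" "fst s < k" "fst s' < k" "s \<noteq> s'"
  shows "p x s + p x s' \<le> 1"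
  using p_sum_le[OF assms(1), of "{s, s'}"] assms by simp

definition balanced :: "'a \<Rightarrow> bool" where
  "balanced x \<longleftrightarrow> (\<forall>s. fst s < k \<longrightarrow> p x s \<le> 1/2)"

text \<open>Taking the least code of a suitable letter keeps the map measurable. On
  \<open>X\<close>, exactly one letter qualifies where \<open>balanced\<close> fails; at balanced
  points the value carries no meaning.\<close>

definition heavy :: "'a \<Rightarrow> letter" where
  "heavy x = from_nat (LEAST i. fst (from_nat i :: letter) < k \<and> 1/2 < p x (from_nat i))"

lemma balanced_measurable [measurable]: "Measurable.pred M balanced"
  unfolding balanced_def by measurable

lemma heavy_measurable [measurable]: "heavy \<in> M \<rightarrow>\<^sub>M count_space UNIV"
  unfolding heavy_def by measurable

lemma heavy:
  assumes "\<not> balanced x"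
  shows "fst (heavy x) < k" "1/2 < p x (heavy x)"
proof -
  obtain s where s: "fst s < k" "1/2 < p x s"
    using assms unfolding balanced_def by (meson not_le)
  then have "\<exists>i. fst (from_nat i :: letter) < k \<and> 1/2 < p x (from_nat i)"
    by (intro exI[of _ "to_nat s"]) simp
  from LeastI_ex[OF this] show "fst (heavy x) < k" "1/2 < p x (heavy x)"
    by (auto simp: heavy_def)
qed

lemma heavy_unique:
  assumes "x \<in> X" "fst s < k" "1/2 \<le> p x s" "\<not> balanced x"
  shows "heavy x = s"
  using p_add_le[OF assms(1,2) heavy(1)[OF assms(4)]] heavy(2)[OF assms(4)] assms(3) by fastforce

definition balanced_orbit :: "'a \<Rightarrow> bool" where
  "balanced_orbit x \<longleftrightarrow> (\<exists>w. balanced (act w x))"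

lemma balanced_orbit_measurable [measurable]: "Measurable.pred M balanced_orbit"
  unfolding balanced_orbit_def by measurable

lemma balanced_orbit_T:
  assumes "x \<in> space M"
  shows "balanced_orbit (T s x) = balanced_orbit x"
proof
  assume "balanced_orbit (T s x)"
  then obtain w where "balanced (act (w @ [s]) x)" by (auto simp: balanced_orbit_def)
  then show "balanced_orbit x" unfolding balanced_orbit_def by blast
next
  assume "balanced_orbit x"
  then obtain w where "balanced (act w x)" by (auto simp: balanced_orbit_def)
  then have "balanced (act (w @ [inv_letter s]) (T s x))" using assms by simp
  then show "balanced_orbit (T s x)" unfolding balanced_orbit_def by blast
qed

text \<open>The two half-trees of an edge share mass one, so one of them has at least 1/2. In the
  case of equality the strict inequality at \<open>x\<close> forces its heavy direction to be this
  edge.\<close>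

lemma heavy_edge:
  assumes "x \<in> X" "fst s < k" "\<not> balanced x"
  shows "heavy x = s \<or> \<not> balanced (T s x) \<and> heavy (T s x) = inv_letter s"
proof (cases "1/2 \<le> p x s")
  case True
  then show ?thesis using heavy_unique assms by blast
next
  case False
  then have "1/2 < p (T s x) (inv_letter s)" using p_edge[OF assms(1,2)] by linarith
  moreover from this have "\<not> balanced (T s x)"
    using assms(2) unfolding balanced_def by (metis fst_inv_letter not_le)
  ultimately show ?thesis
    using heavy_unique[OF X_invariant[OF assms(1)], of "inv_letter s" s] assms(2) by auto
qed

subsection \<open>Orbits without balanced points\<close>

primrec heavy_word :: "'a \<Rightarrow> nat \<Rightarrow> letter list" where
  "heavy_word x 0 = []"
| "heavy_word x (Suc i) = heavy ((step heavy ^^ i) x) # heavy_word x i"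

lemma length_heavy_word [simp]: "length (heavy_word x i) = i"
  by (induction i) auto

lemma act_heavy_word: "act (heavy_word x i) x = (step heavy ^^ i) x"
  by (induction i) (auto simp: step_def[of heavy "(step heavy ^^ _) _"])

lemma chain_word_heavy: "chain_word heavy x (heavy x) i = heavy_word x (Suc i)"
proof (induction i)
  case (Suc i)
  have "T (heavy x) x = step heavy x" by (simp add: step_def)
  then show ?case using Suc by (simp add: funpow_swap1)
qed simp

text \<open>Heavy directions never turn back, so every point has a forward ray, and seeds are points
  of a colour that recurs on their ray. Separation by \<open>2 * N\<close> keeps the next
  \<open>N\<close> points after a seed free of seeds. It also keeps chains apart, since two chains
  that meet would join their seeds by a word of length at most \<open>2 * N\<close>.\<close>

lemma end_seed_system:
  "\<exists>Z dir Lk. seed_system N {x \<in> X. \<not> balanced_orbit x} Z dir Lk"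
proof -
  let ?X = "{x \<in> X. \<not> balanced_orbit x}" and ?F = "step heavy"
  obtain Y :: "nat \<Rightarrow> 'a set" and q :: nat where Y [measurable]: "\<And>i. Y i \<in> sets M" and sep: "\<And>i. separated (2 * N) (Y i)"
    and cover: "\<And>x. x \<in> space M \<Longrightarrow> \<exists>i<q. x \<in> Y i"
    using exists_finite_colouring[of "2 * N"] by blast
  have [measurable]: "?X \<in> sets M" by measurable
  have F_measurable [measurable]: "?F \<in> M \<rightarrow>\<^sub>M M"
    unfolding step_def by (rule measurable_compose_countable) measurable
  have XD: "x \<in> X" "x \<in> space M" "\<not> balanced x" if "x \<in> ?X" for x
  proof -
    show "x \<in> X" "x \<in> space M" using that X_space by auto
    have "\<not> balanced (act [] x)" using that unfolding balanced_orbit_def by blast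
    then show "\<not> balanced x" by simp
  qed
  have XT: "T s x \<in> ?X" if "x \<in> ?X" for x s
    using that XD[OF that] X_invariant balanced_orbit_T by simp
  have XF: "(?F ^^ i) x \<in> ?X" if "x \<in> ?X" for x i
  proof (induction i)
    case (Suc i)
    then show ?case using XT unfolding step_def[of heavy "(?F ^^ i) x"] funpow.simps comp_def by blast
  qed (use that in simp)
  \<comment> \<open>As there are finitely many colours, some colour recurs. The least recurrent one
    depends only on the tail of the ray, so it is the same at a point and at its successor.\<close>
  define idx where "idx x = (LEAST i. \<forall>m. \<exists>t\<ge>m. (?F ^^ t) x \<in> Y i)" for x
  have idx_measurable [measurable]: "idx \<in> M \<rightarrow>\<^sub>M count_space UNIV"
    unfolding idx_def by measurable
  have idx: "\<forall>m. \<exists>t\<ge>m. (?F ^^ t) x \<in> Y (idx x)" if xX: "x \<in> ?X" for x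
  proof -
    have "\<exists>i. \<forall>m. \<exists>t\<ge>m. (?F ^^ t) x \<in> Y i"
    proof (rule ccontr)
      assume "\<not> ?thesis"
      then obtain m where m: "\<And>i t. m i \<le> t \<Longrightarrow> (?F ^^ t) x \<notin> Y i" by metis
      let ?t = "\<Sum>i<q. m i"
      obtain i where "i < q" "(?F ^^ ?t) x \<in> Y i" using cover XD(2)[OF XF[OF xX]] by blast
      then show False using m[of i ?t] member_le_sum[of i "{..<q}" m] by auto
    qed
    then show ?thesis unfolding idx_def by (rule LeastI_ex)
  qed
  have idx_F: "idx (?F x) = idx x" for x
  proof -
    have "(\<forall>m. \<exists>t\<ge>m. (?F ^^ t) (?F x) \<in> Y i) \<longleftrightarrow> (\<forall>m. \<exists>t\<ge>m. (?F ^^ t) x \<in> Y i)" (is "?l \<longleftrightarrow> ?r") for i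
    proof
      assume ?l
      then show ?r by (metis comp_apply funpow_Suc_right le_SucI)
    next
      assume r: ?r
      show ?l
      proof
        fix m
        obtain t where t: "t \<ge> Suc m" "(?F ^^ t) x \<in> Y i" using r by blast
        then obtain t' where "t = Suc t'" by (cases t) auto
        then show "\<exists>t\<ge>m. (?F ^^ t) (?F x) \<in> Y i"
          using t by (intro exI[of _ t']) (simp add: funpow_swap1)
      qed
    qed
    then show ?thesis by (simp add: idx_def)
  qed
  have idx_Fn: "idx ((?F ^^ i) x) = idx x" for i x by (induction i) (auto simp: idx_F)
  define Z where "Z = {x \<in> space M. x \<in> ?X \<and> x \<in> Y (idx x)}"
  have Z_eq: "x \<in> Z \<longleftrightarrow> x \<in> ?X \<and> x \<in> Y (idx x)" for x using XD(2) by (auto simp: Z_def)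
  have Z_measurable [measurable]: "Z \<in> sets M"
  proof -
    have "Z = (\<Union>i. {x \<in> space M. x \<in> ?X \<and> idx x = i \<and> x \<in> Y i})" by (auto simp: Z_def)
    also have "\<dots> \<in> sets M" by measurable
    finally show ?thesis .
  qed
  \<comment> \<open>The label of a seed is fixed without regard to its successor, so the edge in its
    own heavy direction becomes an extra edge.\<close>
  define Lk where "Lk s = {x \<in> space M. x \<in> Z \<and> heavy x = s}" for s
  have Lk_eq: "x \<in> Lk s \<longleftrightarrow> x \<in> Z \<and> heavy x = s" for x s using XD(2) by (auto simp: Lk_def Z_eq)
  have Lk_measurable: "Lk s \<in> sets M" for s unfolding Lk_def by measurable
  have hw_red: "heavy_word x i \<in> reduced_words k" if "x \<in> ?X" for x i
  proof (induction i)
    case (Suc i)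
    \<comment> \<open>The half-tree entered has mass above 1/2, which leaves less than 1/2 behind
      the new point.\<close>
    have "heavy ((?F ^^ Suc j) x) \<noteq> inv_letter (heavy ((?F ^^ j) x))" for j
    proof -
      note a = XD[OF XF[OF that, of j]] and b = XD[OF XF[OF that, of "Suc j"]]
      have "p ((?F ^^ Suc j) x) (inv_letter (heavy ((?F ^^ j) x))) < 1/2"
        using p_edge[OF a(1) heavy(1)[OF a(3)]] heavy(2)[OF a(3)] by (simp add: step_def)
      then show ?thesis using heavy(2)[OF b(3)] by fastforce
    qed
    then have "hd (heavy_word x i) \<noteq> inv_letter (heavy ((?F ^^ i) x))" if "heavy_word x i \<noteq> []"
      using that by (cases i) (auto simp: inv_letter_eq_iff)
    then show ?case
      using Suc heavy(1)[OF XD(3)[OF XF[OF that]]] unfolding heavy_word.simps reduced_words_Cons_iff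
      by blast
  qed simp
  have LkX: "y \<in> ?X" "s = heavy y" "T s y = ?F y" if "y \<in> Lk s" for y s
    using that by (auto simp: Lk_eq Z_eq step_def)
  have notZ: "(?F ^^ Suc i) y \<notin> Z" if "y \<in> Z" "i < N" for y i
  proof
    assume "(?F ^^ Suc i) y \<in> Z"
    then have "(?F ^^ Suc i) y \<in> Y (idx y)" unfolding Z_eq idx_Fn by blast
    then have "act (heavy_word y (Suc i)) y \<in> Y (idx y)" by (simp only: act_heavy_word)
    moreover have y: "y \<in> ?X" "y \<in> Y (idx y)" using \<open>y \<in> Z\<close> by (auto simp: Z_eq)
    moreover have "length (heavy_word y (Suc i)) \<le> 2 * N" using that(2) by simp
    ultimately have "act (heavy_word y (Suc i)) y = y"
      using sep[of "idx y"] reduced_words_letters[OF hw_red[OF y(1)]] unfolding separated_def by blast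
    then have "heavy_word y (Suc i) = []" using act_reduced_eq_self XD hw_red y by blast
    then show False by simp
  qed
  have disj: "y = y'" if "y \<in> Z" "y' \<in> Z" "i < N" "i' < N" "(?F ^^ Suc i) y = (?F ^^ Suc i') y'" for y y' i i'
  proof -
    have id: "idx y = idx y'" using that(5) idx_Fn by metis
    let ?w = "inv_word (heavy_word y' (Suc i')) @ heavy_word y (Suc i)"
    have yX: "y \<in> ?X" "y' \<in> ?X" "y \<in> Y (idx y)" "y' \<in> Y (idx y)" using that id by (auto simp: Z_eq)
    have "act ?w y = act (inv_word (heavy_word y' (Suc i'))) (act (heavy_word y' (Suc i')) y')"
      using that(5) by (simp only: act_append act_heavy_word)
    also have "\<dots> = y'" using XD yX by (intro act_inv_word)
    finally have w: "act ?w y = y'" .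
    have "set ?w \<subseteq> letters k"
      using reduced_words_letters[OF hw_red[OF yX(1), of "Suc i"]]
        inv_word_letters[OF reduced_words_letters[OF hw_red[OF yX(2), of "Suc i'"]]]
      unfolding set_append by blast
    moreover have "length ?w \<le> 2 * N" using that by simp
    moreover have "act ?w y \<in> Y (idx y)" unfolding w by (rule yX(4))
    ultimately have "act ?w y = y"
      using sep[of "idx y", unfolded separated_def, rule_format, OF yX(3), of ?w] by blast
    then show ?thesis using w by simp
  qed
  have "seed_system N ?X Z heavy Lk"
    unfolding seed_system_def
  proof (intro conjI)
    show "\<forall>s. Lk s \<subseteq> ?X \<inter> Z \<and> (Lk s \<noteq> {} \<longrightarrow> fst s < k)"
    proof (intro allI conjI impI subsetI)
      show "y \<in> ?X \<inter> Z" if "y \<in> Lk s" for y s using that by (simp add: Lk_eq Z_eq)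
      show "fst s < k" if "Lk s \<noteq> {}" for s
      proof -
        obtain y where "y \<in> Lk s" using \<open>Lk s \<noteq> {}\<close> by blast
        then show ?thesis using heavy(1)[OF XD(3)[OF LkX(1)]] LkX(2) by blast
      qed
    qed
    show "\<forall>x\<in>?X - Z. fst (heavy x) < k" using heavy(1) XD(3) by blast
    show "\<forall>x\<in>?X. \<exists>t. (?F ^^ t) x \<in> Z"
    proof
      fix x assume x: "x \<in> ?X"
      obtain t where "(?F ^^ t) x \<in> Y (idx x)" using idx[OF x] by blast
      then have "(?F ^^ t) x \<in> Z" unfolding Z_eq idx_Fn using XF[OF x] by blast
      then show "\<exists>t. (?F ^^ t) x \<in> Z" by blast
    qed
    show "\<forall>x\<in>?X. \<forall>s. fst s < k \<longrightarrow> x \<notin> Z \<and> heavy x = s \<or> T s x \<notin> Z \<and> heavy (T s x) = inv_letter s \<or>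
        x \<in> Lk s \<or> T s x \<in> Lk (inv_letter s)"
      using heavy_edge XD unfolding Lk_eq by blast
    show "\<forall>s. \<forall>y\<in>Lk s. \<forall>i<N. (?F ^^ i) (T s y) \<notin> Z \<and> chain_word heavy y s i \<in> reduced_words k"
    proof (intro allI ballI impI conjI)
      fix s y i assume y: "y \<in> Lk s" and i: "i < N"
      show "(?F ^^ i) (T s y) \<notin> Z"
        using notZ[of y i] y i LkX(3)[OF y] by (simp add: Lk_eq funpow_swap1)
      show "chain_word heavy y s i \<in> reduced_words k"
        using hw_red[OF LkX(1)[OF y]] unfolding LkX(2)[OF y] chain_word_heavy .
    qed
    show "\<forall>s s' i i'. \<forall>y\<in>Lk s. \<forall>y'\<in>Lk s'. i < N \<and> i' < N \<and>
        (?F ^^ i) (T s y) = (?F ^^ i') (T s' y') \<longrightarrow> y = y' \<and> s = s'"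
    proof (intro allI ballI impI)
      fix s s' i i' y y' assume y: "y \<in> Lk s" "y' \<in> Lk s'"
        and e: "i < N \<and> i' < N \<and> (?F ^^ i) (T s y) = (?F ^^ i') (T s' y')"
      then have "y = y'" using disj[of y y' i i'] LkX(3)[OF y(1)] LkX(3)[OF y(2)]
        by (simp add: Lk_eq funpow_swap1)
      then show "y = y' \<and> s = s'" using y by (simp add: Lk_eq)
    qed
  qed (use XT Lk_measurable in auto)
  then show ?thesis by blast
qed

end

subsection \<open>Orbits with balanced points\<close>

lemma reduced_words_appendD: "u @ v \<in> reduced_words k \<Longrightarrow> u \<in> reduced_words k \<and> v \<in> reduced_words k"
  by (auto simp: reduced_words_def successively_append_iff)

lemma reduced_words_snoc_iff:
  "w @ [s] \<in> reduced_words k \<longleftrightarrow>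
    fst s < k \<and> w \<in> reduced_words k \<and> (w \<noteq> [] \<longrightarrow> last w \<noteq> inv_letter s)"
  by (auto simp: reduced_words_def successively_append_iff inv_letter_eq_iff)

lemma reduced_words_append_last:
  "u @ v \<in> reduced_words k \<Longrightarrow> u \<noteq> [] \<Longrightarrow> v \<noteq> [] \<Longrightarrow> last u \<noteq> inv_letter (hd v)"
  by (auto simp: reduced_words_def successively_append_iff inv_letter_eq_iff)

lemma reduced_words_last: "w \<in> reduced_words k \<Longrightarrow> w \<noteq> [] \<Longrightarrow> fst (last w) < k"
  using reduced_words_letters last_in_set by blast

lemma inv_word_reduced:
  assumes "w \<in> reduced_words k"
  shows "inv_word w \<in> reduced_words k"
proof -
  have "successively (\<lambda>x y. y \<noteq> inv_letter x) w" using assms by (simp add: reduced_words_def)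
  then have "successively (\<lambda>x y. inv_letter x \<noteq> y) w"
    by (rule successively_mono) auto
  then show ?thesis
    using assms inv_word_letters[OF reduced_words_letters[OF assms]]
    by (auto simp: inv_word_def reduced_words_def successively_rev successively_map)
qed

lemma inv_word_append: "inv_word (u @ v) = inv_word v @ inv_word u"
  by (simp add: inv_word_def)

lemma inv_word_inv_word [simp]: "inv_word (inv_word w) = w"
  by (simp add: inv_word_def rev_map comp_def)

lemma inv_word_eq_Nil_iff [simp]: "inv_word w = [] \<longleftrightarrow> w = []"
  by (simp add: inv_word_def)

lemma last_inv_word: "w \<noteq> [] \<Longrightarrow> last (inv_word w) = inv_letter (hd w)"
  by (simp add: inv_word_def last_rev hd_map)

section \<open>Convexity of the set of balanced points\<close>

context potential
begin

lemma balanced_le: "balanced x \<Longrightarrow> fst s < k \<Longrightarrow> p x s \<le> 1/2"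
  unfolding balanced_def by blast

text \<open>The first step away from a balanced point leaves mass at least 1/2 behind. Then every
  other direction has mass at most 1/2, so crossing another edge again leaves at least 1/2
  behind.\<close>

lemma p_toward_balanced:
  assumes "x \<in> X" "balanced x" "s # v \<in> reduced_words k"
  shows "1/2 \<le> p (act (s # v) x) (inv_letter s)"
  using assms(3)
proof (induction v arbitrary: s)
  case Nil
  then have "fst s < k" by (simp add: reduced_words_Cons_iff)
  then show ?case using balanced_le[OF assms(2)] p_edge[OF assms(1)] by fastforce
next
  case (Cons s' v)
  let ?y = "act (s' # v) x"
  have red: "fst s < k" "fst s' < k" "s' # v \<in> reduced_words k" "s \<noteq> inv_letter s'"
    using Cons.prems by (auto simp: reduced_words_Cons_iff)
  have y: "?y \<in> X" using X_act[OF assms(1)] .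
  have "p ?y s + p ?y (inv_letter s') \<le> 1" using p_add_le[OF y] red by simp
  moreover have "p ?y s + p (T s ?y) (inv_letter s) = 1" using p_edge[OF y red(1)] .
  moreover have "1/2 \<le> p ?y (inv_letter s')" using Cons.IH[OF red(3)] .
  ultimately have "1/2 \<le> p (T s ?y) (inv_letter s)" by linarith
  then show ?case by simp
qed

lemma heavy_toward_balanced:
  assumes "x \<in> X" "balanced x" "s # v \<in> reduced_words k" "\<not> balanced (act (s # v) x)"
  shows "heavy (act (s # v) x) = inv_letter s"
proof (rule heavy_unique[OF X_act[OF assms(1)] _ p_toward_balanced[OF assms(1-3)] assms(4)])
  show "fst (inv_letter s) < k" using assms(3) by (simp add: reduced_words_Cons_iff)
qed

text \<open>If the far end is balanced too, the last edge splits the mass evenly. A point with mass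
  exactly 1/2 in direction \<open>s\<close> has no room for mass above 1/2 in any direction, so it
  is balanced.\<close>

lemma balanced_tail:
  assumes "x \<in> X" "balanced x" "s # v \<in> reduced_words k" "balanced (act (s # v) x)"
  shows "balanced (act v x)"
proof (rule ccontr)
  let ?y = "act v x"
  assume n: "\<not> balanced ?y"
  have s: "fst s < k" using assms(3) by (simp add: reduced_words_Cons_iff)
  have y: "?y \<in> X" using X_act[OF assms(1)] .
  have "p (act (s # v) x) (inv_letter s) \<le> 1/2" using balanced_le[OF assms(4), of "inv_letter s"] s by simp
  then have "p (act (s # v) x) (inv_letter s) = 1/2" using p_toward_balanced[OF assms(1-3)] by linarith
  then have "p ?y s = 1/2" using p_edge[OF y s] by simp
  then show False using heavy_unique[OF y s _ n] heavy(2)[OF n] by simp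
qed

lemma balanced_suffix:
  assumes "x \<in> X" "balanced x" "u @ v \<in> reduced_words k" "balanced (act (u @ v) x)"
  shows "balanced (act v x)"
  using assms(3,4)
proof (induction u)
  case (Cons s u)
  have red: "s # (u @ v) \<in> reduced_words k" using Cons.prems by simp
  have "balanced (act (u @ v) x)"
    using balanced_tail[OF assms(1,2) red] Cons.prems(2) by simp
  then show ?case using Cons.IH reduced_words_ConsD[OF red] by blast
qed simp

lemma balanced_neighbour:
  assumes "x \<in> X" "balanced x" "fst s < k" "balanced (T s x)"
  shows "p x s = 1/2"
  using p_edge[OF assms(1,3)] balanced_le[OF assms(2,3)] balanced_le[OF assms(4), of "inv_letter s"] assms(3)
  by simp

text \<open>Every balanced neighbour lies in a half-tree of mass exactly 1/2, so three of them would
  exceed the total mass. Being convex, the balanced points of a tree thus form a path, which can be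
  continued away from \<open>s\<close> in at most one way.\<close>

lemma balanced_neighbours_unique:
  assumes "x \<in> X" "balanced x" "fst s < k" "fst a < k" "fst b < k"
    "balanced (T s x)" "balanced (T a x)" "balanced (T b x)" "a \<noteq> s" "b \<noteq> s"
  shows "a = b"
proof (rule ccontr)
  assume "a \<noteq> b"
  then have "p x s + p x a + p x b \<le> 1"
    using p_sum_le[OF assms(1), of "{s, a, b}"] assms by (auto simp: add.assoc)
  then show False
    using balanced_neighbour[OF assms(1,2,3,6)] balanced_neighbour[OF assms(1,2,4,7)]
      balanced_neighbour[OF assms(1,2,5,8)] by simp
qed

end

section \<open>Seeds on the path of balanced points\<close>

locale coloured_potential = potential +
  fixes N :: nat and Y :: "nat \<Rightarrow> 'a set" and q :: nat
  assumes Y_sets [measurable]: "Y i \<in> sets M"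
    and Y_separated: "separated (2 * N + 2) (Y i)"
    and Y_cover: "x \<in> space M \<Longrightarrow> \<exists>i<q. x \<in> Y i"
begin

text \<open>The colour is chosen once per orbit, as the least one present among its balanced points.
  All seeds of an orbit then share a colour, which is what separates them.\<close>

definition idx :: "'a \<Rightarrow> nat" where
  "idx x = (LEAST i. \<exists>w. balanced (act w x) \<and> act w x \<in> Y i)"

definition Z :: "'a set" where
  "Z = {x \<in> space M. x \<in> X \<and> balanced x \<and> x \<in> Y (idx x)}"

lemma idx_measurable [measurable]: "idx \<in> M \<rightarrow>\<^sub>M count_space UNIV"
  unfolding idx_def by measurable

lemma Z_sets [measurable]: "Z \<in> sets M"
proof -
  have "Z = (\<Union>i. {x \<in> space M. x \<in> X \<and> balanced x \<and> idx x = i \<and> x \<in> Y i})" by (auto simp: Z_def)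
  also have "\<dots> \<in> sets M" by measurable
  finally show ?thesis .
qed

lemma Z_D: "x \<in> Z \<Longrightarrow> x \<in> space M \<and> x \<in> X \<and> balanced x"
  by (auto simp: Z_def)

lemma idx_act:
  assumes "x \<in> space M"
  shows "idx (act v x) = idx x"
proof -
  have "(\<exists>w. balanced (act w (act v x)) \<and> act w (act v x) \<in> Y i) \<longleftrightarrow>
      (\<exists>w. balanced (act w x) \<and> act w x \<in> Y i)" (is "?l \<longleftrightarrow> ?r") for i
  proof
    assume ?l
    then obtain w where "balanced (act (w @ v) x)" "act (w @ v) x \<in> Y i" by auto
    then show ?r by blast
  next
    assume ?r
    then obtain w where "balanced (act w x)" "act w x \<in> Y i" by blast
    then have "balanced (act (w @ inv_word v) (act v x))" "act (w @ inv_word v) (act v x) \<in> Y i"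
      using assms by simp_all
    then show ?l by blast
  qed
  then show ?thesis by (simp add: idx_def)
qed

lemma Z_exists:
  assumes x: "x \<in> X" "balanced_orbit x"
  obtains w where "w \<in> reduced_words k" "act w x \<in> Z"
proof -
  have xs: "x \<in> space M" using X_space x by blast
  obtain w where w: "balanced (act w x)" using x by (auto simp: balanced_orbit_def)
  obtain i where "act w x \<in> Y i" using Y_cover act_space[OF xs] by blast
  then have "\<exists>i w. balanced (act w x) \<and> act w x \<in> Y i" using w by blast
  then have "\<exists>w. balanced (act w x) \<and> act w x \<in> Y (idx x)" unfolding idx_def by (rule LeastI_ex)
  then obtain w' where w': "balanced (act w' x)" "act w' x \<in> Y (idx x)" by blast
  obtain v where v: "v \<in> reduced_words k" "act v x = act w' x" using act_reduced[OF xs] by blast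
  have "act v x \<in> Z"
    unfolding Z_def using v w' xs X_act[OF x(1)] idx_act[OF xs, of v] by auto
  then show thesis using that v by blast
qed

lemma Z_separated:
  assumes "x \<in> Z" "act w x \<in> Z" "w \<in> reduced_words k" "length w \<le> 2 * N + 2"
  shows "w = []"
proof -
  have x: "x \<in> space M" "x \<in> Y (idx x)" using assms(1) by (auto simp: Z_def)
  have "act w x \<in> Y (idx x)" using assms(2) idx_act[OF x(1), of w] by (auto simp: Z_def)
  then have "act w x = x"
    using Y_separated[of "idx x"] x assms reduced_words_letters unfolding separated_def by blast
  then show ?thesis using act_reduced_eq_self x assms by blast
qed

text \<open>Proper suffixes of \<open>w\<close> lead to the intermediate points, because the last
  letter acts first. From a balanced point of \<open>X\<close> the word follows the path of balanced
  points to the next seed, so there is at most one such word on either side.\<close>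

definition sees :: "'a \<Rightarrow> letter list \<Rightarrow> bool" where
  "sees x w \<longleftrightarrow> w \<in> reduced_words k \<and> w \<noteq> [] \<and> act w x \<in> Z \<and>
     (\<forall>u v. w = u @ v \<and> u \<noteq> [] \<and> v \<noteq> [] \<longrightarrow> act v x \<notin> Z)"

lemma sees_measurable [measurable]: "Measurable.pred M (\<lambda>x. sees x w)"
  unfolding sees_def by measurable

lemma sees_snocD:
  assumes "sees x (w @ [s])" "w \<noteq> []"
  shows "sees (T s x) w" "T s x \<notin> Z"
proof -
  have "act v (T s x) \<notin> Z" if "w = u @ v" "u \<noteq> []" "v \<noteq> []" for u v
  proof -
    have "w @ [s] = u @ (v @ [s])" "v @ [s] \<noteq> []" using that by auto
    then have "act (v @ [s]) x \<notin> Z" using assms(1) that(2) unfolding sees_def by blast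
    then show ?thesis by simp
  qed
  then show "sees (T s x) w"
    using assms reduced_words_appendD[of w "[s]" k] unfolding sees_def by auto
  have "act [s] x \<notin> Z" using assms unfolding sees_def by blast
  then show "T s x \<notin> Z" by simp
qed

lemma sees_snocI:
  assumes "sees (T s x) w" "T s x \<notin> Z" "fst s < k" "last w \<noteq> inv_letter s"
  shows "sees x (w @ [s])"
proof -
  have "act v x \<notin> Z" if uv: "w @ [s] = u @ v" "u \<noteq> []" "v \<noteq> []" for u v
  proof -
    obtain v' where v: "v = v' @ [s]" "w = u @ v'"
      using uv by (cases v rule: rev_cases) auto
    show ?thesis
    proof (cases "v' = []")
      case False
      then show ?thesis using assms(1) uv(2) v unfolding sees_def by simp
    qed (use assms v in simp)
  qed
  then show ?thesis
    using assms unfolding sees_def by (auto simp: reduced_words_snoc_iff)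
qed

lemma sees_balanced:
  assumes "x \<in> X" "balanced x" "sees x (u @ v)"
  shows "balanced (act v x)"
  using balanced_suffix[OF assms(1,2), of u v] assms(3) Z_D unfolding sees_def by blast

lemma sees_last:
  assumes "x \<in> X" "balanced x" "sees x w"
  shows "fst (last w) < k" "balanced (T (last w) x)"
proof -
  have w: "w \<in> reduced_words k" "w \<noteq> []" using assms(3) by (auto simp: sees_def)
  then show "fst (last w) < k" by (rule reduced_words_last)
  have "w = butlast w @ [last w]" using w by simp
  then have "balanced (act [last w] x)" using sees_balanced[OF assms(1,2)] assms(3) by metis
  then show "balanced (T (last w) x)" by simp
qed

text \<open>The induction removes last letters, since these are the first steps taken. After a
  common first step the path of balanced points continues in only one way, and neither word can pass
  a seed at which the other stops.\<close>

lemma sees_unique: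
  assumes "x \<in> X" "balanced x" "sees x w" "sees x w'" "last w = last w'"
  shows "w = w'"
  using assms
proof (induction w arbitrary: x w' rule: rev_induct)
  case Nil
  then show ?case by (simp add: sees_def)
next
  case (snoc s v)
  have "w' \<noteq> []" using snoc.prems by (simp add: sees_def)
  then obtain v' where w': "w' = v' @ [s]" using snoc.prems(5) by (metis append_butlast_last_id last_snoc)
  have xs: "x \<in> space M" using X_space snoc.prems by blast
  show ?case
  proof (cases "v = [] \<or> v' = []")
    case True
    have Z1: "T s x \<in> Z" if "sees x [s]" using that by (simp add: sees_def)
    then show ?thesis using True snoc.prems sees_snocD(2) unfolding w' by (metis append_Nil)
  next
    case False
    let ?y = "T s x"
    have y: "?y \<in> X" "balanced ?y" using X_invariant snoc.prems sees_last(2)[OF snoc.prems(1-3)] by auto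
    have s: "fst s < k" using sees_last(1)[OF snoc.prems(1-3)] by simp
    have sv: "sees ?y v" "sees ?y v'"
      using sees_snocD(1) False snoc.prems unfolding w' by blast+
    have ne: "last v \<noteq> inv_letter s" "last v' \<noteq> inv_letter s"
      using False snoc.prems(3,4) unfolding w' by (auto simp: sees_def reduced_words_snoc_iff)
    have "last v = last v'"
      by (rule balanced_neighbours_unique[OF y, of "inv_letter s"])
        (use s sees_last[OF y] sv ne xs snoc.prems in auto)
    then show ?thesis using snoc.IH[OF y sv] w' by simp
  qed
qed

lemma sees_exists:
  assumes "w \<in> reduced_words k" "w \<noteq> []" "act w x \<in> Z"
  shows "\<exists>v. sees x v"
  using assms
proof (induction "length w" arbitrary: w rule: less_induct)
  case less
  show ?case
  proof (cases "sees x w")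
    case False
    then have "\<exists>u v. w = u @ v \<and> u \<noteq> [] \<and> v \<noteq> [] \<and> act v x \<in> Z"
      using less.prems by (simp add: sees_def)
    then obtain u v where uv: "w = u @ v" "u \<noteq> []" "v \<noteq> []" "act v x \<in> Z" by blast
    have "length v < length w" using uv by simp
    moreover have "v \<in> reduced_words k"
      using less.prems(1) reduced_words_appendD[of u v k] unfolding uv(1) by blast
    ultimately show ?thesis by (rule less.hyps[OF _ _ uv(3,4)])
  qed blast
qed

text \<open>All balanced points strictly between two consecutive seeds see the same two seeds.
  Preferring the larger value of \<open>h\<close> makes them agree on their target, so that their
  directions are coherent.\<close>

definition picks :: "'a \<Rightarrow> letter list \<Rightarrow> bool" where
  "picks x w \<longleftrightarrow> sees x w \<and> (\<forall>w'. sees x w' \<longrightarrow> h (act w' x) \<le> h (act w x))"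

lemma picks_measurable [measurable]: "Measurable.pred M (\<lambda>x. picks x w)"
  unfolding picks_def by measurable

lemma h_act_inj:
  assumes "x \<in> space M" "sees x w" "sees x w'" "h (act w x) = h (act w' x)"
  shows "w = w'"
proof -
  have "act w x = act w' x" using assms(1,4) act_space h_inj by (meson inj_onD)
  then show ?thesis using act_inj assms unfolding sees_def by blast
qed

lemma picks_unique:
  assumes "x \<in> space M" "picks x w" "picks x w'"
  shows "w = w'"
  using assms h_act_inj[of x w w'] unfolding picks_def by (meson order_antisym)

lemma picks_exists:
  assumes x: "x \<in> X" "balanced x" "x \<notin> Z"
  shows "\<exists>w. picks x w"
proof -
  have "balanced (act [] x)" using x by simp
  then have "balanced_orbit x" unfolding balanced_orbit_def by blast
  then obtain w where w: "w \<in> reduced_words k" "act w x \<in> Z" using Z_exists x(1) by blast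
  then have "w \<noteq> []" using x(3) by auto
  then have ne: "{w. sees x w} \<noteq> {}" using sees_exists w by blast
  have "inj_on last {w. sees x w}" using sees_unique[OF x(1,2)] by (auto intro: inj_onI)
  moreover have "last ` {w. sees x w} \<subseteq> letters k" using sees_last(1)[OF x(1,2)] by auto
  ultimately have fin: "finite {w. sees x w}"
    using finite_subset[OF _ finite_letters] finite_image_iff by metis
  let ?m = "Max ((\<lambda>w. h (act w x)) ` {w. sees x w})"
  have "?m \<in> (\<lambda>w. h (act w x)) ` {w. sees x w}" using fin ne by (intro Max_in) auto
  then obtain v where v: "sees x v" "h (act v x) = ?m" by auto
  have "h (act w' x) \<le> ?m" if "sees x w'" for w' using fin that by (intro Max_ge) auto
  then have "picks x v" using v unfolding picks_def by simp
  then show ?thesis by blast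
qed

text \<open>A seed that the neighbour sees is also seen from \<open>x\<close>, either across the
  edge or, if the line of sight turns back through \<open>x\<close>, further along it. The latter
  needs that \<open>x\<close> is not a seed itself.\<close>

lemma picks_T:
  assumes x: "x \<in> X" "x \<notin> Z" and w: "picks x (w @ [s])" "w \<noteq> []"
  shows "picks (T s x) w"
proof -
  have xs: "x \<in> space M" using X_space x by blast
  have sw: "sees (T s x) w" and nZ: "T s x \<notin> Z" using sees_snocD w unfolding picks_def by blast+
  have s: "fst s < k" using w(1) unfolding picks_def sees_def by (simp add: reduced_words_snoc_iff)
  have "h (act w' (T s x)) \<le> h (act w (T s x))" if w': "sees (T s x) w'" for w'
  proof (cases "last w' = inv_letter s")
    case True
    have "w' \<noteq> []" using w' by (simp add: sees_def)
    then obtain v where v: "w' = v @ [inv_letter s]" using True by (metis append_butlast_last_id)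
    have "v \<noteq> []"
    proof
      assume "v = []"
      then have "x \<in> Z" using w' v xs by (simp add: sees_def)
      then show False using x by simp
    qed
    then have "sees x v" using sees_snocD(1)[of "T s x" v "inv_letter s"] w' v xs by simp
    then show ?thesis using w(1) xs unfolding picks_def v by simp
  next
    case False
    then have "sees x (w' @ [s])" using sees_snocI[OF w' nZ s] by blast
    then show ?thesis using w(1) unfolding picks_def by fastforce
  qed
  then show ?thesis using sw by (simp add: picks_def)
qed

definition dir :: "'a \<Rightarrow> letter" where
  "dir x = (if balanced x then from_nat (LEAST i. \<exists>w. picks x w \<and> last w = from_nat i) else heavy x)"

lemma dir_measurable [measurable]: "dir \<in> M \<rightarrow>\<^sub>M count_space UNIV"
  unfolding dir_def by measurable

lemma dir_balanced:
  assumes "x \<in> space M" "balanced x" "picks x w"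
  shows "dir x = last w"
proof -
  have "\<exists>i v. picks x v \<and> last v = from_nat i"
    using assms(3) by (metis from_nat_to_nat)
  from LeastI_ex[OF this] obtain v
    where "picks x v" "last v = from_nat (LEAST i. \<exists>w. picks x w \<and> last w = from_nat i)" by blast
  then show ?thesis using picks_unique[OF assms(1,3)] assms(2) by (simp add: dir_def)
qed

lemma dir_not_balanced: "\<not> balanced x \<Longrightarrow> dir x = heavy x"
  by (simp add: dir_def)

text \<open>The segment between two consecutive seeds flows entirely to the one with the larger
  value of \<open>h\<close>. No point directs itself across the first edge at the smaller one, so
  this edge becomes the extra edge.\<close>

definition Lk :: "letter \<Rightarrow> 'a set" where
  "Lk s = {x \<in> space M. x \<in> Z \<and> (\<exists>w. sees x w \<and> last w = s \<and> h x < h (act w x))}"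

lemma Lk_sets [measurable]: "Lk s \<in> sets M"
  unfolding Lk_def by measurable

section \<open>Verification of the seed system on orbits with balanced points\<close>

lemma reach_balanced:
  assumes "x \<in> X" "balanced x"
  shows "\<exists>t. (step dir ^^ t) x \<in> Z"
proof (cases "x \<in> Z")
  case True
  then show ?thesis by (intro exI[of _ 0]) simp
next
  case False
  then obtain w where "picks x w" using picks_exists assms by blast
  then show ?thesis using assms False
  proof (induction w arbitrary: x rule: rev_induct)
    case Nil
    then show ?case by (simp add: picks_def sees_def)
  next
    case (snoc s w)
    have xs: "x \<in> space M" using X_space snoc.prems by blast
    have F: "step dir x = T s x" using dir_balanced[OF xs snoc.prems(3,1)] by (simp add: step_def)
    have s: "sees x (w @ [s])" using snoc.prems(1) by (simp add: picks_def)
    show ?case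
    proof (cases "w = []")
      case True
      then have "(step dir ^^ 1) x \<in> Z" using s F by (simp add: sees_def)
      then show ?thesis by blast
    next
      case False
      have "balanced (T s x)" using sees_last(2)[OF snoc.prems(2,3) s] by simp
      then obtain t where "(step dir ^^ t) (step dir x) \<in> Z"
        using snoc.IH[OF picks_T[OF snoc.prems(2,4,1) False]] X_invariant[OF snoc.prems(2)]
          sees_snocD(2)[OF s False] F by auto
      then have "(step dir ^^ Suc t) x \<in> Z" by (simp add: funpow_swap1)
      then show ?thesis by blast
    qed
  qed
qed

text \<open>Unbalanced points retrace the reduced word that joins a seed to them, since their heavy
  direction leads back towards any balanced point. Once a balanced point is met, its picked line of
  sight takes over.\<close>

lemma reach_Z:
  assumes x: "x \<in> X" "balanced_orbit x"
  shows "\<exists>t. (step dir ^^ t) x \<in> Z"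
proof -
  have xs: "x \<in> space M" using X_space x by blast
  obtain w where w: "w \<in> reduced_words k" "act w x \<in> Z" using Z_exists x by blast
  let ?b = "act w x"
  have b: "?b \<in> X" "balanced ?b" using Z_D[OF w(2)] by auto
  have "\<exists>t. (step dir ^^ t) (act v ?b) \<in> Z" if "v \<in> reduced_words k" for v
    using that
  proof (induction v)
    case Nil
    then show ?case using reach_balanced[OF b] by simp
  next
    case (Cons s v)
    show ?case
    proof (cases "balanced (act (s # v) ?b)")
      case True
      then show ?thesis using reach_balanced X_act[OF b(1)] by blast
    next
      case False
      have bs: "act v ?b \<in> space M" using xs by simp
      have "step dir (act (s # v) ?b) = act v ?b"
        using heavy_toward_balanced[OF b Cons.prems False] dir_not_balanced[OF False] bs
        by (simp add: step_def)
      moreover obtain t where "(step dir ^^ t) (act v ?b) \<in> Z"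
        using Cons.IH reduced_words_ConsD[OF Cons.prems] by blast
      ultimately have "(step dir ^^ Suc t) (act (s # v) ?b) \<in> Z" by (simp only: funpow_Suc_right comp_apply)
      then show ?thesis by blast
    qed
  qed
  from this[OF inv_word_reduced[OF w(1)]] show ?thesis using xs by simp
qed

text \<open>The neighbour sees \<open>x\<close>. If it points elsewhere, it prefers a seed with a
  larger value of \<open>h\<close>, and \<open>x\<close> sees that seed through
  \<open>s\<close>.\<close>

lemma cover_seed_edge:
  assumes x: "x \<in> Z" and s: "fst s < k" and y: "balanced (T s x)"
  shows "T s x \<notin> Z \<and> dir (T s x) = inv_letter s \<or> x \<in> Lk s"
proof -
  have xX: "x \<in> X" "x \<in> space M" "balanced x" using Z_D[OF x] by auto
  have yX: "T s x \<in> X" "T s x \<in> space M" using X_invariant xX by auto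
  have nZ: "T s x \<notin> Z"
    using Z_separated[of x "[s]"] x s by (auto simp: reduced_words_Cons_iff)
  obtain w where w: "picks (T s x) w" using picks_exists[OF yX(1) y nZ] by blast
  have dy: "dir (T s x) = last w" using dir_balanced[OF yX(2) y w] .
  show ?thesis
  proof (cases "last w = inv_letter s")
    case False
    have sx: "sees x (w @ [s])" using sees_snocI[OF _ nZ s False] w by (simp add: picks_def)
    have "sees (T s x) [inv_letter s]"
      using x xX s unfolding sees_def by (auto simp: reduced_words_Cons_iff Cons_eq_append_conv)
    then have "h x \<le> h (act (w @ [s]) x)" using w xX unfolding picks_def by fastforce
    moreover have "h x \<noteq> h (act (w @ [s]) x)"
    proof
      assume "h x = h (act (w @ [s]) x)"
      then have "act (w @ [s]) x = x" using h_inj xX(2) act_space by (metis inj_onD)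
      moreover have "w @ [s] \<in> reduced_words k" using sx by (simp add: sees_def)
      ultimately show False using act_reduced_eq_self xX(2) by blast
    qed
    ultimately have "h x < h (act (w @ [s]) x)" by simp
    then have "x \<in> Lk s" unfolding Lk_def using sx x xX by (auto intro!: exI[of _ "w @ [s]"])
    then show ?thesis by blast
  qed (use nZ dy in simp)
qed

lemma cover_edge:
  assumes x: "x \<in> X" and s: "fst s < k"
  shows "x \<notin> Z \<and> dir x = s \<or> T s x \<notin> Z \<and> dir (T s x) = inv_letter s \<or>
    x \<in> Lk s \<or> T s x \<in> Lk (inv_letter s)"
proof -
  let ?y = "T s x"
  have xs: "x \<in> space M" using X_space x by blast
  have y: "?y \<in> X" "?y \<in> space M" "T (inv_letter s) ?y = x" using X_invariant x xs by auto
  have s': "fst (inv_letter s) < k" using s by simp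
  show ?thesis
  proof (cases "balanced x \<and> balanced ?y")
    case False
    then have "\<not> balanced x \<and> heavy x = s \<or> \<not> balanced ?y \<and> heavy ?y = inv_letter s"
      using heavy_edge[OF x s] heavy_edge[OF y(1) s'] unfolding y(3) by auto
    then show ?thesis using dir_not_balanced Z_D by metis
  next
    case True
    then consider "x \<in> Z" | "?y \<in> Z" | "x \<notin> Z" "?y \<notin> Z" by blast
    then show ?thesis
    proof cases
      case 1
      then show ?thesis using cover_seed_edge[OF 1 s] True by blast
    next
      case 2
      then show ?thesis using cover_seed_edge[OF 2 s'] True unfolding y(3) by auto
    next
      case 3
      obtain w v where w: "picks x w" and v: "picks ?y v"
        using picks_exists[OF x _ 3(1)] picks_exists[OF y(1) _ 3(2)] True by blast
      have d: "dir x = last w" "dir ?y = last v"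
        using dir_balanced xs y w v True by blast+
      show ?thesis
      \<comment> \<open>If neither end points across the edge, each end sees the other's choice
        through it. Both choices then have the same value of \<open>h\<close>, so they coincide, and
        the path from \<open>x\<close> does start with the edge.\<close>
      proof (rule ccontr)
        assume "\<not> ?thesis"
        then have ne: "last w \<noteq> s" "last v \<noteq> inv_letter s" using 3 d by auto
        have sv: "sees x (v @ [s])" using sees_snocI[OF _ 3(2) s ne(2)] v by (simp add: picks_def)
        have sw: "sees ?y (w @ [inv_letter s])"
          using sees_snocI[of "inv_letter s" ?y w] w 3(1) s' ne(1) unfolding y(3) by (simp add: picks_def)
        have "h (act v ?y) \<le> h (act w x)" using sv w unfolding picks_def by fastforce
        moreover have "h (act w x) \<le> h (act v ?y)" using sw v xs unfolding picks_def by fastforce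
        ultimately have "h (act w x) = h (act (v @ [s]) x)" by simp
        then have "w = v @ [s]" using h_act_inj[OF xs _ sv] w by (simp add: picks_def)
        then show False using ne(1) by simp
      qed
    qed
  qed
qed

text \<open>An interior point of a line of sight to a seed with larger \<open>h\<close> sees
  \<open>y\<close> behind it and that seed ahead. No third direction stays on the path of balanced
  points, so it picks the seed ahead.\<close>

lemma link_split:
  assumes y: "y \<in> Z" and w: "sees y (u @ v)" "u \<noteq> []" "v \<noteq> []" and hy: "h y < h (act (u @ v) y)"
  defines "x \<equiv> act v y"
  shows "x \<in> X" "balanced x" "x \<notin> Z" "sees x (inv_word v)" "dir x = last u"
    "last u \<noteq> inv_letter (hd v)"
proof -
  have yX: "y \<in> X" "balanced y" "y \<in> space M" using Z_D[OF y] by auto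
  show xX: "x \<in> X" unfolding x_def using X_act[OF yX(1)] .
  then have xs: "x \<in> space M" by (rule X_space)
  show xb: "balanced x" unfolding x_def using sees_balanced[OF yX(1,2) w(1)] .
  show xZ: "x \<notin> Z" using w unfolding sees_def x_def by blast
  have red: "u @ v \<in> reduced_words k" using w(1) by (simp add: sees_def)
  have redv: "v \<in> reduced_words k" using reduced_words_appendD[OF red] by blast
  show lu: "last u \<noteq> inv_letter (hd v)" using reduced_words_append_last[OF red w(2,3)] .
  have bk: "act (inv_word v) x = y" unfolding x_def using yX by simp
  have "act b x \<notin> Z" if ab: "inv_word v = a @ b" "a \<noteq> []" "b \<noteq> []" for a b
  proof -
    have v: "v = inv_word b @ inv_word a" using ab(1) by (metis inv_word_append inv_word_inv_word)
    then have "act b x = act (inv_word a) y"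
      using act_inv_word[of "act (inv_word a) y" "inv_word b"] yX unfolding x_def by simp
    moreover have "u @ v = (u @ inv_word b) @ inv_word a" using v by simp
    ultimately show ?thesis using w(1) ab(2) w(2) unfolding sees_def
      by (metis append_is_Nil_conv inv_word_eq_Nil_iff)
  qed
  then show sb: "sees x (inv_word v)"
    unfolding sees_def using inv_word_reduced[OF redv] w(3) bk y by simp
  have su: "sees x u"
  proof -
    have "act b x \<notin> Z" if "u = a @ b" "a \<noteq> []" "b \<noteq> []" for a b
    proof -
      have "u @ v = a @ (b @ v)" "b @ v \<noteq> []" using that by auto
      then have "act (b @ v) y \<notin> Z" using w(1) that(2) unfolding sees_def by blast
      then show ?thesis by (simp add: x_def)
    qed
    then show ?thesis using w reduced_words_appendD[OF red] unfolding sees_def x_def by auto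
  qed
  have "h (act w' x) \<le> h (act u x)" if w': "sees x w'" for w'
  proof (cases "last w' = inv_letter (hd v)")
    case True
    then have "w' = inv_word v"
      using sees_unique[OF xX xb w' sb] last_inv_word[OF w(3)] by simp
    then show ?thesis using hy bk by (simp add: x_def)
  next
    case False
    have "last w' = last u"
      by (rule balanced_neighbours_unique[OF xX xb, of "inv_letter (hd v)"])
        (use sees_last[OF xX xb] sb last_inv_word[OF w(3)] w' su False lu in metis)+
    then show ?thesis using sees_unique[OF xX xb w' su] by simp
  qed
  then have "picks x u" using su by (simp add: picks_def)
  then show "dir x = last u" using dir_balanced xs xb by blast
qed

text \<open>Consecutive seeds are more than \<open>2 * N + 2\<close> letters apart, so the first
  \<open>N\<close> points after \<open>y\<close> lie strictly inside the line of sight. By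
  \<open>link_split\<close> the direction follows that line there, which makes every chain word a
  proper suffix of it.\<close>

lemma link_chain:
  assumes y: "y \<in> Lk s" and i: "i < N"
  obtains u where "u \<noteq> []" "sees y (u @ chain_word dir y s i)"
    "h y < h (act (u @ chain_word dir y s i) y)" "last (chain_word dir y s i) = s"
proof -
  obtain w where w: "y \<in> Z" "sees y w" "last w = s" "h y < h (act w y)"
    using y by (auto simp: Lk_def)
  have wr: "w \<in> reduced_words k" "w \<noteq> []" "act w y \<in> Z" using w(2) by (auto simp: sees_def)
  then have len: "2 * N + 2 < length w" using Z_separated[OF w(1)] by (meson not_le)
  have "\<exists>u. u \<noteq> [] \<and> w = u @ chain_word dir y s j \<and> last (chain_word dir y s j) = s" if "j < N" for j
    using that
  proof (induction j)
    case 0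
    have "w = butlast w @ [s]" using wr(2) w(3) by (metis append_butlast_last_id)
    moreover have "butlast w \<noteq> []" using len by (cases w rule: rev_cases) auto
    ultimately show ?case by auto
  next
    case (Suc j)
    let ?v = "chain_word dir y s j"
    obtain u where u: "u \<noteq> []" "w = u @ ?v" "last ?v = s" using Suc by auto
    have v: "?v \<noteq> []" using length_chain_word[of dir y s j] by fastforce
    have "dir (act ?v y) = last u"
      using link_split(5)[OF w(1), of u ?v] w u v by simp
    then have cw: "chain_word dir y s (Suc j) = last u # ?v" by (simp add: act_chain_word)
    have "w = butlast u @ chain_word dir y s (Suc j)" using u cw by simp
    moreover have "butlast u \<noteq> []"
    proof
      assume "butlast u = []"
      then have "length w = length (chain_word dir y s (Suc j))" using calculation by simp
      then show False using len Suc.prems by simp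
    qed
    ultimately show ?case using cw u(3) v by (metis last_ConsR)
  qed
  then show thesis using that w i by metis
qed

lemma balanced_seed_system: "seed_system N {x \<in> X. balanced_orbit x} Z dir Lk"
  unfolding seed_system_def
proof (intro conjI)
  let ?X = "{x \<in> X. balanced_orbit x}"
  show "?X \<in> sets M" by measurable
  show "Z \<in> sets M" "dir \<in> M \<rightarrow>\<^sub>M count_space UNIV" "\<forall>s. Lk s \<in> sets M" by auto
  have orb: "balanced_orbit x" if "balanced x" for x
    using that unfolding balanced_orbit_def by (intro exI[of _ "[]"]) simp
  show "\<forall>s. Lk s \<subseteq> ?X \<inter> Z \<and> (Lk s \<noteq> {} \<longrightarrow> fst s < k)"
    using sees_last(1) Z_D orb unfolding Lk_def by blast
  show "\<forall>x\<in>?X. \<forall>s. T s x \<in> ?X" using X_invariant balanced_orbit_T X_space by auto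
  show "\<forall>x\<in>?X - Z. fst (dir x) < k"
  proof
    fix x assume x: "x \<in> ?X - Z"
    show "fst (dir x) < k"
    proof (cases "balanced x")
      case True
      then obtain w where w: "picks x w" using picks_exists x by blast
      then show ?thesis
        using dir_balanced[OF _ True w] sees_last(1)[OF _ True] X_space x by (auto simp: picks_def)
    qed (use heavy(1) dir_not_balanced in simp)
  qed
  show "\<forall>x\<in>?X. \<exists>t. (step dir ^^ t) x \<in> Z" using reach_Z by blast
  show "\<forall>x\<in>?X. \<forall>s. fst s < k \<longrightarrow> x \<notin> Z \<and> dir x = s \<or> T s x \<notin> Z \<and> dir (T s x) = inv_letter s \<or>
      x \<in> Lk s \<or> T s x \<in> Lk (inv_letter s)" using cover_edge by blast
  have LkZ: "y \<in> Z" if "y \<in> Lk s" for y s using that by (simp add: Lk_def)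
  have cw_ne: "chain_word dir y s i \<noteq> []" for y s i
    using length_chain_word[of dir y s i] by fastforce
  show "\<forall>s. \<forall>y\<in>Lk s. \<forall>i<N. (step dir ^^ i) (T s y) \<notin> Z \<and> chain_word dir y s i \<in> reduced_words k"
  proof (intro allI ballI impI conjI)
    fix s y i assume y: "y \<in> Lk s" and i: "i < N"
    obtain u where u: "u \<noteq> []" "sees y (u @ chain_word dir y s i)"
      "h y < h (act (u @ chain_word dir y s i) y)" using link_chain[OF y i] by metis
    show "(step dir ^^ i) (T s y) \<notin> Z"
      using link_split(3)[OF LkZ[OF y] u(2,1) cw_ne u(3)] by (simp add: act_chain_word)
    show "chain_word dir y s i \<in> reduced_words k"
      using u(2) reduced_words_appendD unfolding sees_def by blast
  qed
  show "\<forall>s s' i i'. \<forall>y\<in>Lk s. \<forall>y'\<in>Lk s'. i < N \<and> i' < N \<and>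
      (step dir ^^ i) (T s y) = (step dir ^^ i') (T s' y') \<longrightarrow> y = y' \<and> s = s'"
  proof (intro allI ballI impI)
    fix s s' i i' y y' assume y: "y \<in> Lk s" and y': "y' \<in> Lk s'"
      and e: "i < N \<and> i' < N \<and> (step dir ^^ i) (T s y) = (step dir ^^ i') (T s' y')"
    let ?v = "chain_word dir y s i" and ?v' = "chain_word dir y' s' i'"
    obtain u where u: "u \<noteq> []" "sees y (u @ ?v)" "h y < h (act (u @ ?v) y)" "last ?v = s"
      using link_chain[OF y] e by metis
    obtain u' where u': "u' \<noteq> []" "sees y' (u' @ ?v')" "h y' < h (act (u' @ ?v') y')" "last ?v' = s'"
      using link_chain[OF y'] e by metis
    note l = link_split[OF LkZ[OF y] u(2,1) cw_ne u(3)]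
    note l' = link_split[OF LkZ[OF y'] u'(2,1) cw_ne u'(3)]
    define x where "x = act ?v y"
    have x': "act ?v' y' = x" using e by (simp add: x_def act_chain_word)
    have x: "x \<in> X" "balanced x" using l(1,2) by (auto simp: x_def)
    have sv: "sees x (inv_word ?v)" "sees x (inv_word ?v')"
      using l(4) l'(4) unfolding x' x_def by auto
    have ys: "y \<in> space M" "y' \<in> space M" using Z_D LkZ y y' by auto
    have su: "balanced (T (last u) x)" "fst (last u) < k"
    proof -
      have "u @ ?v = butlast u @ (last u # ?v)" using u(1) by simp
      then have "balanced (act (last u # ?v) y)"
        using sees_balanced[of y "butlast u" "last u # ?v"] u(2) Z_D[OF LkZ[OF y]] by metis
      then show "balanced (T (last u) x)" by (simp add: x_def)
      show "fst (last u) < k"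
        using u(1,2) reduced_words_last reduced_words_appendD unfolding sees_def by blast
    qed
    \<comment> \<open>Both \<open>y\<close> and \<open>y'\<close> lie behind \<open>x\<close>, in a
      direction different from \<open>dir x = last u\<close>. On a path there is only one such
      direction.\<close>
    have "last (inv_word ?v) = last (inv_word ?v')"
    proof (rule balanced_neighbours_unique[OF x, of "last u"])
      show "last (inv_word ?v) \<noteq> last u" using l(6) last_inv_word[OF cw_ne] by metis
      show "last (inv_word ?v') \<noteq> last u"
        using l'(5,6) l(5) last_inv_word[OF cw_ne] unfolding x' x_def by metis
    qed (use sees_last[OF x] sv su in auto)
    then have iv: "inv_word ?v = inv_word ?v'" using sees_unique[OF x sv] by blast
    then have "?v = ?v'" by (metis inv_word_inv_word)
    then have "s = s'" using u(4) u'(4) by simp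
    moreover have "y = act (inv_word ?v) x" unfolding x_def using ys by simp
    moreover have "y' = act (inv_word ?v') x" unfolding x'[symmetric] using ys by simp
    ultimately show "y = y' \<and> s = s'" using iv by simp
  qed
qed

end

context potential
begin

lemma balanced_orbit_seed_system:
  "\<exists>Z dir Lk. seed_system N {x \<in> X. balanced_orbit x} Z dir Lk"
proof -
  obtain Y :: "nat \<Rightarrow> 'a set" and q :: nat where Y: "\<And>i. Y i \<in> sets M"
    "\<And>i. separated (2 * N + 2) (Y i)" "\<And>x. x \<in> space M \<Longrightarrow> \<exists>i<q. x \<in> Y i"
    using exists_finite_colouring[of "2 * N + 2"] by blast
  interpret coloured_potential M k T h X p N Y q
    by standard (use Y in auto)
  show ?thesis using balanced_seed_system by blast
qed

end

section \<open>Potentials from hyperfiniteness\<close>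

lemma sum_weighted_sum:
  "(\<Sum>s\<in>S. weighted_sum a (\<lambda>j. f j s)) = weighted_sum a (\<lambda>j. \<Sum>s\<in>S. f j s)"
  unfolding weighted_sum_def by (subst sum.swap) (simp add: sum_distrib_left)

lemma weighted_sum_add: "weighted_sum a f + weighted_sum a g = weighted_sum a (\<lambda>j. f j + g j)"
  by (simp add: weighted_sum_def sum.distrib distrib_left)

lemma weighted_sum_one:
  assumes "a \<in> tail_weights i" "\<And>j. i \<le> j \<Longrightarrow> f j = 1"
  shows "weighted_sum a f = 1"
proof -
  have "weighted_sum a f = sum a {j. a j \<noteq> 0}"
    unfolding weighted_sum_def using assms by (intro sum.cong) (auto simp: tail_weights_def)
  then show ?thesis using assms(1) by (simp add: tail_weights_def)
qed

lemma exists_full_support_pmf: "\<exists>Q :: 'b :: countable pmf. set_pmf Q = UNIV"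
proof
  have "set_pmf (map_pmf (from_nat :: nat \<Rightarrow> 'b) (geometric_pmf (1/2))) = range from_nat"
    by (simp add: set_pmf_geometric)
  then show "set_pmf (map_pmf (from_nat :: nat \<Rightarrow> 'b) (geometric_pmf (1/2))) = UNIV" by simp
qed

text \<open>
  Here \<open>D\<close> is the conull set on which the orbit relation is the increasing union of the finite
  relations \<open>F j\<close>.  The potential is a limit of the uniform measures on the classes of \<open>F j\<close>;
  points outside \<open>D\<close> use the class of the first point of their orbit in \<open>D\<close>.
\<close>

locale hyperfinite_action = letter_action + prob_space M +
  fixes D :: "'a set" and F :: "nat \<Rightarrow> ('a \<times> 'a) set"
  assumes D_sets [measurable]: "D \<in> sets M" and D_AE: "AE x in M. x \<in> D"
    and F_mono: "incseq F" and F_equiv: "equiv D (F j)"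
    and F_sets [measurable]: "F j \<in> sets (M \<Otimes>\<^sub>M M)"
    and F_finite: "x \<in> D \<Longrightarrow> finite (F j `` {x})"
    and F_act: "x \<in> D \<Longrightarrow> act w x \<in> D \<Longrightarrow> \<exists>j. (x, act w x) \<in> F j"
begin

section \<open>Counting a finite class in half-trees\<close>

definition first :: "'a \<Rightarrow> letter list \<Rightarrow> bool" where
  "first x v \<longleftrightarrow> act v x \<in> D \<and> (\<forall>v'. to_nat v' < to_nat v \<longrightarrow> act v' x \<notin> D)"

definition related :: "nat \<Rightarrow> 'a \<Rightarrow> letter list \<Rightarrow> bool" where
  "related j x w \<longleftrightarrow> (\<exists>v. first x v \<and> (act v x, act w x) \<in> F j)"

definition class_words :: "nat \<Rightarrow> 'a \<Rightarrow> letter list set" where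
  "class_words j x = {w \<in> reduced_words k. related j x w}"

text \<open>The last letter acts first, so these words lead to the points of the class in the
  half-tree that \<open>x\<close> sees in direction \<open>s\<close>. Freeness makes the count of
  reduced words a count of points.\<close>

definition side_words :: "nat \<Rightarrow> 'a \<Rightarrow> letter \<Rightarrow> letter list set" where
  "side_words j x s = {w \<in> class_words j x. w \<noteq> [] \<and> last w = s}"

text \<open>The mass of a half-tree under the uniform measure on the class. If the orbit misses
  \<open>D\<close>, the class is empty and the quotient is 0.\<close>

definition fraction :: "nat \<Rightarrow> 'a \<Rightarrow> letter \<Rightarrow> real" where
  "fraction j x s = real (card (side_words j x s)) / real (card (class_words j x))"

lemma first_unique: "first x v \<Longrightarrow> first x v' \<Longrightarrow> v = v'"
  unfolding first_def by (metis linorder_neqE_nat to_nat_split inj_to_nat injD)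

lemma first_exists:
  assumes "act w x \<in> D"
  shows "\<exists>v. first x v"
proof -
  let ?P = "\<lambda>i. \<exists>v. to_nat v = i \<and> act v x \<in> D"
  have "?P (to_nat w)" using assms by blast
  then have "?P (LEAST i. ?P i)" by (rule LeastI)
  then obtain v where v: "to_nat v = (LEAST i. ?P i)" "act v x \<in> D" by blast
  have "act v' x \<notin> D" if "to_nat v' < to_nat v" for v'
    using not_less_Least[of "to_nat v'" ?P] that v(1) by auto
  then show ?thesis using v(2) unfolding first_def by blast
qed

lemma related_iff: "first x v \<Longrightarrow> related j x w \<longleftrightarrow> (act v x, act w x) \<in> F j"
  unfolding related_def using first_unique by blast

lemma class_words_finite:
  assumes "x \<in> space M"
  shows "finite (class_words j x)"
proof (cases "\<exists>v. first x v")
  case True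
  then obtain v where v: "first x v" by blast
  have "(\<lambda>w. act w x) ` class_words j x \<subseteq> F j `` {act v x}"
    using related_iff[OF v] by (auto simp: class_words_def)
  then have "finite ((\<lambda>w. act w x) ` class_words j x)"
    using F_finite[of "act v x" j] v finite_subset unfolding first_def by blast
  moreover have "inj_on (\<lambda>w. act w x) (class_words j x)"
    using act_inj[OF assms] by (auto simp: class_words_def intro: inj_onI)
  ultimately show ?thesis by (simp add: finite_image_iff)
next
  case False
  then show ?thesis by (simp add: class_words_def related_def)
qed

lemma first_measurable [measurable]: "Measurable.pred M (\<lambda>x. first x v)"
  unfolding first_def by measurable

lemma related_measurable [measurable]: "Measurable.pred M (\<lambda>x. related j x w)"
proof -
  have [measurable]: "Measurable.pred M (\<lambda>x. (act v x, act w x) \<in> F j)" for v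
    by (rule pred_sets2[OF F_sets]) measurable
  show ?thesis unfolding related_def by measurable
qed

lemma card_words_measurable:
  assumes [measurable]: "\<And>w. Measurable.pred M (\<lambda>x. P x w)"
  shows "(\<lambda>x. real (card {w :: letter list. P x w})) \<in> borel_measurable M"
proof -
  have "card {w. P x w} = card {i. i \<in> range (to_nat :: letter list \<Rightarrow> nat) \<and> P x (from_nat i)}" for x
    by (rule bij_betw_same_card[of to_nat]) (auto simp: bij_betw_def inj_on_def)
  then have "(\<lambda>x. card {w. P x w}) \<in> M \<rightarrow>\<^sub>M count_space UNIV"
    by (simp only:) (rule measurable_card, measurable)
  then show ?thesis by measurable
qed

lemma fraction_measurable [measurable]: "(\<lambda>x. fraction j x s) \<in> borel_measurable M"
proof -
  have [measurable]: "(\<lambda>x. real (card (class_words j x))) \<in> borel_measurable M"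
    unfolding class_words_def by (rule card_words_measurable) measurable
  have [measurable]: "(\<lambda>x. real (card (side_words j x s))) \<in> borel_measurable M"
    unfolding side_words_def class_words_def mem_Collect_eq by (rule card_words_measurable) measurable
  show ?thesis unfolding fraction_def by measurable
qed

lemma fraction_sum_le:
  assumes "x \<in> space M"
  shows "(\<Sum>s\<in>letters k. fraction j x s) \<le> 1"
proof -
  have fin: "finite (side_words j x s)" for s
    using class_words_finite[OF assms, of j] by (simp add: side_words_def)
  have "(\<Sum>s\<in>letters k. card (side_words j x s)) = card (\<Union>s\<in>letters k. side_words j x s)"
    using fin by (intro card_UN_disjoint[symmetric]) (auto simp: side_words_def)
  also have "\<dots> \<le> card (class_words j x)"
    using class_words_finite[OF assms] by (intro card_mono) (auto simp: side_words_def)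
  finally have le: "(\<Sum>s\<in>letters k. real (card (side_words j x s))) \<le> real (card (class_words j x))"
    by (metis of_nat_le_iff of_nat_sum)
  have "(\<Sum>s\<in>letters k. fraction j x s) =
      (\<Sum>s\<in>letters k. real (card (side_words j x s))) / real (card (class_words j x))"
    unfolding fraction_def by (rule sum_divide_distrib[symmetric])
  then show ?thesis using le by (cases "card (class_words j x) = 0") (auto simp: divide_le_eq_1)
qed

lemma fraction_bounds:
  assumes "x \<in> space M"
  shows "0 \<le> fraction j x s \<and> fraction j x s \<le> 1"
proof -
  have "card (side_words j x s) \<le> card (class_words j x)"
    using class_words_finite[OF assms] by (intro card_mono) (auto simp: side_words_def)
  then show ?thesis by (auto simp: fraction_def divide_le_eq_1)
qed

text \<open>Appending \<open>s\<close> moves the root of a word from \<open>T s x\<close> to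
  \<open>x\<close>. The result is reduced exactly if the word does not start back across the edge,
  so it maps the far side, as seen from \<open>T s x\<close>, onto the side of \<open>x\<close> in
  direction \<open>s\<close>.\<close>

lemma side_words_inv:
  assumes x: "x \<in> space M" and s: "fst s < k" and eq: "\<And>w. related j (T s x) w \<longleftrightarrow> related j x (w @ [s])"
    and eq': "\<And>w. related j x w \<longleftrightarrow> related j (T s x) (w @ [inv_letter s])"
  shows "card (side_words j x s) = card (class_words j (T s x) - side_words j (T s x) (inv_letter s))"
proof -
  have "bij_betw (\<lambda>w. w @ [s]) (class_words j (T s x) - side_words j (T s x) (inv_letter s)) (side_words j x s)"
    unfolding bij_betw_def
  proof
    show "inj_on (\<lambda>w. w @ [s]) (class_words j (T s x) - side_words j (T s x) (inv_letter s))"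
      by (auto intro: inj_onI)
    show "(\<lambda>w. w @ [s]) ` (class_words j (T s x) - side_words j (T s x) (inv_letter s)) = side_words j x s"
    proof (intro equalityI subsetI)
      fix v assume "v \<in> (\<lambda>w. w @ [s]) ` (class_words j (T s x) - side_words j (T s x) (inv_letter s))"
      then obtain w where w: "v = w @ [s]" "w \<in> class_words j (T s x)" "w = [] \<or> last w \<noteq> inv_letter s"
        by (auto simp: side_words_def)
      then show "v \<in> side_words j x s"
        using s eq by (auto simp: class_words_def side_words_def reduced_words_snoc_iff)
    next
      fix v assume v: "v \<in> side_words j x s"
      then have "v = butlast v @ [s]" by (auto simp: side_words_def)
      then obtain w where w: "v = w @ [s]" by blast
      then have "w \<in> class_words j (T s x) - side_words j (T s x) (inv_letter s)"
        using v eq by (auto simp: class_words_def side_words_def reduced_words_snoc_iff)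
      then show "v \<in> (\<lambda>w. w @ [s]) ` (class_words j (T s x) - side_words j (T s x) (inv_letter s))"
        using w by blast
    qed
  qed
  then show ?thesis by (metis bij_betw_same_card)
qed

text \<open>The ends of an edge may refer to different points of \<open>D\<close>, which are related
  only from some stage \<open>J\<close> on. From then on both ends count the same class, and the
  edge splits it in two. That the identity holds only eventually is the reason for weights supported
  on tails.\<close>

lemma fraction_edge:
  assumes x: "x \<in> space M" and w: "act w x \<in> D" and s: "fst s < k"
  shows "\<exists>J. \<forall>j\<ge>J. fraction j x s + fraction j (T s x) (inv_letter s) = 1"
proof -
  let ?x = "T s x"
  obtain v where v: "first x v" using first_exists[OF w] by blast
  have "act (w @ [inv_letter s]) ?x \<in> D" using w x by simp
  then obtain v' where v': "first ?x v'" using first_exists by blast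
  let ?y = "act v x" and ?y' = "act v' ?x"
  have yD: "?y \<in> D" "?y' \<in> D" using v v' by (auto simp: first_def)
  have "?y' = act ((v' @ [s]) @ inv_word v) ?y" using x by simp
  then obtain J where J: "(?y, ?y') \<in> F J" using F_act[OF yD(1)] yD(2) by metis
  have "fraction j x s + fraction j ?x (inv_letter s) = 1" if j: "J \<le> j" for j
  proof -
    have yy: "(?y, ?y') \<in> F j" using J F_mono j by (auto simp: incseq_def)
    have F: "(?y, z) \<in> F j \<longleftrightarrow> (?y', z) \<in> F j" for z
      using yy F_equiv[of j] by (meson equivE symE transE)
    have rel: "related j x w \<longleftrightarrow> (?y, act w x) \<in> F j" "related j ?x w \<longleftrightarrow> (?y, act w ?x) \<in> F j" for w
      using related_iff[OF v] related_iff[OF v'] F by auto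
    let ?A = "side_words j x s" and ?A' = "side_words j ?x (inv_letter s)"
    let ?B = "class_words j x" and ?B' = "class_words j ?x"
    have fin: "finite ?B" "finite ?B'" using class_words_finite x by auto
    have sub: "?A \<subseteq> ?B" "?A' \<subseteq> ?B'" by (auto simp: side_words_def)
    have "card ?A = card (?B' - ?A')"
      using x s by (intro side_words_inv) (auto simp: rel)
    then have 1: "card ?B' = card ?A + card ?A'"
      using card_Diff_subset[OF finite_subset[OF sub(2) fin(2)] sub(2)] card_mono[OF fin(2) sub(2)] by simp
    have "card ?A' = card (class_words j (T (inv_letter s) ?x)
        - side_words j (T (inv_letter s) ?x) (inv_letter (inv_letter s)))"
      using x s by (intro side_words_inv) (auto simp: rel)
    then have "card ?A' = card (?B - ?A)" using x by simp
    then have 2: "card ?B = card ?A + card ?A'"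
      using card_Diff_subset[OF finite_subset[OF sub(1) fin(1)] sub(1)] card_mono[OF fin(1) sub(1)] by simp
    obtain u where "u \<in> reduced_words k" "act u x = ?y" using act_reduced[OF x] by blast
    then have "u \<in> ?B" using F_equiv[of j] yD(1) by (auto simp: class_words_def rel equiv_def refl_on_def)
    then have "card ?B > 0" using fin card_gt_0_iff by blast
    then show ?thesis
      unfolding fraction_def 1 2 by (simp flip: add_divide_distrib of_nat_add)
  qed
  then show ?thesis by blast
qed

lemma exists_potential: "\<exists>X p. potential M k T h X p \<and> (AE x in M. x \<in> X)"
proof -
  obtain Q :: "(letter list \<times> letter) pmf" where Q: "set_pmf Q = UNIV"
    using exists_full_support_pmf by blast
  \<comment> \<open>One sequence of weights must serve all words and letters. Treating these as a
    second random coordinate with full support reduces this to a single convergence statement on the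
    product space.\<close>
  interpret Q: pair_prob_space M "measure_pmf Q" ..
  let ?\<nu> = "M \<Otimes>\<^sub>M measure_pmf Q"
  define g where "g j z = fraction j (act (fst (snd z)) (fst z)) (snd (snd z))"
    for j and z :: "'a \<times> letter list \<times> letter"
  have "snd \<in> ?\<nu> \<rightarrow>\<^sub>M measure_pmf Q" by measurable
  then have snd_m [measurable]: "snd \<in> ?\<nu> \<rightarrow>\<^sub>M count_space UNIV"
    by (simp cong: measurable_cong_sets)
  have g_measurable: "g j \<in> borel_measurable ?\<nu>" for j
    unfolding g_def
    by (rule measurable_compose_countable[where f = "\<lambda>u z. fraction j (act (fst u) (fst z)) (snd u)", OF _ snd_m])
      measurable
  have g_bounds: "0 \<le> g j z \<and> g j z \<le> 1" if "z \<in> space ?\<nu>" for j z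
    unfolding g_def using that by (intro fraction_bounds) (auto simp: space_pair_measure)
  obtain a :: "nat \<Rightarrow> nat \<Rightarrow> real" where a: "\<And>i. a i \<in> tail_weights i"
    and conv: "AE z in ?\<nu>. convergent (\<lambda>i. weighted_sum (a i) (\<lambda>j. g j z))"
    using Q.convex_combinations_AE_convergent[of g, OF g_measurable g_bounds] by blast
  define b where "b i x s = weighted_sum (a i) (\<lambda>j. fraction j x s)" for i x s
  have b_measurable [measurable]: "(\<lambda>x. b i x s) \<in> borel_measurable M" for i s
    unfolding b_def weighted_sum_def by measurable
  \<comment> \<open>Convergence is demanded at all points of the orbit, which makes the set
    invariant.\<close>
  define X where "X = {x \<in> space M. (\<exists>w. act w x \<in> D) \<and> (\<forall>w s. Cauchy (\<lambda>i. b i (act w x) s))}"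
  define p where "p x s = lim (\<lambda>i. b i x s)" for x s
  have "AE x in M. AE u in measure_pmf Q. convergent (\<lambda>i. weighted_sum (a i) (\<lambda>j. g j (x, u)))"
    using Q.AE_pair[OF conv] .
  then have "AE x in M. \<forall>w s. Cauchy (\<lambda>i. b i (act w x) s)"
    by (rule AE_mp) (auto simp: AE_measure_pmf_iff Q g_def b_def Cauchy_convergent_iff)
  then have AE_X: "AE x in M. x \<in> X"
    using D_AE AE_space
  proof eventually_elim
    case (elim x)
    then have "act [] x \<in> D" by simp
    then show ?case using elim unfolding X_def by blast
  qed
  have X_sets: "X \<in> sets M"
  proof -
    have [measurable]: "Measurable.pred M (\<lambda>x. Cauchy (\<lambda>i. b i (act w x) s))" for w s
    proof -
      have [measurable]: "(\<lambda>x. b i (act w x) s) \<in> borel_measurable M" for i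
        using measurable_compose[OF act_measurable b_measurable] .
      show ?thesis unfolding pred_def by measurable
    qed
    show ?thesis unfolding X_def by measurable
  qed
  have lim: "(\<lambda>i. b i x s) \<longlonglongrightarrow> p x s" if "x \<in> X" for x s
  proof -
    have "Cauchy (\<lambda>i. b i (act [] x) s)" using that unfolding X_def by blast
    then show ?thesis by (simp add: p_def Cauchy_convergent_iff convergent_LIMSEQ_iff)
  qed
  have XT: "T s x \<in> X" if xX: "x \<in> X" for x s
  proof -
    have xs: "x \<in> space M" using xX by (simp add: X_def)
    obtain w where "act w x \<in> D" using xX by (auto simp: X_def)
    then have "act (w @ [inv_letter s]) (T s x) \<in> D" using xs by simp
    moreover have "Cauchy (\<lambda>i. b i (act v (T s x)) s')" for v s'
    proof -
      have "Cauchy (\<lambda>i. b i (act (v @ [s]) x) s')" using xX unfolding X_def by blast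
      then show ?thesis by simp
    qed
    ultimately show ?thesis using T_space[OF xs] unfolding X_def mem_Collect_eq by blast
  qed
  have "potential M k T h X p"
  proof (intro potential.intro potential_axioms.intro)
    show "letter_action M k T h" by (rule letter_action_axioms)
    show "X \<in> sets M" by fact
    show "T s x \<in> X" if "x \<in> X" for x s using XT that .
    show "(\<lambda>x. p x s) \<in> borel_measurable M" for s
      unfolding p_def by measurable
    show "0 \<le> p x s" if "x \<in> X" "fst s < k" for x s
    proof (rule LIMSEQ_le_const[OF lim[OF that(1)]])
      have "x \<in> space M" using that(1) by (simp add: X_def)
      then have "0 \<le> b i x s" for i
        unfolding b_def
        using weighted_sum_bounds[OF a[of i], of "\<lambda>j. fraction j x s"] fraction_bounds by blast
      then show "\<exists>N. \<forall>n\<ge>N. 0 \<le> b n x s" by blast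
    qed
    show "(\<Sum>s\<in>letters k. p x s) \<le> 1" if "x \<in> X" for x
    proof (rule LIMSEQ_le_const2)
      show "(\<lambda>i. \<Sum>s\<in>letters k. b i x s) \<longlonglongrightarrow> (\<Sum>s\<in>letters k. p x s)"
        using lim[OF that] by (intro tendsto_sum)
      have xs: "x \<in> space M" using that by (simp add: X_def)
      have "0 \<le> (\<Sum>s\<in>letters k. fraction j x s)" for j
        using fraction_bounds[OF xs] by (intro sum_nonneg) auto
      then have "(\<Sum>s\<in>letters k. b i x s) \<le> 1" for i
        unfolding b_def sum_weighted_sum
        using weighted_sum_bounds[OF a[of i], of "\<lambda>j. \<Sum>s\<in>letters k. fraction j x s"]
          fraction_sum_le[OF xs] by blast
      then show "\<exists>N. \<forall>n\<ge>N. (\<Sum>s\<in>letters k. b n x s) \<le> 1" by blast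
    qed
    show "p x s + p (T s x) (inv_letter s) = 1" if x: "x \<in> X" "fst s < k" for x s
    proof -
      obtain w where w: "act w x \<in> D" "x \<in> space M" using x by (auto simp: X_def)
      obtain J where J: "\<And>j. J \<le> j \<Longrightarrow> fraction j x s + fraction j (T s x) (inv_letter s) = 1"
        using fraction_edge[OF w(2,1) x(2)] by blast
      have "b i x s + b i (T s x) (inv_letter s) = 1" if "J \<le> i" for i
        unfolding b_def weighted_sum_add using J that by (intro weighted_sum_one[OF a]) auto
      then have "eventually (\<lambda>i. b i x s + b i (T s x) (inv_letter s) = 1) sequentially"
        by (auto simp: eventually_sequentially)
      then have "(\<lambda>i. b i x s + b i (T s x) (inv_letter s)) \<longlonglongrightarrow> 1"
        by (rule tendsto_eventually)
      moreover have "(\<lambda>i. b i x s + b i (T s x) (inv_letter s)) \<longlonglongrightarrow> p x s + p (T s x) (inv_letter s)"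
        using lim[OF x(1)] lim[OF XT[OF x(1)]] by (intro tendsto_add)
      ultimately show ?thesis by (rule LIMSEQ_unique[symmetric])
    qed
  qed
  then show ?thesis using AE_X by blast
qed

end

section \<open>Labellings\<close>

lemma (in hyperfinite_action) AE_labelling:
  fixes R :: "letter \<Rightarrow> (nat \<times> nat) set"
  assumes N: "1 \<le> N" and n: "1 \<le> n"
    and R: "\<And>s. R s \<subseteq> {..<n} \<times> {..<n}" "\<And>s. R (inv_letter s) = (R s)\<inverse>"
      "\<And>s l. fst s < k \<Longrightarrow> l < n \<Longrightarrow> \<exists>l'. (l, l') \<in> R s"
      "\<And>w a b. w \<in> reduced_words k \<Longrightarrow> N \<le> length w \<Longrightarrow> a < n \<Longrightarrow> b < n \<Longrightarrow> (a, b) \<in> path_rel R w"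
  shows "\<exists>X c. X \<in> sets M \<and> (AE x in M. x \<in> X) \<and> (\<forall>x\<in>X. \<forall>s. T s x \<in> X) \<and>
    c \<in> M \<rightarrow>\<^sub>M count_space UNIV \<and> (\<forall>x\<in>X. c x < n) \<and>
    (\<forall>x\<in>X. \<forall>s. fst s < k \<longrightarrow> (c x, c (T s x)) \<in> R s)"
proof -
  obtain X p where pot: "potential M k T h X p" and AE: "AE x in M. x \<in> X"
    using exists_potential by blast
  interpret potential M k T h X p by (rule pot)
  obtain Z1 dir1 Lk1 where s1: "seed_system N {x \<in> X. balanced_orbit x} Z1 dir1 Lk1"
    using balanced_orbit_seed_system by blast
  obtain Z2 dir2 Lk2 where s2: "seed_system N {x \<in> X. \<not> balanced_orbit x} Z2 dir2 Lk2"
    using end_seed_system by blast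
  obtain c1 where c1: "c1 \<in> M \<rightarrow>\<^sub>M count_space UNIV"
    "\<And>x. x \<in> {x \<in> X. balanced_orbit x} \<Longrightarrow> c1 x < n"
    "\<And>x s. x \<in> {x \<in> X. balanced_orbit x} \<Longrightarrow> fst s < k \<Longrightarrow> (c1 x, c1 (T s x)) \<in> R s"
    using seed_labelling[where R = R, OF s1 N n R] by blast
  obtain c2 where c2: "c2 \<in> M \<rightarrow>\<^sub>M count_space UNIV"
    "\<And>x. x \<in> {x \<in> X. \<not> balanced_orbit x} \<Longrightarrow> c2 x < n"
    "\<And>x s. x \<in> {x \<in> X. \<not> balanced_orbit x} \<Longrightarrow> fst s < k \<Longrightarrow> (c2 x, c2 (T s x)) \<in> R s"
    using seed_labelling[where R = R, OF s2 N n R] by blast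
  define c where "c x = (if x \<in> {x \<in> X. balanced_orbit x} then c1 x else c2 x)" for x
  have [measurable]: "c1 \<in> M \<rightarrow>\<^sub>M count_space UNIV" "c2 \<in> M \<rightarrow>\<^sub>M count_space UNIV" by fact+
  have "c \<in> M \<rightarrow>\<^sub>M count_space UNIV" unfolding c_def by measurable
  moreover have "c x < n" if "x \<in> X" for x
    using c1(2)[of x] c2(2)[of x] that by (simp add: c_def)
  moreover have "(c x, c (T s x)) \<in> R s" if "x \<in> X" "fst s < k" for x s
    using c1(3)[of x s] c2(3)[of x s] that balanced_orbit_T[OF X_space[OF that(1)]] X_invariant
    by (simp add: c_def)
  ultimately show ?thesis using AE X_sets X_invariant by (intro exI[of _ X] exI[of _ c]) simp
qed

text \<open>The set \<open>B\<close> meets every orbit at most once, so its points can be taken as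
  the roots. This is what permits their labels to be prescribed.\<close>

lemma (in letter_action) tree_labelling:
  fixes R :: "letter \<Rightarrow> (nat \<times> nat) set"
  assumes R: "\<And>s. R s \<subseteq> {..<n} \<times> {..<n}" "\<And>s. R (inv_letter s) = (R s)\<inverse>"
      "\<And>s l. fst s < k \<Longrightarrow> l < n \<Longrightarrow> \<exists>l'. (l, l') \<in> R s"
    and n: "1 \<le> n" and B: "B \<subseteq> space M" "\<And>x. x \<in> B \<Longrightarrow> e x < n"
      "\<And>x w. x \<in> B \<Longrightarrow> act w x \<in> B \<Longrightarrow> act w x = x"
  shows "\<exists>c. (\<forall>x\<in>space M. c x < n \<and> (\<forall>s. fst s < k \<longrightarrow> (c x, c (T s x)) \<in> R s)) \<and> (\<forall>x\<in>B. c x = e x)"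
proof -
  define orb where "orb x = (\<lambda>w. act w x) ` UNIV" for x
  have orb_T: "orb (T s x) = orb x" if x: "x \<in> space M" for s x
  proof (intro equalityI subsetI)
    fix y assume "y \<in> orb (T s x)"
    then obtain w where "y = act (w @ [s]) x" by (auto simp: orb_def)
    then show "y \<in> orb x" unfolding orb_def by blast
  next
    fix y assume "y \<in> orb x"
    then obtain w where "y = act w x" by (auto simp: orb_def)
    then have "y = act (w @ [inv_letter s]) (T s x)" using x by simp
    then show "y \<in> orb (T s x)" unfolding orb_def by blast
  qed
  have self: "x \<in> orb x" for x unfolding orb_def by (rule image_eqI[of _ _ "[]"]) auto
  define r where "r x = (SOME y. y \<in> orb x \<and> (orb x \<inter> B \<noteq> {} \<longrightarrow> y \<in> B))" for x
  have r: "r x \<in> orb x" "orb x \<inter> B \<noteq> {} \<Longrightarrow> r x \<in> B" for x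
  proof -
    have "\<exists>y. y \<in> orb x \<and> (orb x \<inter> B \<noteq> {} \<longrightarrow> y \<in> B)" using self by blast
    from someI_ex[OF this] show "r x \<in> orb x" "orb x \<inter> B \<noteq> {} \<Longrightarrow> r x \<in> B"
      unfolding r_def by blast+
  qed
  have r_T: "r (T s x) = r x" if "x \<in> space M" for x s using orb_T[OF that] by (simp add: r_def)
  have r_space: "r x \<in> space M" if "x \<in> space M" for x using r(1)[of x] that by (auto simp: orb_def)
  have r_B: "r x = x" if "x \<in> B" for x
  proof -
    have "r x \<in> B" using r(2)[of x] self[of x] that by blast
    moreover obtain w where "r x = act w x" using r(1)[of x] by (auto simp: orb_def)
    ultimately show ?thesis using B(3) that by simp
  qed
  have "\<exists>w. w \<in> reduced_words k \<and> act w (r x) = x" if x: "x \<in> space M" for x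
  proof -
    obtain w where w: "r x = act w x" using r(1)[of x] by (auto simp: orb_def)
    have "\<exists>v\<in>reduced_words k. act v (r x) = act (inv_word w) (r x)"
      by (rule act_reduced[OF r_space[OF x]])
    then show ?thesis using w x by auto
  qed
  then obtain wd where wd: "\<And>x. x \<in> space M \<Longrightarrow> wd x \<in> reduced_words k \<and> act (wd x) (r x) = x"
    by metis
  have wd_eq: "wd x = w" if "x \<in> space M" "w \<in> reduced_words k" "act w (r x) = x" for x w
    using wd[OF that(1)] that act_inj r_space by metis
  define lab where "lab l = rec_list l (\<lambda>s w l'. SOME l''. (l', l'') \<in> R s)" for l :: nat
  have lab_Nil: "lab l [] = l" and lab_Cons: "lab l (s # w) = (SOME l''. (lab l w, l'') \<in> R s)" for l s w
    by (auto simp: lab_def)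
  have lab: "lab l w < n \<and> (\<forall>s v. w = s # v \<longrightarrow> (lab l v, lab l w) \<in> R s)"
    if "l < n" "w \<in> reduced_words k" for l w
    using that(2)
  proof (induction w)
    case Nil
    then show ?case using that(1) by (simp add: lab_Nil)
  next
    case (Cons s w)
    have sw: "fst s < k" "w \<in> reduced_words k" using reduced_words_ConsD[OF Cons.prems] by auto
    have "(lab l w, lab l (s # w)) \<in> R s"
      unfolding lab_Cons by (rule someI_ex) (use R(3)[OF sw(1)] Cons.IH[OF sw(2)] in blast)
    then show ?case using R(1) by fastforce
  qed
  define c where "c x = lab (if r x \<in> B then e (r x) else 0) (wd x)" for x
  have "c x = e x" if "x \<in> B" for x
  proof -
    have "wd x = []" using wd_eq[of x "[]"] r_B[OF that] that B(1) by auto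
    then show ?thesis using r_B[OF that] that by (simp add: c_def lab_Nil)
  qed
  moreover have "c x < n \<and> (\<forall>s. fst s < k \<longrightarrow> (c x, c (T s x)) \<in> R s)" if x: "x \<in> space M" for x
  proof (intro conjI allI impI)
    define l where "l = (if r x \<in> B then e (r x) else 0)"
    have l: "l < n" using B(2) n by (auto simp: l_def)
    have cx: "c x = lab l (wd x)" by (simp add: c_def l_def)
    show "c x < n" unfolding cx using lab[OF l] wd[OF x] by blast
    fix s :: letter assume s: "fst s < k"
    have cT: "c (T s x) = lab l (wd (T s x))" by (simp add: c_def l_def r_T[OF x])
    have Tx: "T s x \<in> space M" using x by simp
    show "(c x, c (T s x)) \<in> R s"
    proof (cases "wd x \<noteq> [] \<and> hd (wd x) = inv_letter s")
      case True
      then obtain v where v: "wd x = inv_letter s # v" by (cases "wd x") auto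
      have red: "inv_letter s # v \<in> reduced_words k" using wd[OF x] v by simp
      have "act v (r x) = T s x" using wd[OF x] v r_space[OF x] T_inv'[of "act v (r x)" s] by auto
      then have "wd (T s x) = v"
        using wd_eq[OF Tx] reduced_words_ConsD[OF red] r_T[OF x] by simp
      then have "(c (T s x), c x) \<in> R (inv_letter s)"
        using lab[OF l red] by (simp add: cT cx v)
      then show ?thesis by (simp add: R(2))
    next
      case False
      then have red: "s # wd x \<in> reduced_words k" using wd[OF x] s by (auto simp: reduced_words_Cons_iff)
      have "wd (T s x) = s # wd x"
        using wd_eq[OF Tx red] wd[OF x] r_T[OF x] by simp
      then show ?thesis using lab[OF l red] by (simp add: cT cx)
    qed
  qed
  ultimately show ?thesis by blast
qed

section \<open>A free subgroup of rank \<open>k\<close>\<close>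

text \<open>The generator with index \<open>i\<close> is \<open>a\<^sup>i b a\<^sup>-\<^sup>i\<close>, where \<open>a\<close> and \<open>b\<close> are the first two free generators.\<close>

definition gen :: "letter \<Rightarrow> letter list" where
  "gen s = replicate (fst s) (0, True) @ [(1, snd s)] @ replicate (fst s) (0, False)"

definition gen_word :: "letter list \<Rightarrow> letter list" where
  "gen_word w = foldr (\<lambda>s v. foldr push_letter (gen s) v) w []"

lemma gen_word_simps [simp]: "gen_word [] = []"
  "gen_word (s # w) = foldr push_letter (gen s) (gen_word w)"
  by (simp_all add: gen_word_def)

lemma gen_reduced:
  assumes "2 \<le> m"
  shows "gen s \<in> reduced_words m"
proof -
  have "successively (\<lambda>x y. y \<noteq> inv_letter x) (replicate i (0, b))" for i b
    by (induction i) (auto simp: successively_Cons inv_letter_def)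
  then show ?thesis
    using assms by (auto simp: gen_def reduced_words_def successively_append_iff inv_letter_def
        successively_Cons)
qed

lemma letters_gen: "2 \<le> m \<Longrightarrow> fst ` set (gen s) \<subseteq> {..<m}"
  using gen_reduced[of m s] by (simp add: reduced_words_def)

lemma gen_word_reduced: "2 \<le> m \<Longrightarrow> gen_word w \<in> reduced_words m"
  by (induction w) (auto intro!: foldr_push_letter_reduced dest: letters_gen)

lemma push_replicate_cancel:
  "foldr push_letter (replicate i x) (replicate i (inv_letter x) @ v) = v"
proof (induction i)
  case (Suc i)
  have "replicate (Suc i) x = replicate i x @ [x]" by (simp add: replicate_append_same)
  then have "foldr push_letter (replicate (Suc i) x) u = foldr push_letter (replicate i x) (push_letter x u)" for u
    by (simp only: foldr_append) simp
  then show ?case using Suc by simp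
qed simp

lemma push_replicate:
  "v = [] \<or> hd v \<noteq> inv_letter x \<Longrightarrow> foldr push_letter (replicate i x) v = replicate i x @ v"
proof (induction i)
  case (Suc i)
  then have "foldr push_letter (replicate (Suc i) x) v = push_letter x (replicate i x @ v)" by simp
  also have "\<dots> = x # replicate i x @ v"
    using Suc.prems by (cases i; cases v) (auto simp: inv_letter_def prod_eq_iff)
  finally show ?case by simp
qed simp

lemma gen_inv: "foldr push_letter (gen (inv_letter s)) (gen s) = []"
proof -
  have a: "(0, False) = inv_letter (0, True)" "(0, True) = inv_letter (0, False)"
    by (auto simp: inv_letter_def)
  have "foldr push_letter (replicate (fst s) (0, False)) (gen s) = (1, snd s) # replicate (fst s) (0, False)"
    using push_replicate_cancel[of "fst s" "(0, False)"] unfolding gen_def a(2)[symmetric] by simp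
  moreover have "push_letter (1, \<not> snd s) ((1, snd s) # v) = v" for v by (simp add: inv_letter_def)
  moreover have "foldr push_letter (replicate (fst s) (0, True)) (replicate (fst s) (0, False)) = []"
    using push_replicate_cancel[of "fst s" "(0, True)" "[]"] unfolding a(1)[symmetric] by simp
  ultimately show ?thesis by (simp add: gen_def inv_letter_def)
qed

text \<open>Between neighbouring generators only powers of \<open>a\<close> cancel. If the exponents
  differ, a nontrivial power of \<open>a\<close> remains in between; if they agree, the two letters
  \<open>b\<close> have the same sign because the word is reduced. So the leading power of
  \<open>a\<close> and the letter after it survive, and they reveal the first generator.\<close>

lemma gen_word_form:
  assumes "s # w \<in> reduced_words k"
  shows "\<exists>v. gen_word (s # w) = replicate (fst s) (0, True) @ (1, snd s) # v"
  using assms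
proof (induction w arbitrary: s)
  case Nil
  have "foldr push_letter (gen s) [] = gen s"
    using gen_reduced[of 2 s] foldr_push_letter_Nil by blast
  then show ?case by (auto simp: gen_def)
next
  case (Cons t w)
  have red: "t # w \<in> reduced_words k" "t \<noteq> inv_letter s"
    using Cons.prems by (auto simp: reduced_words_Cons_iff)
  obtain v where v: "gen_word (t # w) = replicate (fst t) (0, True) @ (1, snd t) # v"
    using Cons.IH[OF red(1)] by blast
  have a: "inv_letter (0, True) = (0, False)" "inv_letter (0, False) = (0, True)"
    by (auto simp: inv_letter_def)
  let ?i = "fst s" and ?j = "fst t"
  define u where "u = foldr push_letter (replicate ?i (0, False)) (gen_word (t # w))"
  have u: "u \<noteq> []" "hd u \<noteq> inv_letter (1, snd s)"
  proof -
    have "u \<noteq> [] \<and> hd u \<noteq> inv_letter (1, snd s)"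
    proof (cases "?i \<le> ?j")
      case True
      then obtain d where d: "?j = ?i + d" using le_Suc_ex by blast
      have "u = replicate d (0, True) @ (1, snd t) # v"
        unfolding u_def v d replicate_add append_assoc
        using push_replicate_cancel[of ?i "(0, False)"] by (simp add: a)
      moreover have "snd t = snd s" if "d = 0"
        using red(2) d that by (auto simp: inv_letter_def prod_eq_iff)
      ultimately show ?thesis by (cases d) (auto simp: inv_letter_def)
    next
      case False
      then obtain d where d: "?i = Suc d + ?j" by (metis add.commute add_Suc_right less_imp_Suc_add not_le)
      have "u = foldr push_letter (replicate (Suc d) (0, False)) ((1, snd t) # v)"
        unfolding u_def v d replicate_add foldr_append
        using push_replicate_cancel[of ?j "(0, False)"] by (simp add: a)
      also have "\<dots> = replicate (Suc d) (0, False) @ (1, snd t) # v"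
        by (rule push_replicate) (simp add: a)
      finally show ?thesis by (simp add: inv_letter_def)
    qed
    then show "u \<noteq> []" "hd u \<noteq> inv_letter (1, snd s)" by auto
  qed
  have "gen_word (s # t # w) = foldr push_letter (replicate ?i (0, True)) (push_letter (1, snd s) u)"
    by (simp add: gen_def u_def)
  also have "push_letter (1, snd s) u = (1, snd s) # u" using u by (cases u) auto
  also have "foldr push_letter (replicate ?i (0, True)) ((1, snd s) # u) = replicate ?i (0, True) @ (1, snd s) # u"
    by (rule push_replicate) (simp add: a)
  finally show ?case by blast
qed

lemma replicate_append_Cons_eq:
  assumes "replicate i x @ y # u = replicate j x @ z # v" "y \<noteq> x" "z \<noteq> x"
  shows "i = j \<and> y = z"
  using assms
proof (induction i arbitrary: j)
  case 0
  then show ?case by (cases j) auto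
next
  case (Suc i)
  then show ?case by (cases j) auto
qed

lemma gen_word_inj:
  fixes m :: nat
  assumes m: "2 \<le> m" and "v \<in> reduced_words k" "w \<in> reduced_words k" "gen_word v = gen_word w"
  shows "v = w"
  using assms(2-)
proof (induction v arbitrary: w)
  case Nil
  show ?case
  proof (cases w)
    case (Cons s w')
    then show ?thesis using gen_word_form[of s w' k] Nil by auto
  qed simp
next
  case (Cons s v)
  obtain t w' where w: "w = t # w'"
    using gen_word_form[OF Cons.prems(1)] Cons.prems(3) by (cases w) auto
  obtain u u' where "gen_word (s # v) = replicate (fst s) (0, True) @ (1, snd s) # u"
    "gen_word (t # w') = replicate (fst t) (0, True) @ (1, snd t) # u'"
    using gen_word_form Cons.prems(1,2) unfolding w by meson
  then have st: "s = t"
    using replicate_append_Cons_eq[of "fst s" "(0, True)" "(1, snd s)" u "fst t" "(1, snd t)" u']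
      Cons.prems(3) w by (auto simp: prod_eq_iff)
  have cancel: "gen_word x = foldr push_letter (gen (inv_letter s)) (gen_word (s # x))" for x
  proof -
    have "foldr push_letter (gen (inv_letter s)) (gen_word (s # x)) =
        foldr push_letter (foldr push_letter (gen (inv_letter s)) (gen s)) (gen_word x)"
      using foldr_push_letter_assoc[OF letters_gen[OF m] gen_reduced[OF m] gen_word_reduced[OF m]] by simp
    then show ?thesis by (simp add: gen_inv)
  qed
  have "gen_word v = gen_word w'" using cancel[of v] cancel[of w'] Cons.prems(3) w st by simp
  then have "v = w'"
    using Cons.IH Cons.prems(1,2) w reduced_words_ConsD by blast
  then show ?case using st w by simp
qed

section \<open>Realizations\<close>

lemma set_push_letter: "set (push_letter s w) \<subseteq> insert s (set w)"
  by (cases w) auto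

lemma set_foldr_push_letter: "set (foldr push_letter u w) \<subseteq> set u \<union> set w"
proof (induction u)
  case (Cons s u)
  then show ?case using set_push_letter[of s "foldr push_letter u w"] by auto
qed simp

locale free_group_action =
  fixes m k :: nat and M :: "'a measure" and \<phi> :: "letter list \<Rightarrow> 'a \<Rightarrow> 'a" and h :: "'a \<Rightarrow> real"
  assumes m: "2 \<le> m" and borel: "borel_action (free_group m) M \<phi>"
    and free: "free_action (free_group m) (space M) \<phi>"
    and h_borel: "h \<in> borel_measurable M" and h_inj_on: "inj_on h (space M)"
begin

sublocale group_action "free_group m" "space M" \<phi>
  using borel by (simp add: borel_action_def)

lemma carrier_eq: "carrier (free_group m) = reduced_words m"
  and mult_eq: "g \<otimes>\<^bsub>free_group m\<^esub> g' = foldr push_letter g g'"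
  and one_eq: "\<one>\<^bsub>free_group m\<^esub> = []"
  by (simp_all add: free_group_def)

lemma \<phi>_mult:
  "x \<in> space M \<Longrightarrow> g \<in> reduced_words m \<Longrightarrow> g' \<in> reduced_words m \<Longrightarrow>
    \<phi> (foldr push_letter g g') x = \<phi> g (\<phi> g' x)"
  using composition_rule[of x g g'] by (simp add: carrier_eq mult_eq)

lemma \<phi>_Nil: "x \<in> space M \<Longrightarrow> \<phi> [] x = x"
  using fun_cong[OF id_eq_one, of x] by (simp add: one_eq)

lemma \<phi>_space: "x \<in> space M \<Longrightarrow> g \<in> reduced_words m \<Longrightarrow> \<phi> g x \<in> space M"
  using element_image[of g x] by (simp add: carrier_eq)

lemma \<phi>_inj:
  assumes "x \<in> space M" "g \<in> reduced_words m" "g' \<in> reduced_words m" "\<phi> g x = \<phi> g' x"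
  shows "g = g'"
proof -
  interpret G: group "free_group m" by (rule group_free_group)
  have c: "g \<in> carrier (free_group m)" "g' \<in> carrier (free_group m)" using assms by (auto simp: carrier_eq)
  let ?u = "inv\<^bsub>free_group m\<^esub> g' \<otimes>\<^bsub>free_group m\<^esub> g"
  have "\<phi> ?u x = \<phi> (inv\<^bsub>free_group m\<^esub> g') (\<phi> g' x)"
    using composition_rule[of x "inv\<^bsub>free_group m\<^esub> g'" g] assms c by simp
  also have "\<dots> = x" using orbit_sym_aux[OF c(2) assms(1)] by simp
  finally have "?u \<in> stabilizer (free_group m) \<phi> x" using c by (simp add: stabilizer_def)
  then have "?u = \<one>\<^bsub>free_group m\<^esub>" using free assms(1) by (simp add: free_action_def)
  then have "g' \<otimes>\<^bsub>free_group m\<^esub> ?u = g'" using c by simp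
  then show ?thesis using c by (simp flip: G.m_assoc)
qed

definition T :: "letter \<Rightarrow> 'a \<Rightarrow> 'a" where
  "T s x = (if x \<in> space M \<and> fst s < k then \<phi> (gen s) x else x)"

lemma T_space': "x \<in> space M \<Longrightarrow> T s x \<in> space M"
  using \<phi>_space gen_reduced[OF m] by (simp add: T_def)

lemma foldr_T:
  assumes "x \<in> space M" "set w \<subseteq> letters k"
  shows "foldr T w x = \<phi> (gen_word w) x"
  using assms(2)
proof (induction w)
  case Nil
  then show ?case using \<phi>_Nil assms(1) by simp
next
  case (Cons s w)
  then show ?case
    using \<phi>_mult[OF assms(1) gen_reduced[OF m] gen_word_reduced[OF m]]
      \<phi>_space[OF assms(1) gen_word_reduced[OF m]] by (simp add: T_def)
qed

sublocale letter_action M k T h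
proof
  show "T s \<in> M \<rightarrow>\<^sub>M M" for s
  proof (cases "fst s < k")
    case True
    have "\<phi> (gen s) \<in> M \<rightarrow>\<^sub>M M" using borel gen_reduced[OF m] by (simp add: borel_action_def carrier_eq)
    then show ?thesis using True by (subst measurable_cong[where g = "\<phi> (gen s)"]) (auto simp: T_def)
  next
    case False
    then show ?thesis by (subst measurable_cong[where g = "\<lambda>x. x"]) (auto simp: T_def)
  qed
  show "T s x = x" if "k \<le> fst s" "x \<in> space M" for s x using that by (simp add: T_def)
  show "T (inv_letter s) (T s x) = x" if "x \<in> space M" for s x
    using that \<phi>_mult[OF that gen_reduced[OF m] gen_reduced[OF m], of "inv_letter s" s] T_space'[OF that, of s]
    by (auto simp: T_def gen_inv \<phi>_Nil)
  show "v = w" if "x \<in> space M" "v \<in> reduced_words k" "w \<in> reduced_words k" "foldr T v x = foldr T w x" for x v w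
    using that foldr_T[OF that(1) reduced_words_letters] \<phi>_inj[OF that(1) gen_word_reduced[OF m] gen_word_reduced[OF m]]
      gen_word_inj[OF m that(2,3)] by metis
qed (use h_borel h_inj_on in auto)

text \<open>A labelling built from seeds may omit some labels. These points lie in different orbits
  of the subgroup, so each can be given its own label, which makes every piece nonempty.\<close>

definition base_point :: "'a \<Rightarrow> nat \<Rightarrow> 'a" where
  "base_point x i = \<phi> (replicate i (0, True)) x"

lemma replicate_reduced: "replicate i (0, b) \<in> reduced_words m"
proof -
  have "successively (\<lambda>x y. y \<noteq> inv_letter x) (replicate i (0, b))"
    by (induction i) (auto simp: successively_Cons inv_letter_def)
  then show ?thesis using m by (auto simp: reduced_words_def)
qed

text \<open>Words in the chosen generators contain the letter \<open>b\<close>, but quotients of powers of \<open>a\<close> do not.\<close>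

lemma base_points_inequivalent:
  assumes x: "x \<in> space M" and eq: "act w (base_point x i) = base_point x j"
  shows "i = j"
proof -
  let ?a = "\<lambda>i. replicate i (0, True)" and ?A = "\<lambda>i. replicate i (0, False)"
  have bp: "base_point x i \<in> space M" unfolding base_point_def by (rule \<phi>_space[OF x replicate_reduced])
  obtain v where v: "v \<in> reduced_words k" "act v (base_point x i) = base_point x j"
    using act_reduced[OF bp, of w] eq by auto
  have aA: "foldr push_letter (?a i) (?A i) = []"
    using push_replicate_cancel[of i "(0, True)" "[]"] by (simp add: inv_letter_def)
  have "\<phi> (gen_word v) (\<phi> (?a i) x) = \<phi> (?a j) x"
    using v(2) foldr_T[OF bp reduced_words_letters[OF v(1)]] by (simp add: base_point_def)
  then have "\<phi> (foldr push_letter (gen_word v) (?a i)) x = \<phi> (?a j) x"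
    using \<phi>_mult[OF x gen_word_reduced[OF m] replicate_reduced] by simp
  moreover have gv: "fst ` set (gen_word v) \<subseteq> {..<m}"
    using gen_word_reduced[OF m, of v] by (simp add: reduced_words_def)
  ultimately have a: "foldr push_letter (gen_word v) (?a i) = ?a j"
    by (intro \<phi>_inj[OF x] foldr_push_letter_reduced replicate_reduced) auto
  have "foldr push_letter (?a j) (?A i) = foldr push_letter (gen_word v) (foldr push_letter (?a i) (?A i))"
    unfolding a[symmetric] by (rule foldr_push_letter_assoc[OF gv replicate_reduced replicate_reduced])
  also have "\<dots> = gen_word v" unfolding aA by (rule foldr_push_letter_Nil[OF gen_word_reduced[OF m]])
  finally have "set (gen_word v) \<subseteq> {(0, True), (0, False)}"
    using set_foldr_push_letter[of "?a j" "?A i"] by (auto split: if_splits)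
  then have "v = []"
    using gen_word_form[of "hd v" "tl v" k] v(1) by (cases v) auto
  then show ?thesis using a by (auto dest: arg_cong[of _ _ length])
qed

lemma singleton_sets: "x \<in> space M \<Longrightarrow> {x} \<in> sets M"
proof -
  assume x: "x \<in> space M"
  have "{x} = {y \<in> space M. h y = h x}" using x h_inj by (auto dest: inj_onD)
  also have "\<dots> \<in> sets M" by measurable
  finally show ?thesis .
qed

text \<open>The pairs of label sets realized by some group element form an equivalence relation,
  because elements can be composed and inverted, and complements are respected because the action is
  by bijections. Hence realizing the generating pairs is enough.\<close>

lemma realization_of_labelling:
  assumes c: "\<And>x. x \<in> space M \<Longrightarrow> c x < n"
    and surj: "\<And>i. i < n \<Longrightarrow> \<exists>x\<in>space M. c x = i"
    and AB: "\<And>i. i < k \<Longrightarrow> A i \<in> proper_subsets n \<and> B i \<in> proper_subsets n"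
    and gen: "\<And>Q. equiv (proper_subsets n) Q \<Longrightarrow>
       (\<And>U V. (U, V) \<in> Q \<Longrightarrow> ({..<n} - U, {..<n} - V) \<in> Q) \<Longrightarrow>
       (\<And>i. i < k \<Longrightarrow> (A i, B i) \<in> Q) \<Longrightarrow> E \<subseteq> Q"
    and R: "\<And>x s. x \<in> space M \<Longrightarrow> fst s < k \<Longrightarrow> (c x, c (T s x)) \<in> cong_rel n A B s"
  shows "realization (free_group m) (space M) \<phi> n E (\<lambda>i. {x \<in> space M. c x = i})"
proof -
  let ?P = "\<lambda>i. {x \<in> space M. c x = i}" and ?G = "free_group m"
  let ?U = "\<lambda>U. {x \<in> space M. c x \<in> U}"
  interpret G: group ?G by (rule group_free_group)
  have Un: "(\<Union>i\<in>U. ?P i) = ?U U" for U by auto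
  define Q where "Q = {(U, V). U \<in> proper_subsets n \<and> V \<in> proper_subsets n \<and>
    (\<exists>g\<in>carrier ?G. \<phi> g ` ?U U = ?U V)}"
  have Q_iff: "\<phi> g ` ?U U = ?U V \<longleftrightarrow> (\<forall>x\<in>space M. c x \<in> U \<longleftrightarrow> c (\<phi> g x) \<in> V)"
    if g: "g \<in> carrier ?G" for g U V
  proof
    assume e: "\<phi> g ` ?U U = ?U V"
    show "\<forall>x\<in>space M. c x \<in> U \<longleftrightarrow> c (\<phi> g x) \<in> V"
    proof
      fix x assume x: "x \<in> space M"
      have gx: "\<phi> g x \<in> space M" using element_image[OF g x] by simp
      show "c x \<in> U \<longleftrightarrow> c (\<phi> g x) \<in> V"
      proof
        assume "c x \<in> U"
        then have "\<phi> g x \<in> ?U V" unfolding e[symmetric] using x by blast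
        then show "c (\<phi> g x) \<in> V" by simp
      next
        assume "c (\<phi> g x) \<in> V"
        then have "\<phi> g x \<in> \<phi> g ` ?U U" unfolding e using gx by simp
        then obtain y where y: "y \<in> space M" "c y \<in> U" "\<phi> g x = \<phi> g y" by auto
        then have "x = y" using inj_prop[OF g] x by (auto dest: inj_onD)
        then show "c x \<in> U" using y by simp
      qed
    qed
  next
    assume e: "\<forall>x\<in>space M. c x \<in> U \<longleftrightarrow> c (\<phi> g x) \<in> V"
    show "\<phi> g ` ?U U = ?U V"
    proof (intro equalityI subsetI)
      fix y assume "y \<in> \<phi> g ` ?U U"
      then show "y \<in> ?U V" using e element_image[OF g] by auto
    next
      fix y assume y: "y \<in> ?U V"
      then obtain x where "x \<in> space M" "y = \<phi> g x" using surj_prop[OF g] by auto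
      then show "y \<in> \<phi> g ` ?U U" using e y by auto
    qed
  qed
  have Q: "(U, V) \<in> Q \<longleftrightarrow> U \<in> proper_subsets n \<and> V \<in> proper_subsets n \<and>
    (\<exists>g\<in>carrier ?G. \<forall>x\<in>space M. c x \<in> U \<longleftrightarrow> c (\<phi> g x) \<in> V)" for U V
    using Q_iff by (auto simp: Q_def)
  have "equiv (proper_subsets n) Q"
  proof (rule equivI)
    show "Q \<subseteq> proper_subsets n \<times> proper_subsets n" by (auto simp: Q_def)
    show "refl_on (proper_subsets n) Q"
    proof (rule refl_onI)
      fix U assume "U \<in> proper_subsets n"
      moreover have "\<forall>x\<in>space M. c x \<in> U \<longleftrightarrow> c (\<phi> [] x) \<in> U" by (simp add: \<phi>_Nil)
      ultimately show "(U, U) \<in> Q" unfolding Q using G.one_closed by (auto simp: one_eq)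
    qed
    show "sym Q"
    proof (rule symI)
      fix U V assume "(U, V) \<in> Q"
      then obtain g where g: "U \<in> proper_subsets n" "V \<in> proper_subsets n" "g \<in> carrier ?G"
        "\<forall>x\<in>space M. c x \<in> U \<longleftrightarrow> c (\<phi> g x) \<in> V" unfolding Q by blast
      have "c y \<in> V \<longleftrightarrow> c (\<phi> (inv\<^bsub>?G\<^esub> g) y) \<in> U" if y: "y \<in> space M" for y
      proof -
        obtain x where x: "x \<in> space M" "y = \<phi> g x" using surj_prop[OF g(3)] y by auto
        then show ?thesis using g(4) orbit_sym_aux[OF g(3) x(1)] by simp
      qed
      then show "(V, U) \<in> Q" unfolding Q using g G.inv_closed[OF g(3)] by blast
    qed
    show "trans Q"
    proof (rule transI)
      fix U V W assume "(U, V) \<in> Q" "(V, W) \<in> Q"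
      then obtain g g' where g: "U \<in> proper_subsets n" "W \<in> proper_subsets n" "g \<in> carrier ?G"
        "g' \<in> carrier ?G" "\<forall>x\<in>space M. c x \<in> U \<longleftrightarrow> c (\<phi> g x) \<in> V"
        "\<forall>x\<in>space M. c x \<in> V \<longleftrightarrow> c (\<phi> g' x) \<in> W" unfolding Q by blast
      have "c x \<in> U \<longleftrightarrow> c (\<phi> (g' \<otimes>\<^bsub>?G\<^esub> g) x) \<in> W" if x: "x \<in> space M" for x
        using g(5,6) x element_image[OF g(3) x] composition_rule[OF x g(4,3)] by simp
      then show "(U, W) \<in> Q" unfolding Q using g G.m_closed[OF g(4,3)] by blast
    qed
  qed
  moreover have "({..<n} - U, {..<n} - V) \<in> Q" if UV: "(U, V) \<in> Q" for U V
  proof -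
    obtain g where g: "U \<in> proper_subsets n" "V \<in> proper_subsets n" "g \<in> carrier ?G"
      "\<forall>x\<in>space M. c x \<in> U \<longleftrightarrow> c (\<phi> g x) \<in> V" using UV unfolding Q by blast
    have "\<forall>x\<in>space M. c x \<in> {..<n} - U \<longleftrightarrow> c (\<phi> g x) \<in> {..<n} - V"
      using g(4) c element_image[OF g(3)] by simp
    then show ?thesis unfolding Q using g(3) proper_subsets_compl g(1,2) by blast
  qed
  moreover have "(A i, B i) \<in> Q" if i: "i < k" for i
  proof -
    have "c x \<in> A i \<longleftrightarrow> c (\<phi> (gen (i, True)) x) \<in> B i" if x: "x \<in> space M" for x
      using R[OF x, of "(i, True)"] i x by (simp add: cong_rel_def T_def)
    moreover have "gen (i, True) \<in> carrier ?G" using gen_reduced[OF m] by (simp add: carrier_eq)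
    ultimately show ?thesis unfolding Q using AB[OF i] by blast
  qed
  ultimately have "E \<subseteq> Q" by (rule gen)
  show ?thesis
    unfolding realization_def Un
  proof (intro conjI allI impI)
    show "inj_on ?P {..<n}"
    proof (rule inj_onI)
      fix i j assume "i \<in> {..<n}" "?P i = ?P j"
      then show "i = j" using surj[of i] by auto
    qed
    show "partition_on (space M) (?P ` {..<n})"
    proof (rule partition_onI)
      show "\<Union> (?P ` {..<n}) = space M" using c by auto
      show "{} \<notin> ?P ` {..<n}" using surj by fastforce
      show "disjnt p p'" if "p \<in> ?P ` {..<n}" "p' \<in> ?P ` {..<n}" "p \<noteq> p'" for p p'
        using that by (auto simp: disjnt_def)
    qed
    show "\<exists>g\<in>carrier ?G. \<phi> g ` ?U U = ?U V" if "(U, V) \<in> E" for U V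
      using \<open>E \<subseteq> Q\<close> that by (auto simp: Q_def)
  qed
qed

lemma measurable_realization:
  assumes hyp: "mu_hyperfinite (free_group m) M \<phi>" and prob: "prob_space M"
    and n: "1 \<le> n"
    and AB: "\<And>i. i < k \<Longrightarrow> A i \<in> proper_subsets n \<and> B i \<in> proper_subsets n"
    and gen: "\<And>Q. equiv (proper_subsets n) Q \<Longrightarrow>
       (\<And>U V. (U, V) \<in> Q \<Longrightarrow> ({..<n} - U, {..<n} - V) \<in> Q) \<Longrightarrow>
       (\<And>i. i < k \<Longrightarrow> (A i, B i) \<in> Q) \<Longrightarrow> E \<subseteq> Q"
    and mixing: "\<And>w a b. w \<in> reduced_words k \<Longrightarrow> N \<le> length w \<Longrightarrow> a < n \<Longrightarrow> b < n \<Longrightarrow>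
       (a, b) \<in> path_rel (cong_rel n A B) w"
    and N: "1 \<le> N"
  shows "\<exists>P. realization (free_group m) (space M) \<phi> n E P \<and> (\<forall>i<n. P i \<in> sets (completion M))"
proof -
  interpret prob_space M by fact
  obtain D F where D: "D \<in> sets M" "space M - D \<in> null_sets M" and F: "incseq F"
    "\<forall>k. equiv D (F k) \<and> F k \<in> sets (M \<Otimes>\<^sub>M M) \<and> (\<forall>x\<in>D. finite (F k `` {x}))"
    "orbit_rel (free_group m) (space M) \<phi> \<inter> D \<times> D = (\<Union>k. F k)"
    using hyp unfolding mu_hyperfinite_def by blast
  interpret hyperfinite_action M k T h D F
  proof
    show "D \<in> sets M" "incseq F" by fact+
    show "AE x in M. x \<in> D" using D(2) by (rule AE_I') auto
    show "equiv D (F j)" "F j \<in> sets (M \<Otimes>\<^sub>M M)" for j using F(2) by auto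
    show "finite (F j `` {x})" if "x \<in> D" for x j using F(2) that by auto
    show "\<exists>j. (x, act w x) \<in> F j" if x: "x \<in> D" "act w x \<in> D" for x w
    proof -
      have xs: "x \<in> space M" using x(1) D(1) sets.sets_into_space by blast
      obtain v where v: "v \<in> reduced_words k" "act v x = act w x" using act_reduced[OF xs] by blast
      have "act w x = \<phi> (gen_word v) x" using v foldr_T[OF xs reduced_words_letters[OF v(1)]] by simp
      then have "act w x \<in> orbit (free_group m) \<phi> x"
        using gen_word_reduced[OF m] unfolding orbit_def carrier_eq by blast
      then have "(x, act w x) \<in> orbit_rel (free_group m) (space M) \<phi> \<inter> D \<times> D"
        using x xs by (simp add: orbit_rel_def)
      then show ?thesis unfolding F(3) by blast
    qed
  qed
  let ?R = "cong_rel n A B"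
  have R: "?R s \<subseteq> {..<n} \<times> {..<n}" "?R (inv_letter s) = (?R s)\<inverse>" for s
    by (rule cong_rel_bounded, rule cong_rel_inv_letter)
  have R_total: "\<exists>l'. (l, l') \<in> ?R s" if "fst s < k" "l < n" for s l
    using cong_rel_total AB that by blast
  obtain X c1 where X: "X \<in> sets M" "AE x in M. x \<in> X" "\<forall>x\<in>X. \<forall>s. T s x \<in> X"
    and c1: "c1 \<in> M \<rightarrow>\<^sub>M count_space UNIV" "\<forall>x\<in>X. c1 x < n"
      "\<forall>x\<in>X. \<forall>s. fst s < k \<longrightarrow> (c1 x, c1 (T s x)) \<in> ?R s"
    using AE_labelling[OF N n R R_total mixing] by blast
  obtain x0 where x0: "x0 \<in> space M" using not_empty by blast
  let ?b = "base_point x0"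
  have b: "?b i \<in> space M" for i unfolding base_point_def by (rule \<phi>_space[OF x0 replicate_reduced])
  have b_ineq: "i = j" if "act w (?b i) = ?b j" for w i j
    using base_points_inequivalent[OF x0 that] .
  have b_inj: "inj_on ?b {..<n}"
    by (rule inj_onI) (use b_ineq[of "[]"] in simp)
  define e where "e = the_inv_into {..<n} ?b"
  have e: "e (?b i) = i" if "i < n" for i
    using the_inv_into_f_f[OF b_inj, of i] that by (simp add: e_def)
  have e_lt: "e x < n" if "x \<in> ?b ` {..<n}" for x using that e by auto
  have b_sub: "?b ` {..<n} \<subseteq> space M" using b by blast
  have b_orb: "act w x = x" if "x \<in> ?b ` {..<n}" "act w x \<in> ?b ` {..<n}" for x w
    using that b_ineq by force
  obtain c2 where c2: "\<forall>x\<in>space M. c2 x < n \<and> (\<forall>s. fst s < k \<longrightarrow> (c2 x, c2 (T s x)) \<in> ?R s)"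
    and c2_b: "\<forall>x\<in>?b ` {..<n}. c2 x = e x"
    using tree_labelling[where R = ?R and e = e, OF R R_total n b_sub e_lt b_orb] by blast
  \<comment> \<open>The orbits of the base points are countable and invariant. They are taken out of
    the measurable part so that the prescribed labels can be used on them.\<close>
  define C where "C = (\<Union>i<n. range (\<lambda>w. act w (?b i)))"
  have C_space: "C \<subseteq> space M" unfolding C_def using act_space[OF b] by blast
  have C_countable: "countable C"
    unfolding C_def
    by (rule countable_UN[OF countable_finite[OF finite_lessThan]]) (rule countable_image[OF countableI_type])
  have sets_countable: "S \<in> sets M" if "S \<subseteq> C" for S
    by (rule sets.countable[OF _ countable_subset[OF that C_countable]])
      (use that C_space singleton_sets in blast)
  have C_T: "T s x \<in> C" if x: "x \<in> C" for x s
  proof -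
    obtain i w where "i < n" "x = act w (?b i)" using x unfolding C_def by blast
    then have "T s x = act (s # w) (?b i)" by simp
    then show ?thesis using \<open>i < n\<close> unfolding C_def by blast
  qed
  define Y where "Y = X - C"
  have Y_space: "Y \<subseteq> space M" using sets.sets_into_space[OF X(1)] by (auto simp: Y_def)
  have Y_sets: "Y \<in> sets M" using X(1) sets_countable[of C] by (auto simp: Y_def)
  have Y_T: "T s x \<in> Y \<longleftrightarrow> x \<in> Y" if x: "x \<in> space M" for s x
  proof -
    have "T s y \<in> Y" if y: "y \<in> Y" for y s
    proof -
      have ys: "y \<in> space M" using y Y_space by blast
      have "T s y \<notin> C" using C_T[of "T s y" "inv_letter s"] ys y by (auto simp: Y_def)
      then show ?thesis using X(3) y unfolding Y_def by blast
    qed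
    then show ?thesis using T_inv[OF x] by metis
  qed
  define c where "c x = (if x \<in> Y then c1 x else c2 x)" for x
  have c_R: "(c x, c (T s x)) \<in> ?R s" if "x \<in> space M" "fst s < k" for x s
  proof (cases "x \<in> Y")
    case True
    then have "c x = c1 x" "c (T s x) = c1 (T s x)" using Y_T[OF that(1)] by (simp_all add: c_def)
    moreover have "x \<in> X" using True by (simp add: Y_def)
    ultimately show ?thesis using c1(3) that(2) by presburger
  next
    case False
    then have "c x = c2 x" "c (T s x) = c2 (T s x)" using Y_T[OF that(1)] by (simp_all add: c_def)
    then show ?thesis using c2 that by presburger
  qed
  have c_lt: "c x < n" if "x \<in> space M" for x
    using c1(2) c2 that by (auto simp: c_def Y_def)
  have c_surj: "\<exists>x\<in>space M. c x = i" if i: "i < n" for i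
  proof
    have "?b i \<in> C" unfolding C_def using i by (auto intro!: bexI[of _ i] range_eqI[of _ _ "[]"])
    then show "c (?b i) = i" using c2_b e i by (simp add: c_def Y_def)
  qed (rule b)
  have "{x \<in> space M. c x = i} \<in> sets (completion M)" for i
  proof -
    let ?S = "{x \<in> space M. c x = i}"
    have 1: "?S \<inter> Y \<in> sets M"
    proof -
      have "?S \<inter> Y = {x \<in> space M. c1 x = i} \<inter> Y" by (auto simp: c_def)
      also have "\<dots> \<in> sets M" using c1(1) Y_sets by measurable
      finally show ?thesis .
    qed
    have 2: "?S \<inter> C \<in> sets M" by (rule sets_countable) auto
    have "space M - X \<in> null_sets M" using X(1,2) by (subst (asm) AE_iff_null) (auto simp: set_diff_eq)
    then have 3: "?S - X \<in> sets (completion M)"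
      using null_sets_completion_subset[of "?S - X" "space M - X" M] null_sets_completionI by auto
    \<comment> \<open>A measurable part, a countable part and a subset of a null set; only the last
      calls for the completion.\<close>
    have "?S = ((?S \<inter> Y) \<union> (?S \<inter> C)) \<union> (?S - X)" by (auto simp: Y_def)
    also have "\<dots> \<in> sets (completion M)" 
      by (rule sets.Un[OF sets_completionI_sets[OF sets.Un[OF 1 2]] 3])
    finally show ?thesis .
  qed
  moreover have "realization (free_group m) (space M) \<phi> n E (\<lambda>i. {x \<in> space M. c x = i})"
    using realization_of_labelling[OF c_lt c_surj AB gen c_R] .
  ultimately show ?thesis by blast
qed

end

theorem theorem4p3:
  fixes m n :: nat
    and M :: "'a measure"
    and \<phi> :: "letter list \<Rightarrow> 'a \<Rightarrow> 'a"
    and E :: "(nat set \<times> nat set) set"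
  assumes "2 \<le> m"
    and "standard_prob_space M"
    and "borel_action (free_group m) M \<phi>"
    and "free_action (free_group m) (space M) \<phi>"
    and "mu_hyperfinite (free_group m) M \<phi>"
    and "1 \<le> n"
    and "abstract_system n E"
    and "non_complementing n E"
    and "non_expanding E"
  shows "\<exists>A. realization (free_group m) (space M) \<phi> n E A \<and>
             (\<forall>i<n. A i \<in> sets (completion M))"
proof (rule exists_star_generators[OF assms(7-9)])
  fix k :: nat and A B :: "nat \<Rightarrow> nat set"
  assume gens: "\<And>i. i < k \<Longrightarrow> A i \<in> proper_subsets n \<and> B i \<in> proper_subsets n"
    "\<And>Q. equiv (proper_subsets n) Q \<Longrightarrow> (\<And>U V. (U, V) \<in> Q \<Longrightarrow> ({..<n} - U, {..<n} - V) \<in> Q) \<Longrightarrow>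
       (\<And>i. i < k \<Longrightarrow> (A i, B i) \<in> Q) \<Longrightarrow> E \<subseteq> Q"
    "\<And>w a b. w \<in> reduced_words k \<Longrightarrow> 3 * 2 ^ n + 3 \<le> length w \<Longrightarrow> a < n \<Longrightarrow> b < n \<Longrightarrow>
       (a, b) \<in> path_rel (cong_rel n A B) w"
  obtain h :: "'a \<Rightarrow> real" where h: "h \<in> borel_measurable M" "inj_on h (space M)"
    using standard_borel_space_injection[of M] assms(2) unfolding standard_prob_space_def by blast
  interpret free_group_action m k M \<phi> h
    by standard (use assms h in auto)
  have "prob_space M" using assms(2) by (simp add: standard_prob_space_def)
  moreover have "1 \<le> 3 * 2 ^ n + (3 :: nat)" by (rule trans_le_add2) simp
  ultimately show ?thesis
    using measurable_realization[OF assms(5) _ assms(6) gens] by blast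
qed

end
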